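(* Let $G$ with Lie algebra $\mathcal G$ be as in one of the following two settings: (I) $G=\mathrm{GL}(n,\mathbb F_q)$, $q$ a prime power, and $P=LU$, $P'=L'U'$ are two of its standard parabolic subgroups $P_{i,j}=L_{i,j}U_{i,j}$, $i+j=n$ (with possibly different pairs $(i,j)$ for $P$ and $P'$); or (II) $G=\mathrm U(2n,\mathbb F_{q^2})$, $q$ an odd prime power, and $P=LU$, $P'=L'U'$ are two of its standard parabolic subgroups $\widetilde P_{i,j}=\widetilde L_{i,j}\widetilde U_{i,j}$, $i+j=n$ (with possibly different pairs $(i,j)$). Let $W$ be the Weyl group, embedded in $G$ as a subgroup of permutation matrices. For $w\in W$ let $\mathcal L_w$, $\mathcal L'_w$, $T_w$ and the parabolic restriction and induction maps be as in the context. Then the following identity between linear maps $\mathcal C(\mathcal L)\to\mathcal C(\mathcal L')$ holds: $$ \downarrow^{\mathcal G}_{\mathcal L'}\circ\uparrow^{\mathcal G}_{\mathcal L}\;=\;\sum_{w\in[(W\cap L')\backslash W/(W\cap L)]}\uparrow^{\mathcal L'}_{\mathcal L'_w}\circ\, T_w\circ\downarrow^{\mathcal L}_{\mathcal L_w}, $$ where $w$ ranges over a set of representatives of the double cosets $(W\cap L')\backslash W/(W\cap L)$.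
   Context: Invariant functions. For a finite matrix group $H$ with Lie algebra $\mathcal H$ (on which $H$ acts by $\mathrm{Ad}(h)X=hXh^{-1}$), $\mathcal C(\mathcal H)$ is the real vector space of functions $\mathcal H\to\mathbb R$ constant on $H$-orbits. Parabolic restriction and induction. Let $P=LU<G$ be a parabolic subgroup with its Levi decomposition ($L$ Levi subgroup, $U$ unipotent radical), with Lie algebras $\mathcal P=\mathcal L\oplus\mathcal U$. The parabolic restriction $\downarrow^{\mathcal G}_{\mathcal L}:\mathcal C(\mathcal G)\to\mathcal C(\mathcal L)$ is $$(\downarrow^{\mathcal G}_{\mathcal L}\Psi)(Y)=\frac1{|\mathcal U|}\sum_{Z\in\mathcal U}\Psi(Y+Z),\qquad Y\in\mathcal L.$$ The parabolic induction $\uparrow^{\mathcal G}_{\mathcal L}:\mathcal C(\mathcal L)\to\mathcal C(\mathcal G)$ is $$(\uparrow^{\mathcal G}_{\mathcal L}\Phi)(X)=\sum_{g\in[G/P]}\Phi'(g^{-1}Xg),\qquad X\in\mathcal G,$$ where $[G/P]$ is any set of representatives of left cosets of $P$ in $G$, and $\Phi':\mathcal G\to\mathbb R$ equals $\Phi\circ\pi$ on $\mathcal P$ ($\pi:\mathcal P=\mathcal L\oplus\mathcal U\to\mathcal L$ the projection) and $0$ on $\mathcal G\setminus\mathcal P$. (The notation suppresses the dependence on $P$.) The same definitions are used with $G$ replaced by $L$ or $L'$. Setting I. $G=\mathrm{GL}(n,\mathbb F_q)$, $\mathcal G=\mathfrak{gl}(n,\mathbb F_q)$ = all $n\times n$ matrices.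 For $i,j\ge0$, $i+j=n$, in block form with respect to $n=i+j$: $P_{i,j}=L_{i,j}U_{i,j}$ with $L_{i,j}=\{\mathrm{diag}(A,B): A\in\mathrm{GL}(i,\mathbb F_q),B\in\mathrm{GL}(j,\mathbb F_q)\}$ and $U_{i,j}=\{\begin{bmatrix}1&C\\0&1\end{bmatrix}: C\in\mathrm{Mat}_{i\times j}(\mathbb F_q)\}$. $W$ is the group of all $n\times n$ permutation matrices. Setting II. For a matrix $A=(a_{rs})$ over $\mathbb F_{q^2}$ let $A^*$ be the transpose of $(a_{rs}^q)$. $J_m$ is the $m\times m$ matrix with $1$'s on the antidiagonal and $0$ elsewhere. $G=\mathrm U(2n,\mathbb F_{q^2})=\{g\in\mathrm{GL}(2n,\mathbb F_{q^2}): g^*J_{2n}g=J_{2n}\}$, $\mathcal G=\mathfrak u(2n,\mathbb F_{q^2})=\{X\in\mathfrak{gl}(2n,\mathbb F_{q^2}): X^*J_{2n}+J_{2n}X=0\}$. For $i,j\ge0$, $i+j=n$, in block form with respect to $2n=i+2j+i$: $\widetilde P_{i,j}=\widetilde L_{i,j}\widetilde U_{i,j}$ with $\widetilde L_{i,j}=\{\mathrm{diag}(A,B,A'): A\in\mathrm{GL}(i,\mathbb F_{q^2}),\,B\in\mathrm U(2j,\mathbb F_{q^2}),\,A'=J_i(A^* )^{-1}J_i\}$ and $$\widetilde U_{i,j}=\left\{\begin{bmatrix}I_i&C&D\\0&I_{2j}&C'\\0&0&I_i\end{bmatrix}: C'=-J_{2j}C^*J_i,\ J_iD+D^*J_i=-J_iCJ_{2j}C^*J_i\right\}.$$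 Their Lie algebras are the sets of matrices in $\mathfrak u(2n,\mathbb F_{q^2})$ that are block diagonal, respectively strictly block upper triangular. $W$ is the Weyl group with respect to the maximal torus of diagonal matrices, realized as the group of permutation matrices belonging to $G$. Objects attached to $w\in W$. Put $L_w=L\cap w^{-1}L'w$, $U_w=L\cap w^{-1}U'w$, $L'_w=L'\cap wLw^{-1}$, $U'_w=L'\cap wUw^{-1}$. Then $P_w=L_wU_w$ and $P'_w=L'_wU'_w$ are parabolic subgroups (with these Levi decompositions) of $L$ and $L'$, respectively. Let $\mathcal L,\mathcal L',\mathcal U,\mathcal U'$ be the Lie algebras of $L,L',U,U'$. The Lie algebras of $L_w,U_w,L'_w,U'_w$ are $\mathcal L_w=\mathcal L\cap w^{-1}\mathcal L'w$, $\mathcal L\cap w^{-1}\mathcal U'w$, $\mathcal L'_w=\mathcal L'\cap w\mathcal Lw^{-1}$, $\mathcal L'\cap w\,\mathcal U w^{-1}$. The maps $\downarrow^{\mathcal L}_{\mathcal L_w}$ and $\uparrow^{\mathcal L'}_{\mathcal L'_w}$ are parabolic restriction and induction with respect to $P_w<L$ and $P'_w<L'$. $T_w:\mathcal C(\mathcal L_w)\to\mathcal C(\mathcal L'_w)$ is the isomorphism $(T_wf)(X)=f(w^{-1}Xw)$. The maps $\uparrow^{\mathcal G}_{\mathcal L}$ and $\downarrow^{\mathcal G}_{\mathcal L'}$ are taken with respect to $P$ and $P'$. *)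

theory Defs
  imports
    "Jordan_Normal_Form.Matrix"
    "HOL-Algebra.Coset"
    "HOL-Combinatorics.Permutations"
    "HOL-Library.FuncSet"
    "HOL-Library.Cardinality"
    "HOL-Number_Theory.Prime_Powers"
begin

section \<open>Matrix groups, cosets, invariant functions\<close>

definition GL :: "nat \<Rightarrow> 'a::field mat monoid" where
  "GL n = units_of (ring_mat TYPE('a) n ())"

definition Ad :: "nat \<Rightarrow> 'a::field mat \<Rightarrow> 'a mat \<Rightarrow> 'a mat" where
  "Ad n g X = g * X * inv\<^bsub>GL n\<^esub> g"

text \<open>
  Groups and Lie algebras are sets of \<open>n \<times> n\<close> matrices. Functions on a Lie algebra are
  extensional, so that equality of functions is equality on that Lie algebra.
\<close>

definition invariant_funs :: "nat \<Rightarrow> 'a::field mat set \<Rightarrow> 'a mat set \<Rightarrow> ('a mat \<Rightarrow> real) set" where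
  "invariant_funs n H HH =
     {f \<in> extensional HH. \<forall>h\<in>H. \<forall>X\<in>HH. f (Ad n h X) = f X}"

definition left_coset_reps :: "nat \<Rightarrow> 'a::field mat set \<Rightarrow> 'a mat set \<Rightarrow> 'a mat set \<Rightarrow> bool" where
  "left_coset_reps n R G H \<longleftrightarrow>
     R \<subseteq> G \<and> (\<forall>g\<in>G. \<exists>!r. r \<in> R \<and> g \<in> r <#\<^bsub>GL n\<^esub> H)"

definition double_coset_reps ::
  "nat \<Rightarrow> 'a::field mat set \<Rightarrow> 'a mat set \<Rightarrow> 'a mat set \<Rightarrow> 'a mat set \<Rightarrow> bool" where
  "double_coset_reps n D K W H \<longleftrightarrow>
     D \<subseteq> W \<and> (\<forall>x\<in>W. \<exists>!w. w \<in> D \<and> x \<in> (K #>\<^bsub>GL n\<^esub> w) <#>\<^bsub>GL n\<^esub> H)"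


section \<open>Parabolic restriction and induction\<close>

text \<open>
  A parabolic subgroup with its Levi decomposition is recorded by the Levi subgroup, the
  unipotent radical and their Lie algebras.
\<close>

record 'a parabolic =
  levi :: "'a mat set"
  rad :: "'a mat set"
  levi_alg :: "'a mat set"
  rad_alg :: "'a mat set"

definition par_group :: "nat \<Rightarrow> 'a::field parabolic \<Rightarrow> 'a mat set" where
  "par_group n P = levi P <#>\<^bsub>GL n\<^esub> rad P"

definition par_alg :: "'a::field parabolic \<Rightarrow> 'a mat set" where
  "par_alg P = {Y + Z | Y Z. Y \<in> levi_alg P \<and> Z \<in> rad_alg P}"

definition levi_proj :: "'a::field parabolic \<Rightarrow> 'a mat \<Rightarrow> 'a mat" where
  "levi_proj P X = (THE Y. Y \<in> levi_alg P \<and> (\<exists>Z\<in>rad_alg P. X = Y + Z))"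

definition par_res :: "'a::field parabolic \<Rightarrow> ('a mat \<Rightarrow> real) \<Rightarrow> ('a mat \<Rightarrow> real)" where
  "par_res P \<Psi> = (\<lambda>Y\<in>levi_alg P. (\<Sum>Z\<in>rad_alg P. \<Psi> (Y + Z)) / real (card (rad_alg P)))"

text \<open>
  Induction from \<open>levi_alg P\<close> to the Lie algebra \<open>GG\<close> of the ambient group \<open>G\<close>, where \<open>R\<close> is
  a set of representatives of the left cosets of \<open>par_group n P\<close> in \<open>G\<close>.
\<close>

definition par_ind ::
  "nat \<Rightarrow> 'a::field mat set \<Rightarrow> 'a mat set \<Rightarrow> 'a parabolic \<Rightarrow> ('a mat \<Rightarrow> real) \<Rightarrow> ('a mat \<Rightarrow> real)" where
  "par_ind n R GG P \<Phi> =
     (\<lambda>X\<in>GG. \<Sum>g\<in>R. let X' = Ad n (inv\<^bsub>GL n\<^esub> g) X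
                     in if X' \<in> par_alg P then \<Phi> (levi_proj P X') else 0)"

text \<open>
  The parabolic subgroup of \<open>levi P\<close> cut out by \<open>g Q g\<inverse>\<close>. Thus \<open>P\<^sub>w\<close> is
  \<open>par_cut n P P' w\<inverse>\<close> and \<open>P'\<^sub>w\<close> is \<open>par_cut n P' P w\<close>.
\<close>

definition par_cut :: "nat \<Rightarrow> 'a::field parabolic \<Rightarrow> 'a parabolic \<Rightarrow> 'a mat \<Rightarrow> 'a parabolic" where
  "par_cut n P Q g =
     \<lparr>levi = levi P \<inter> Ad n g ` levi Q,
      rad = levi P \<inter> Ad n g ` rad Q,
      levi_alg = levi_alg P \<inter> Ad n g ` levi_alg Q,
      rad_alg = levi_alg P \<inter> Ad n g ` rad_alg Q\<rparr>"

definition transport :: "nat \<Rightarrow> 'a::field mat set \<Rightarrow> 'a mat \<Rightarrow> ('a mat \<Rightarrow> real) \<Rightarrow> ('a mat \<Rightarrow> real)" where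
  "transport n HH w f = (\<lambda>X\<in>HH. f (Ad n (inv\<^bsub>GL n\<^esub> w) X))"


section \<open>The general linear setting\<close>

definition perm_mats :: "nat \<Rightarrow> 'a::field mat set" where
  "perm_mats n =
     {mat n n (\<lambda>(r, s). if r = p s then 1 else 0) | p. p permutes {..<n}}"

definition GL_parabolic :: "nat \<Rightarrow> nat \<Rightarrow> 'a::field parabolic" where
  "GL_parabolic i j =
     \<lparr>levi = {diag_block_mat [A, B] | A B. A \<in> carrier (GL i) \<and> B \<in> carrier (GL j)},
      rad = {four_block_mat (1\<^sub>m i) C (0\<^sub>m j i) (1\<^sub>m j) | C. C \<in> carrier_mat i j},
      levi_alg = {diag_block_mat [A, B] | A B. A \<in> carrier_mat i i \<and> B \<in> carrier_mat j j},
      rad_alg = {four_block_mat (0\<^sub>m i i) C (0\<^sub>m j i) (0\<^sub>m j j) | C. C \<in> carrier_mat i j}\<rparr>"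


section \<open>The unitary setting\<close>

text \<open>In what follows the field of entries is the one with \<open>q\<^sup>2\<close> elements.\<close>

definition conj_transpose :: "nat \<Rightarrow> 'a::field mat \<Rightarrow> 'a mat" where
  "conj_transpose q A = transpose_mat (map_mat (\<lambda>x. x ^ q) A)"

definition antidiag :: "nat \<Rightarrow> 'a::field mat" where
  "antidiag m = mat m m (\<lambda>(r, s). if r + s + 1 = m then 1 else 0)"

definition unitary_group :: "nat \<Rightarrow> nat \<Rightarrow> 'a::field mat set" where
  "unitary_group q m =
     {g \<in> carrier (GL m). conj_transpose q g * antidiag m * g = antidiag m}"

definition unitary_alg :: "nat \<Rightarrow> nat \<Rightarrow> 'a::field mat set" where
  "unitary_alg q m =
     {X \<in> carrier_mat m m. conj_transpose q X * antidiag m + antidiag m * X = 0\<^sub>m m m}"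

text \<open>The block matrix with rows \<open>(A, C, D)\<close>, \<open>(0, B, E)\<close>, \<open>(0, 0, F)\<close>.\<close>

definition block_upper3 ::
  "'a::field mat \<Rightarrow> 'a mat \<Rightarrow> 'a mat \<Rightarrow> 'a mat \<Rightarrow> 'a mat \<Rightarrow> 'a mat \<Rightarrow> 'a mat" where
  "block_upper3 A C D B E F =
     four_block_mat
       (four_block_mat A C (0\<^sub>m (dim_row B) (dim_col A)) B)  (D @\<^sub>r E)
       (0\<^sub>m (dim_row F) (dim_col A + dim_col B))               F"

definition unitary_parabolic :: "nat \<Rightarrow> nat \<Rightarrow> nat \<Rightarrow> 'a::field parabolic" where
  "unitary_parabolic q i j =
     \<lparr>levi = {diag_block_mat [A, B, antidiag i * inv\<^bsub>GL i\<^esub> (conj_transpose q A) * antidiag i] | A B.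
               A \<in> carrier (GL i) \<and> B \<in> unitary_group q (2 * j)},
      rad = {block_upper3 (1\<^sub>m i) C D (1\<^sub>m (2 * j)) C' (1\<^sub>m i) | C D C'.
              C \<in> carrier_mat i (2 * j) \<and> D \<in> carrier_mat i i \<and>
              C' = - (antidiag (2 * j) * conj_transpose q C * antidiag i) \<and>
              antidiag i * D + conj_transpose q D * antidiag i =
                - (antidiag i * C * antidiag (2 * j) * conj_transpose q C * antidiag i)},
      levi_alg = unitary_alg q (2 * (i + j)) \<inter>
        {diag_block_mat [A, B, F] | A B F.
          A \<in> carrier_mat i i \<and> B \<in> carrier_mat (2 * j) (2 * j) \<and> F \<in> carrier_mat i i},
      rad_alg = unitary_alg q (2 * (i + j)) \<inter>
        {block_upper3 (0\<^sub>m i i) C D (0\<^sub>m (2 * j) (2 * j)) E (0\<^sub>m i i) | C D E.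
          C \<in> carrier_mat i (2 * j) \<and> D \<in> carrier_mat i i \<and> E \<in> carrier_mat (2 * j) i}\<rparr>"

end

theory Submission
  imports Defs "Jordan_Normal_Form.Determinant"
begin

text \<open>The formula is proved by the averaging argument of Harish-Chandra theory, carried out on the Lie
algebra. The Lie algebras of \<open>P\<close>, \<open>L\<close>, \<open>U\<close> are written \<open>PP\<close>, \<open>LL\<close>, \<open>UU\<close>. Let \<open>\<Psi>\<close> be the function
on the Lie algebra \<open>GG\<close> that is \<open>\<Phi>\<close> of the Levi part on \<open>PP\<close>, and
\<open>0\<close> elsewhere. It is invariant under \<open>P\<close>, so inducing means averaging: the value at \<open>X\<close> is the sum of
\<open>\<Psi> (g\<inverse> X g)\<close> over all \<open>g \<in> G\<close>, divided by \<open>|P|\<close>. Splitting \<open>G\<close> into the double cosets \<open>P' w P\<close>, the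
left-hand side at \<open>Y \<in> LL'\<close> becomes the sum over \<open>w\<close> of

\<open>1 / |P' \<inter> w P w\<inverse>| * (\<Sum>p \<in> P'. 1 / |UU'| * (\<Sum>Z \<in> UU'. \<Psi>\<^sub>w (p\<inverse> (Y + Z) p)))\<close>

where \<open>\<Psi>\<^sub>w X = \<Psi> (w\<inverse> X w)\<close>. Conjugation by \<open>p = l u\<close> maps the coset \<open>Y + UU'\<close> onto
\<open>l\<inverse> Y l + UU'\<close>, so the sum over \<open>u\<close> only contributes the factor \<open>|U'| = |UU'|\<close>. For fixed \<open>l\<close>, the
matrix \<open>l\<inverse> Y l + Z\<close> lies in the Lie algebra of \<open>w P w\<inverse>\<close> if and only if both summands do, and the
component of \<open>Z\<close> in \<open>w UU w\<inverse>\<close> does not affect \<open>\<Psi>\<^sub>w\<close>. What remains is an average over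
\<open>UU' \<inter> w LL w\<inverse>\<close>, which is restriction to \<open>LL\<^sub>w\<close> followed by transport, and an average over \<open>L'\<close>, which is
induction from \<open>LL'\<^sub>w\<close>. The constants cancel because \<open>|P' \<inter> w P w\<inverse>|\<close> is the product of
\<open>|L' \<inter> w P w\<inverse>|\<close> and \<open>|U' \<inter> w P w\<inverse>|\<close>, and the latter equals \<open>|UU' \<inter> w PP w\<inverse>|\<close>.

All subgroups involved are given by gradings, functions \<open>b\<close> from the indices to the natural numbers:
\<open>P\<close> consists of the \<open>g \<in> G\<close> with \<open>g\<^sub>r\<^sub>s = 0\<close> unless \<open>b r \<le> b s\<close>. Taking the block-diagonal part is
multiplicative on these matrices, its image is \<open>L\<close> and its kernel is \<open>U\<close>. Conjugation by a permutation
matrix \<open>w\<close> replaces \<open>b\<close> by \<open>b \<circ> w\<inverse>\<close>, and block-diagonal parts for two gradings commute; hence the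
decompositions of all the intersections above are instances of one lemma (\<open>Levi_decomposition\<close>, with
its additive counterpart \<open>algebra_decomposition\<close>). The locale \<open>graded_matrix_group\<close> collects what is
used about \<open>G\<close>, and \<open>mackey_formula\<close> is the formula in this generality.

Two properties of \<open>G\<close> require an argument. The first is the Bruhat decomposition \<open>G = B W B\<close>. It
gives the decomposition of \<open>G\<close> into double cosets of \<open>P'\<close> and \<open>P\<close>, including that Weyl group elements
in one of them lie in one double coset of \<open>W \<inter> L'\<close> and \<open>W \<inter> L\<close> (\<open>same_double_coset\<close>). For the general
linear group it follows from column reduction, which also makes the factors unique
(\<open>bruhat_normal_form\<close>, \<open>bruhat_normal_form_unique\<close>). The unitary group is the set of fixed points of an
automorphism of the general linear group that preserves the normal form; by uniqueness, the factors of
a unitary matrix are unitary (\<open>unitary_bruhat\<close>). The second property is that unipotent subgroups and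
the corresponding nilpotent Lie algebras have the same size. In the general linear case \<open>X\<close> corresponds to
\<open>1 + X\<close>, in the unitary case to its Cayley transform \<open>(1 + X) (1 - X)\<inverse>\<close> (\<open>Cayley_criterion\<close>), for
which \<open>q\<close> has to be odd.\<close>

section \<open>Sums over cosets and double cosets\<close>

lemma (in group) inv_cancel:
  assumes "a \<in> carrier G" "x \<in> carrier G"
  shows "inv a \<otimes> (a \<otimes> x) = x" "a \<otimes> (inv a \<otimes> x) = x"
  using assms by (simp_all add: m_assoc[symmetric])

text \<open>Induction is defined by a choice of representatives. For a summand that is invariant under \<open>H\<close> on
the right, the choice disappears in a sum over the whole group.\<close>

lemma (in group) sum_over_left_coset_reps:
  fixes f :: "'a \<Rightarrow> real"
  assumes H: "subgroup H G" and K: "subgroup K G" "H \<subseteq> K" and fin: "finite K"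
    and R: "R \<subseteq> K" "\<And>g. g \<in> K \<Longrightarrow> \<exists>!r. r \<in> R \<and> g \<in> r <# H"
    and f: "\<And>g h. g \<in> K \<Longrightarrow> h \<in> H \<Longrightarrow> f (g \<otimes> h) = f g"
  shows "(\<Sum>g\<in>K. f g) = real (card H) * (\<Sum>r\<in>R. f r)"
proof -
  have sub: "R \<subseteq> carrier G" "H \<subseteq> carrier G" "K \<subseteq> carrier G"
    using subgroup.subset[OF H] subgroup.subset[OF K(1)] R(1) by blast+
  have bij: "bij_betw (\<lambda>(r, h). r \<otimes> h) (R \<times> H) K"
    unfolding bij_betw_def
  proof
    show "inj_on (\<lambda>(r, h). r \<otimes> h) (R \<times> H)"
    proof (rule inj_onI, clarify)
      fix r h r' h' assume a: "r \<in> R" "h \<in> H" "r' \<in> R" "h' \<in> H" "r \<otimes> h = r' \<otimes> h'"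
      have "r \<otimes> h \<in> K" using a R(1) K by (auto intro: subgroup.m_closed)
      moreover have "r \<otimes> h \<in> r <# H" "r \<otimes> h \<in> r' <# H"
        using a unfolding l_coset_def by blast+
      ultimately have "r = r'" using R(2) a by blast
      then show "r = r' \<and> h = h'" using a sub by (metis inv_cancel(1) subsetD)
    qed
    show "(\<lambda>(r, h). r \<otimes> h) ` (R \<times> H) = K"
    proof
      show "(\<lambda>(r, h). r \<otimes> h) ` (R \<times> H) \<subseteq> K"
        using R(1) K by (auto intro: subgroup.m_closed)
      show "K \<subseteq> (\<lambda>(r, h). r \<otimes> h) ` (R \<times> H)"
      proof
        fix g assume "g \<in> K"
        then obtain r where "r \<in> R" "g \<in> r <# H" using R(2) by blast
        then show "g \<in> (\<lambda>(r, h). r \<otimes> h) ` (R \<times> H)" by (auto simp: l_coset_def)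
      qed
    qed
  qed
  have "(\<Sum>g\<in>K. f g) = (\<Sum>(r, h)\<in>R \<times> H. f (r \<otimes> h))"
    using sum.reindex_bij_betw[OF bij, of f] by (simp add: case_prod_beta)
  also have "\<dots> = (\<Sum>(r, h)\<in>R \<times> H. f r)"
    using f R(1) by (intro sum.cong) auto
  also have "\<dots> = real (card H) * (\<Sum>r\<in>R. f r)"
    by (simp add: sum.cartesian_product[symmetric] sum_distrib_left)
  finally show ?thesis .
qed

text \<open>An element \<open>a w b\<close> of the double coset has \<open>|A \<inter> w B w\<inverse>|\<close> such factorizations: the others are
\<open>(a x) w (w\<inverse> x\<inverse> w b)\<close> for \<open>x \<in> A \<inter> w B w\<inverse>\<close>.\<close>

lemma (in group) sum_over_double_coset:
  fixes f :: "'a \<Rightarrow> real"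
  assumes A: "subgroup A G" "finite A" and B: "subgroup B G" "finite B" and w: "w \<in> carrier G"
    and f: "\<And>a b. a \<in> A \<Longrightarrow> b \<in> B \<Longrightarrow> f (a \<otimes> w \<otimes> b) = f (a \<otimes> w)"
  shows "real (card (A \<inter> (\<lambda>b. w \<otimes> b \<otimes> inv w) ` B)) *
      (\<Sum>g\<in>(\<lambda>(a, b). a \<otimes> w \<otimes> b) ` (A \<times> B). f g)
    = real (card B) * (\<Sum>a\<in>A. f (a \<otimes> w))"
proof -
  let ?m = "\<lambda>(a, b). a \<otimes> w \<otimes> b" and ?K = "A \<inter> (\<lambda>b. w \<otimes> b \<otimes> inv w) ` B"
  note clos = subgroup.m_closed[OF A(1)] subgroup.m_closed[OF B(1)]
    subgroup.m_inv_closed[OF A(1)] subgroup.m_inv_closed[OF B(1)]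
  have car: "x \<in> carrier G" if "x \<in> A \<or> x \<in> B" for x
    using that A(1) B(1) by (auto dest: subgroup.mem_carrier)
  have fibre: "card {x \<in> A \<times> B. ?m x = g} = card ?K" if "g \<in> ?m ` (A \<times> B)" for g
  proof -
    obtain a b where ab: "a \<in> A" "b \<in> B" "g = a \<otimes> w \<otimes> b"
      using \<open>g \<in> ?m ` (A \<times> B)\<close> by (elim imageE SigmaE) simp
    have abc: "a \<in> carrier G" "b \<in> carrier G" using ab car by auto
    have "bij_betw (\<lambda>c. (a \<otimes> c, inv w \<otimes> inv c \<otimes> w \<otimes> b)) ?K {x \<in> A \<times> B. ?m x = g}"
    proof (rule bij_betw_byWitness[where f' = "\<lambda>x. inv a \<otimes> fst x"], goal_cases)
      case 1
      show ?case using abc car by (simp add: inv_cancel)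
    next
      case 2
      show ?case
      proof
        fix x assume x: "x \<in> {x \<in> A \<times> B. ?m x = g}"
        obtain c d where cd: "x = (c, d)" "c \<in> A" "d \<in> B" "c \<otimes> w \<otimes> d = a \<otimes> w \<otimes> b"
          using x ab by (cases x) auto
        have cdc: "c \<in> carrier G" "d \<in> carrier G" using cd car by auto
        have "inv w \<otimes> inv (inv a \<otimes> c) \<otimes> w \<otimes> b = inv w \<otimes> (inv c \<otimes> (a \<otimes> w \<otimes> b))"
          using abc cdc w by (simp add: inv_mult_group m_assoc)
        also have "\<dots> = d"
          using abc cdc w by (simp add: cd(4)[symmetric] m_assoc inv_cancel)
        finally show "(a \<otimes> (inv a \<otimes> fst x), inv w \<otimes> inv (inv a \<otimes> fst x) \<otimes> w \<otimes> b) = x"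
          using cd(1) abc cdc by (simp add: inv_cancel)
      qed
    next
      case 3
      show ?case
      proof (rule image_subsetI)
        fix x assume x: "x \<in> ?K"
        then obtain e where e: "e \<in> B" "x = w \<otimes> e \<otimes> inv w" by blast
        have xA: "x \<in> A" using x by blast
        have ec: "e \<in> carrier G" "x \<in> carrier G" using e(1) xA car by auto
        have "inv w \<otimes> inv x \<otimes> w = inv e"
          using ec(1) w by (simp add: e(2) inv_mult_group m_assoc inv_cancel)
        moreover have "a \<otimes> x \<otimes> w \<otimes> (inv w \<otimes> inv x \<otimes> w \<otimes> b) = g"
          using ec(2) w abc by (simp add: ab(3) m_assoc inv_cancel)
        ultimately show "(a \<otimes> x, inv w \<otimes> inv x \<otimes> w \<otimes> b) \<in> {x \<in> A \<times> B. ?m x = g}"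
          using xA ab e(1) by (simp add: clos)
      qed
    next
      case 4
      show ?case
      proof (rule image_subsetI)
        fix x assume x: "x \<in> {x \<in> A \<times> B. ?m x = g}"
        obtain c d where cd: "x = (c, d)" "c \<in> A" "d \<in> B" "c \<otimes> w \<otimes> d = a \<otimes> w \<otimes> b"
          using x ab by (cases x) auto
        have cdc: "c \<in> carrier G" "d \<in> carrier G" using cd car by auto
        have "w \<otimes> (b \<otimes> inv d) \<otimes> inv w = inv a \<otimes> (a \<otimes> w \<otimes> b) \<otimes> (inv d \<otimes> inv w)"
          using abc cdc w by (simp add: m_assoc inv_cancel)
        also have "\<dots> = inv a \<otimes> c"
          using abc cdc w by (simp add: cd(4)[symmetric] m_assoc inv_cancel)
        finally have "inv a \<otimes> c = w \<otimes> (b \<otimes> inv d) \<otimes> inv w" by simp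
        moreover have "b \<otimes> inv d \<in> B" "inv a \<otimes> c \<in> A" using ab cd by (simp_all add: clos)
        ultimately show "inv a \<otimes> fst x \<in> ?K" using cd(1) by auto
      qed
    qed
    then show ?thesis by (simp add: bij_betw_same_card)
  qed
  have "real (card B) * (\<Sum>a\<in>A. f (a \<otimes> w)) = (\<Sum>x\<in>A \<times> B. f (?m x))"
  proof -
    have "(\<Sum>x\<in>A \<times> B. f (?m x)) = (\<Sum>(a, b)\<in>A \<times> B. f (a \<otimes> w))"
      using f by (intro sum.cong) auto
    then show ?thesis by (simp add: sum.cartesian_product[symmetric] sum_distrib_left)
  qed
  also have "\<dots> = (\<Sum>g\<in>?m ` (A \<times> B). \<Sum>x\<in>{x \<in> A \<times> B. ?m x = g}. f (?m x))"
    using A B by (intro sum.image_gen) auto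
  also have "\<dots> = (\<Sum>g\<in>?m ` (A \<times> B). real (card ?K) * f g)"
  proof (intro sum.cong refl)
    fix g assume g: "g \<in> ?m ` (A \<times> B)"
    have "(\<Sum>x\<in>{x \<in> A \<times> B. ?m x = g}. f (?m x)) = (\<Sum>x\<in>{x \<in> A \<times> B. ?m x = g}. f g)"
      by (intro sum.cong) auto
    then show "(\<Sum>x\<in>{x \<in> A \<times> B. ?m x = g}. f (?m x)) = real (card ?K) * f g"
      by (simp add: fibre[OF g])
  qed
  finally show ?thesis by (simp add: sum_distrib_left)
qed

section \<open>The general linear group and its adjoint action\<close>

abbreviation iv :: "nat \<Rightarrow> 'a::field mat \<Rightarrow> 'a mat" where
  "iv n g \<equiv> inv\<^bsub>GL n\<^esub> g"

lemma GL_ops [simp]: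
  "g \<otimes>\<^bsub>GL n\<^esub> h = g * h" "\<one>\<^bsub>GL n\<^esub> = 1\<^sub>m n"
  by (simp_all add: GL_def units_of_def ring_mat_def)

lemma group_GL: "group (GL n :: 'a::field mat monoid)"
proof -
  have "monoid (ring_mat TYPE('a) n ())"
    using semiring_mat[where ?'a = 'a, of n "()"] by (simp add: semiring_def)
  then show ?thesis unfolding GL_def by (rule monoid.units_group)
qed

lemma mem_GL:
  "g \<in> carrier (GL n) \<longleftrightarrow> g \<in> carrier_mat n n \<and> (\<exists>h\<in>carrier_mat n n. h * g = 1\<^sub>m n \<and> g * h = 1\<^sub>m n)"
  by (auto simp: GL_def units_of_def Units_def ring_mat_def)

lemma GL_carrier [simp]: "g \<in> carrier (GL n) \<Longrightarrow> g \<in> carrier_mat n n"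
  by (simp add: mem_GL)

lemma GL_dim: "g \<in> carrier (GL n) \<Longrightarrow> dim_row g = n" "g \<in> carrier (GL n) \<Longrightarrow> dim_col g = n"
  using GL_carrier by blast+

lemma GL_I: "g \<in> carrier_mat n n \<Longrightarrow> h \<in> carrier_mat n n \<Longrightarrow> h * g = 1\<^sub>m n \<Longrightarrow> g \<in> carrier (GL n)"
  using mat_mult_left_right_inverse[of h n g] unfolding mem_GL by blast

lemma GL_mult [simp]: "g \<in> carrier (GL n) \<Longrightarrow> h \<in> carrier (GL n) \<Longrightarrow> g * h \<in> carrier (GL n)"
  using group.is_monoid[OF group_GL, THEN monoid.m_closed, of g n h] by simp

lemma GL_one [simp]: "1\<^sub>m n \<in> carrier (GL n)"
  using group.is_monoid[OF group_GL, THEN monoid.one_closed, of n] by simp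

lemma GL_iv [simp]: "g \<in> carrier (GL n) \<Longrightarrow> iv n g \<in> carrier (GL n)"
  by (rule group.inv_closed[OF group_GL])

lemma iv_left [simp]: "g \<in> carrier (GL n) \<Longrightarrow> iv n g * g = 1\<^sub>m n"
  using group.l_inv[OF group_GL, of g n] by simp

lemma iv_right [simp]: "g \<in> carrier (GL n) \<Longrightarrow> g * iv n g = 1\<^sub>m n"
  using group.r_inv[OF group_GL, of g n] by simp

lemma iv_iv [simp]: "g \<in> carrier (GL n) \<Longrightarrow> iv n (iv n g) = g"
  by (rule group.inv_inv[OF group_GL])

lemma iv_one [simp]: "iv n (1\<^sub>m n) = 1\<^sub>m n"
  using monoid.inv_one[OF group.is_monoid[OF group_GL], of n] by simp

lemma iv_mult: "g \<in> carrier (GL n) \<Longrightarrow> h \<in> carrier (GL n) \<Longrightarrow> iv n (g * h) = iv n h * iv n g"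
  using group.inv_mult_group[OF group_GL, of g n h] by simp

lemma mult_one_right_sq [simp]: "(A :: 'a::semiring_1 mat) \<in> carrier_mat n n \<Longrightarrow> A * 1\<^sub>m n = A"
  by (rule right_mult_one_mat)

lemma mult_one_left_sq [simp]: "(A :: 'a::semiring_1 mat) \<in> carrier_mat n n \<Longrightarrow> 1\<^sub>m n * A = A"
  by (rule left_mult_one_mat)

lemma mat_mult_closed [simp]:
  "A \<in> carrier_mat n n \<Longrightarrow> B \<in> carrier_mat n n \<Longrightarrow> A * B \<in> carrier_mat n n"
  by (rule mult_carrier_mat)

lemma mat_assoc:
  "A \<in> carrier_mat n n \<Longrightarrow> B \<in> carrier_mat n n \<Longrightarrow> C \<in> carrier_mat n n \<Longrightarrow> A * B * C = A * (B * C)"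
  by (rule assoc_mult_mat)

lemma iv_cancel [simp]:
  assumes "g \<in> carrier (GL n)" "X \<in> carrier_mat n n"
  shows "iv n g * (g * X) = X" "g * (iv n g * X) = X"
  using assms by (simp_all add: mat_assoc[of _ n, symmetric])

lemma iv_unique: "g \<in> carrier_mat n n \<Longrightarrow> h \<in> carrier_mat n n \<Longrightarrow> h * g = 1\<^sub>m n \<Longrightarrow> iv n g = h"
  by (rule group.inv_equality[OF group_GL])
    (simp_all add: GL_I[of g n h] GL_I[of h n g] mat_mult_left_right_inverse[of h n g])

lemma Ad_carrier [simp]: "g \<in> carrier (GL n) \<Longrightarrow> X \<in> carrier_mat n n \<Longrightarrow> Ad n g X \<in> carrier_mat n n"
  by (simp add: Ad_def)

lemma Ad_one [simp]: "X \<in> carrier_mat n n \<Longrightarrow> Ad n (1\<^sub>m n) X = X"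
  by (simp add: Ad_def)

lemma Ad_Ad:
  "g \<in> carrier (GL n) \<Longrightarrow> h \<in> carrier (GL n) \<Longrightarrow> X \<in> carrier_mat n n \<Longrightarrow> Ad n g (Ad n h X) = Ad n (g * h) X"
  by (simp add: Ad_def iv_mult mat_assoc[of _ n])

lemma Ad_iv [simp]:
  assumes "g \<in> carrier (GL n)" "X \<in> carrier_mat n n"
  shows "Ad n g (Ad n (iv n g) X) = X" "Ad n (iv n g) (Ad n g X) = X"
  using assms by (simp_all add: Ad_Ad)

lemma Ad_add:
  "g \<in> carrier (GL n) \<Longrightarrow> X \<in> carrier_mat n n \<Longrightarrow> Y \<in> carrier_mat n n \<Longrightarrow> Ad n g (X + Y) = Ad n g X + Ad n g Y"
  by (simp add: Ad_def mult_add_distrib_mat[of _ n n _ n] add_mult_distrib_mat[of _ n n _ _ n])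

lemma Ad_image_eq:
  assumes "g \<in> carrier (GL n)" "S \<subseteq> carrier_mat n n" "T \<subseteq> carrier_mat n n"
    and "\<And>X. X \<in> carrier_mat n n \<Longrightarrow> Ad n g X \<in> T \<longleftrightarrow> X \<in> S"
  shows "Ad n g ` S = T"
proof
  show "Ad n g ` S \<subseteq> T" using assms by blast
  show "T \<subseteq> Ad n g ` S"
  proof
    fix X assume X: "X \<in> T"
    have Xc: "X \<in> carrier_mat n n" using X assms(3) by blast
    then have "Ad n (iv n g) X \<in> S" "X = Ad n g (Ad n (iv n g) X)"
      using assms(4)[of "Ad n (iv n g) X"] assms(1) X by simp_all
    then show "X \<in> Ad n g ` S" by blast
  qed
qed

lemma finite_carrier_mat: "finite (carrier_mat n m :: 'a::{zero,finite} mat set)"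
proof (rule finite_subset)
  show "carrier_mat n m \<subseteq> (\<lambda>f. mat n m f) ` (({..<n} \<times> {..<m}) \<rightarrow>\<^sub>E (UNIV :: 'a set))"
  proof
    fix A :: "'a mat" assume A: "A \<in> carrier_mat n m"
    have "A = mat n m (restrict (\<lambda>p. A $$ p) ({..<n} \<times> {..<m}))"
      by (rule eq_matI) (use carrier_matD[OF A] in simp_all)
    then show "A \<in> (\<lambda>f. mat n m f) ` (({..<n} \<times> {..<m}) \<rightarrow>\<^sub>E (UNIV :: 'a set))"
      by (intro image_eqI[of _ _ "restrict (\<lambda>p. A $$ p) ({..<n} \<times> {..<m})"]) simp_all
  qed
  show "finite ((\<lambda>f. mat n m f) ` (({..<n} \<times> {..<m}) \<rightarrow>\<^sub>E (UNIV :: 'a set)))"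
    by (intro finite_imageI finite_PiE) auto
qed

lemma finite_GL: "finite (carrier (GL n :: 'a::{field,finite} mat monoid))"
  by (rule finite_subset[OF _ finite_carrier_mat[of n n]]) auto

text \<open>Multiplication by \<open>g\<close> permutes the finite set \<open>K\<close>, so it hits \<open>1\<close>. This spares the computation of
inverses of matrices that are given by the shape of their entries.\<close>

lemma subgroup_GL_if_closed:
  fixes K :: "'a::{field,finite} mat set"
  assumes "K \<subseteq> carrier (GL n)" "1\<^sub>m n \<in> K" "\<And>g h. g \<in> K \<Longrightarrow> h \<in> K \<Longrightarrow> g * h \<in> K"
  shows "subgroup K (GL n)"
proof -
  interpret group "GL n" by (rule group_GL)
  have fin: "finite K" using assms(1) finite_GL finite_subset by blast
  show ?thesis
  proof (rule subgroupI)
    fix g assume g: "g \<in> K"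
    have gc: "g \<in> carrier (GL n)" using g assms(1) by blast
    have "inj_on (\<lambda>h. g * h) K"
    proof (rule inj_onI)
      fix h k assume "h \<in> K" "k \<in> K" "g * h = g * k"
      then show "h = k" using gc assms(1) by (metis GL_carrier iv_cancel(1) subsetD)
    qed
    then have "(\<lambda>h. g * h) ` K = K"
      using fin assms(3) g by (intro endo_inj_surj) auto
    then obtain h where h: "h \<in> K" "g * h = 1\<^sub>m n" using assms(2) by (metis imageE)
    then have "iv n g = h"
      using gc assms(1) by (metis GL_carrier iv_unique mat_mult_left_right_inverse subsetD)
    then show "iv n g \<in> K" using h by simp
  qed (use assms in auto)
qed

section \<open>Support patterns and block-diagonal parts\<close>

definition pat :: "nat \<Rightarrow> (nat \<Rightarrow> nat \<Rightarrow> bool) \<Rightarrow> 'a::field mat set" where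
  "pat n \<rho> = {X \<in> carrier_mat n n. \<forall>r<n. \<forall>s<n. \<not> \<rho> r s \<longrightarrow> X $$ (r, s) = 0}"

definition blk :: "nat \<Rightarrow> (nat \<Rightarrow> nat) \<Rightarrow> 'a::field mat \<Rightarrow> 'a mat" where
  "blk n b X = mat n n (\<lambda>(r, s). if b r = b s then X $$ (r, s) else 0)"

abbreviation upper :: "(nat \<Rightarrow> nat) \<Rightarrow> nat \<Rightarrow> nat \<Rightarrow> bool" where
  "upper b \<equiv> \<lambda>r s. b r \<le> b s"

lemma pat_carrier: "X \<in> pat n \<rho> \<Longrightarrow> X \<in> carrier_mat n n"
  by (simp add: pat_def)

lemma pat_zero: "X \<in> pat n \<rho> \<Longrightarrow> r < n \<Longrightarrow> s < n \<Longrightarrow> \<not> \<rho> r s \<Longrightarrow> X $$ (r, s) = 0"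
  by (simp add: pat_def)

lemma pat_mono: "X \<in> pat n \<rho> \<Longrightarrow> (\<And>r s. r < n \<Longrightarrow> s < n \<Longrightarrow> \<rho> r s \<Longrightarrow> \<sigma> r s) \<Longrightarrow> X \<in> pat n \<sigma>"
  unfolding pat_def by blast

lemma mat_entry_mult:
  assumes "A \<in> carrier_mat n n" "B \<in> carrier_mat n n" "r < n" "s < n"
  shows "(A * B) $$ (r, s) = (\<Sum>t<n. A $$ (r, t) * B $$ (t, s))"
  using assms by (simp add: scalar_prod_def atLeast0LessThan)

lemma pat_mult:
  assumes X: "X \<in> pat n \<rho>" and Y: "Y \<in> pat n \<sigma>"
    and comp: "\<And>r s t. \<rho> r s \<Longrightarrow> \<sigma> s t \<Longrightarrow> \<tau> r t"
  shows "X * Y \<in> pat n \<tau>"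
proof -
  have "(X * Y) $$ (r, s) = 0" if rs: "r < n" "s < n" "\<not> \<tau> r s" for r s
  proof -
    have "X $$ (r, t) * Y $$ (t, s) = 0" if "t < n" for t
      using comp[of r t s] rs that pat_zero[OF X, of r t] pat_zero[OF Y, of t s] by auto
    then have "(\<Sum>t<n. X $$ (r, t) * Y $$ (t, s)) = 0" by (intro sum.neutral) simp
    then show ?thesis
      using rs pat_carrier[OF X] pat_carrier[OF Y] by (simp add: mat_entry_mult[of _ n] del: index_mult_mat)
  qed
  then show ?thesis
    using pat_carrier[OF X] pat_carrier[OF Y] by (simp add: pat_def del: index_mult_mat)
qed

lemma pat_add: "X \<in> pat n \<rho> \<Longrightarrow> Y \<in> pat n \<rho> \<Longrightarrow> X + Y \<in> pat n \<rho>"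
  by (auto simp: pat_def)

lemma pat_diff: "X \<in> pat n \<rho> \<Longrightarrow> Y \<in> pat n \<rho> \<Longrightarrow> X - Y \<in> pat n \<rho>"
  by (auto simp: pat_def)

lemma pat_one: "(\<And>r. \<rho> r r) \<Longrightarrow> 1\<^sub>m n \<in> pat n \<rho>"
  by (auto simp: pat_def)

lemma pat_upper_mult: "X \<in> pat n (upper b) \<Longrightarrow> Y \<in> pat n (upper b) \<Longrightarrow> X * Y \<in> pat n (upper b)"
  by (erule pat_mult, assumption) simp

lemma blk_carrier [simp]: "blk n b X \<in> carrier_mat n n"
  by (simp add: blk_def)

lemma blk_dim [simp]: "dim_row (blk n b X) = n" "dim_col (blk n b X) = n"
  by (simp_all add: blk_def)

lemma blk_index [simp]:
  "r < n \<Longrightarrow> s < n \<Longrightarrow> blk n b X $$ (r, s) = (if b r = b s then X $$ (r, s) else 0)"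
  by (simp add: blk_def)

lemma blk_add:
  assumes "X \<in> carrier_mat n n" "Y \<in> carrier_mat n n"
  shows "blk n b (X + Y) = blk n b X + blk n b Y"
  using assms by (intro eq_matI) auto

lemma blk_diff:
  assumes "X \<in> carrier_mat n n" "Y \<in> carrier_mat n n"
  shows "blk n b (X - Y) = blk n b X - blk n b Y"
  using assms by (intro eq_matI) auto

lemma blk_one [simp]: "blk n b (1\<^sub>m n) = 1\<^sub>m n"
  by (intro eq_matI) auto

lemma blk_zero [simp]: "blk n b (0\<^sub>m n n) = 0\<^sub>m n n"
  by (intro eq_matI) auto

lemma blk_blk [simp]: "blk n b (blk n b X) = blk n b X"
  by (intro eq_matI) auto

lemma blk_commute: "blk n b (blk n c X) = blk n c (blk n b X)"
  by (intro eq_matI) auto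

lemma blk_pat: "X \<in> pat n \<rho> \<Longrightarrow> blk n b X \<in> pat n \<rho>"
  by (auto simp: pat_def)

lemma blk_upper [simp]: "blk n b X \<in> pat n (upper b)"
  by (auto simp: pat_def)

text \<open>On block upper triangular matrices the block-diagonal part is multiplicative: a term
  \<open>X\<^sub>r\<^sub>t Y\<^sub>t\<^sub>s\<close> with \<open>b r = b s\<close> can be nonzero only if \<open>b r \<le> b t \<le> b s\<close>.\<close>

lemma blk_mult:
  assumes X: "X \<in> pat n (upper b)" and Y: "Y \<in> pat n (upper b)"
  shows "blk n b (X * Y) = blk n b X * blk n b Y"
proof (rule eq_matI)
  fix r s assume "r < dim_row (blk n b X * blk n b Y)" "s < dim_col (blk n b X * blk n b Y)"
  then have rs: "r < n" "s < n" by simp_all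
  have "(if b r = b s then X $$ (r, t) * Y $$ (t, s) else 0) =
      (if b r = b t then X $$ (r, t) else 0) * (if b t = b s then Y $$ (t, s) else 0)"
    if "t < n" for t
    using that rs pat_zero[OF X, of r t] pat_zero[OF Y, of t s]
    by (cases "b r \<le> b t"; cases "b t \<le> b s") auto
  then have "(\<Sum>t<n. if b r = b s then X $$ (r, t) * Y $$ (t, s) else 0) =
      (\<Sum>t<n. blk n b X $$ (r, t) * blk n b Y $$ (t, s))"
    using rs by (intro sum.cong) simp_all
  then show "blk n b (X * Y) $$ (r, s) = (blk n b X * blk n b Y) $$ (r, s)"
    using rs pat_carrier[OF X] pat_carrier[OF Y]
    by (cases "b r = b s") (simp_all add: mat_entry_mult[of _ n] del: index_mult_mat)
qed simp_all

lemma mat_add_diff_cancel: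
  fixes A B :: "'a::field mat"
  assumes "A \<in> carrier_mat n m" "B \<in> carrier_mat n m"
  shows "A + (B - A) = B" "(A + B) - A = (B :: 'a mat)"
  using assms by (auto intro!: eq_matI)

lemma mat_add_eq_zero_iff:
  fixes A B :: "'a::field mat"
  assumes A: "A \<in> carrier_mat n m" and B: "B \<in> carrier_mat n m"
  shows "A + B = 0\<^sub>m n m \<longleftrightarrow> A = - B"
proof
  assume e: "A + B = 0\<^sub>m n m"
  show "A = - B"
  proof (rule eq_matI)
    fix r s assume "r < dim_row (- B)" "s < dim_col (- B)"
    then have rs: "r < n" "s < m" using B by auto
    have "(A + B) $$ (r, s) = 0" using e rs by simp
    then show "A $$ (r, s) = (- B) $$ (r, s)" using rs A B by (simp add: eq_neg_iff_add_eq_0)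
  qed (use A B in auto)
next
  assume "A = - B"
  then show "A + B = 0\<^sub>m n m" using A B by (intro eq_matI) auto
qed

section \<open>Triangular matrices\<close>

lemma GL_iff_det: "g \<in> carrier_mat n n \<Longrightarrow> g \<in> carrier (GL n) \<longleftrightarrow> det g \<noteq> 0"
  using unit_imp_det_non_zero[of g n "()"] det_non_zero_imp_unit[of g n "()"]
  by (auto simp: GL_def units_of_def)

lemma upper_subgroup: "subgroup (carrier (GL n :: 'a::{field,finite} mat monoid) \<inter> pat n (upper b)) (GL n)"
  by (rule subgroup_GL_if_closed) (auto simp: pat_upper_mult pat_one)

lemma upper_inverse:
  fixes g :: "'a::{field,finite} mat"
  assumes "g \<in> carrier (GL n)" "g \<in> pat n (upper b)"
  shows "iv n g \<in> pat n (upper b)"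
  using subgroup.m_inv_closed[OF upper_subgroup[of n b], of g] assms by simp

text \<open>By \<open>blk_mult\<close> for the grading \<open>id\<close>, the diagonal part of \<open>g\<close> is invertible as well.\<close>

lemma triangular_diag_nonzero:
  fixes g :: "'a::{field,finite} mat"
  assumes g: "g \<in> carrier (GL n)" "g \<in> pat n (\<le>)" and r: "r < n"
  shows "g $$ (r, r) \<noteq> 0"
proof -
  have u: "g \<in> pat n (upper id)" "iv n g \<in> pat n (upper id)"
    using g upper_inverse[of g n id] by simp_all
  have "blk n id g * blk n id (iv n g) = 1\<^sub>m n"
    unfolding blk_mult[OF u, symmetric] iv_right[OF g(1)] by (rule blk_one)
  then have "(blk n id g * blk n id (iv n g)) $$ (r, r) = 1" using r by simp
  then have "(\<Sum>t<n. blk n id g $$ (r, t) * blk n id (iv n g) $$ (t, r)) = 1"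
    using r by (simp add: mat_entry_mult[of _ n] del: index_mult_mat)
  moreover have "(\<Sum>t<n. blk n id g $$ (r, t) * blk n id (iv n g) $$ (t, r)) =
      (\<Sum>t<n. if t = r then g $$ (r, r) * iv n g $$ (r, r) else 0)"
    using r by (intro sum.cong) auto
  ultimately show ?thesis using r by auto
qed

lemma triangular_mult: "X \<in> pat n (\<le>) \<Longrightarrow> Y \<in> pat n (\<le>) \<Longrightarrow> X * Y \<in> pat n (\<le>)"
  by (erule pat_mult, assumption) simp

lemma triangular_inverse:
  fixes g :: "'a::{field,finite} mat"
  shows "g \<in> carrier (GL n) \<Longrightarrow> g \<in> pat n (\<le>) \<Longrightarrow> iv n g \<in> pat n (\<le>)"
  using upper_inverse[of g n id] by simp

section \<open>Permutation matrices\<close>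

abbreviation pinv :: "(nat \<Rightarrow> nat) \<Rightarrow> nat \<Rightarrow> nat" where
  "pinv p \<equiv> inv_into UNIV p"

definition pmat :: "nat \<Rightarrow> (nat \<Rightarrow> nat) \<Rightarrow> 'a::field mat" where
  "pmat n p = mat n n (\<lambda>(r, s). if r = p s then 1 else 0)"

lemma perm_mats_eq: "perm_mats n = {pmat n p | p. p permutes {..<n}}"
  by (simp add: perm_mats_def pmat_def)

lemma pmat_carrier [simp]: "pmat n p \<in> carrier_mat n n"
  by (simp add: pmat_def)

lemma permutes_lt: "p permutes {..<n} \<Longrightarrow> p r < n \<longleftrightarrow> r < (n::nat)"
  using permutes_in_image[of p "{..<n}" r] by simp

text \<open>The values of \<open>b \<circ> u\<close> and \<open>b \<circ> v\<close> have the same sum, so none of the inequalities can be strict.\<close>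

lemma permutes_preserves_if_le:
  fixes b :: "nat \<Rightarrow> nat"
  assumes u: "u permutes {..<n}" and v: "v permutes {..<n}"
    and le: "\<And>s. s < n \<Longrightarrow> b (u s) \<le> b (v s)" and s: "s < n"
  shows "b (u s) = b (v s)"
proof (rule ccontr)
  assume "b (u s) \<noteq> b (v s)"
  then have "(\<Sum>t<n. b (u t)) < (\<Sum>t<n. b (v t))"
    using le s by (intro sum_strict_mono_ex1) (auto intro!: bexI[of _ s] simp: le_neq_implies_less)
  moreover have "(\<Sum>t<n. b (u t)) = sum b {..<n}" "(\<Sum>t<n. b (v t)) = sum b {..<n}"
    using sum.permute[OF u, of b] sum.permute[OF v, of b] by (simp_all add: o_def)
  ultimately show False by simp
qed

lemma pmat_mult_left:
  assumes "p permutes {..<n}" "X \<in> carrier_mat n n" "r < n" "s < n"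
  shows "(pmat n p * X) $$ (r, s) = X $$ (pinv p r, s)"
proof -
  have lt: "pinv p r < n" using assms permutes_lt[OF permutes_inv[OF assms(1)]] by simp
  have "pmat n p $$ (r, t) * X $$ (t, s) = (if t = pinv p r then X $$ (pinv p r, s) else 0)"
    if "t < n" for t
    using that assms permutes_inverses[OF assms(1)] by (auto simp: pmat_def)
  then have "(\<Sum>t<n. pmat n p $$ (r, t) * X $$ (t, s)) = (\<Sum>t<n. if t = pinv p r then X $$ (pinv p r, s) else 0)"
    by (intro sum.cong) auto
  then show ?thesis
    using assms lt by (simp add: mat_entry_mult[of _ n] del: index_mult_mat)
qed

lemma pmat_mult_right:
  assumes "p permutes {..<n}" "X \<in> carrier_mat n n" "r < n" "s < n"
  shows "(X * pmat n p) $$ (r, s) = X $$ (r, p s)"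
proof -
  have lt: "p s < n" using assms permutes_lt[OF assms(1)] by simp
  have "X $$ (r, t) * pmat n p $$ (t, s) = (if t = p s then X $$ (r, p s) else 0)"
    if "t < n" for t
    using that assms by (auto simp: pmat_def)
  then have "(\<Sum>t<n. X $$ (r, t) * pmat n p $$ (t, s)) = (\<Sum>t<n. if t = p s then X $$ (r, p s) else 0)"
    by (intro sum.cong) auto
  then show ?thesis
    using assms lt by (simp add: mat_entry_mult[of _ n] del: index_mult_mat)
qed

lemma pmat_mult:
  assumes "p permutes {..<n}" "s permutes {..<n}"
  shows "pmat n p * pmat n s = pmat n (p \<circ> s)"
proof (rule eq_matI)
  fix i j assume "i < dim_row (pmat n (p \<circ> s) :: 'a mat)" "j < dim_col (pmat n (p \<circ> s) :: 'a mat)"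
  then have ij: "i < n" "j < n" by (simp_all add: pmat_def)
  show "(pmat n p * pmat n s) $$ (i, j) = pmat n (p \<circ> s) $$ (i, j)"
    using ij assms permutes_lt[of s n j] by (subst pmat_mult_right) (simp_all add: pmat_def)
qed (simp_all add: pmat_def)

lemma pmat_id [simp]: "pmat n id = 1\<^sub>m n"
  by (intro eq_matI) (auto simp: pmat_def)

lemma pmat_GL [simp]:
  assumes "p permutes {..<n}"
  shows "pmat n p \<in> carrier (GL n)"
  by (rule GL_I[of _ n "pmat n (pinv p)"])
    (simp_all add: pmat_mult[OF permutes_inv[OF assms] assms] permutes_inv_o[OF assms])

lemma iv_pmat:
  assumes "p permutes {..<n}"
  shows "iv n (pmat n p) = pmat n (pinv p)"
  by (rule iv_unique)
    (simp_all add: pmat_mult[OF permutes_inv[OF assms] assms] permutes_inv_o[OF assms])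

lemma Ad_pmat:
  assumes "p permutes {..<n}" "X \<in> carrier_mat n n" "r < n" "s < n"
  shows "Ad n (pmat n p) X $$ (r, s) = X $$ (pinv p r, pinv p s)"
  using assms permutes_lt[OF permutes_inv[OF assms(1)]] permutes_inv[OF assms(1)]
  by (simp add: Ad_def iv_pmat pmat_mult_right pmat_mult_left del: index_mult_mat)

lemma Ad_pmat_pat:
  assumes p: "p permutes {..<n}" and X: "X \<in> carrier_mat n n"
  shows "Ad n (pmat n p) X \<in> pat n (upper (b \<circ> pinv p)) \<longleftrightarrow> X \<in> pat n (upper b)"
proof
  assume A: "Ad n (pmat n p) X \<in> pat n (upper (b \<circ> pinv p))"
  have "X $$ (r, s) = 0" if "r < n" "s < n" "\<not> b r \<le> b s" for r s
    using Ad_pmat[OF p X, of "p r" "p s"] pat_zero[OF A, of "p r" "p s"] that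
    by (simp add: permutes_lt[OF p] permutes_inverses[OF p])
  then show "X \<in> pat n (upper b)" using X by (simp add: pat_def)
next
  assume A: "X \<in> pat n (upper b)"
  show "Ad n (pmat n p) X \<in> pat n (upper (b \<circ> pinv p))"
    using p X pat_zero[OF A] permutes_lt[OF permutes_inv[OF p]]
    by (simp add: pat_def Ad_pmat)
qed

lemma Ad_pmat_blk:
  assumes p: "p permutes {..<n}" and X: "X \<in> carrier_mat n n"
  shows "Ad n (pmat n p) (blk n b X) = blk n (b \<circ> pinv p) (Ad n (pmat n p) X)"
proof (rule eq_matI)
  fix r s assume "r < dim_row (blk n (b \<circ> pinv p) (Ad n (pmat n p) X))"
    "s < dim_col (blk n (b \<circ> pinv p) (Ad n (pmat n p) X))"
  then have "r < n" "s < n" by simp_all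
  then show "Ad n (pmat n p) (blk n b X) $$ (r, s) = blk n (b \<circ> pinv p) (Ad n (pmat n p) X) $$ (r, s)"
    using p X permutes_lt[OF permutes_inv[OF p]] by (simp add: Ad_pmat)
qed (use Ad_carrier[OF pmat_GL[OF p] blk_carrier, of b X] in auto)

section \<open>Parabolic subgroups given by gradings\<close>

text \<open>A matrix group \<open>G\<close> with Lie algebra \<open>GG\<close>, together with the gradings \<open>b\<close> (called \<open>adm\<close>) whose
block-diagonal parts preserve \<open>G\<close> and \<open>GG\<close>: in the general linear group all gradings, in the unitary group those
symmetric with respect to the Hermitian form. A transitive pattern \<open>\<rho>\<close> above the diagonal
cuts out a unipotent subgroup of \<open>G\<close> and a space of nilpotent matrices in \<open>GG\<close>; \<open>card_unipotent\<close> compares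
their sizes, which relates sums over radicals of groups and of Lie algebras. The last assumption is the Bruhat
decomposition; the Borel subgroup consists of the upper triangular matrices of \<open>G\<close>.\<close>

locale graded_matrix_group =
  fixes N :: nat and G GG :: "'a::{field,finite} mat set" and adm :: "(nat \<Rightarrow> nat) \<Rightarrow> bool"
  assumes G_subgroup: "subgroup G (GL N)"
    and GG_carrier: "GG \<subseteq> carrier_mat N N"
    and GG_zero: "0\<^sub>m N N \<in> GG"
    and GG_add: "\<And>X Y. X \<in> GG \<Longrightarrow> Y \<in> GG \<Longrightarrow> X + Y \<in> GG"
    and GG_diff: "\<And>X Y. X \<in> GG \<Longrightarrow> Y \<in> GG \<Longrightarrow> X - Y \<in> GG"
    and GG_Ad: "\<And>g X. g \<in> G \<Longrightarrow> X \<in> GG \<Longrightarrow> Ad N g X \<in> GG"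
    and blk_G: "\<And>b g. adm b \<Longrightarrow> g \<in> G \<Longrightarrow> g \<in> pat N (upper b) \<Longrightarrow> blk N b g \<in> G"
    and blk_GG: "\<And>b X. adm b \<Longrightarrow> X \<in> GG \<Longrightarrow> blk N b X \<in> GG"
    and adm_perm: "\<And>b p. adm b \<Longrightarrow> p permutes {..<N} \<Longrightarrow> pmat N p \<in> G \<Longrightarrow> adm (b \<circ> pinv p)"
    and card_unipotent: "\<And>\<rho>. (\<And>r s. r < N \<Longrightarrow> s < N \<Longrightarrow> \<rho> r s \<Longrightarrow> r < s) \<Longrightarrow>
      (\<And>r s t. \<rho> r s \<Longrightarrow> \<rho> s t \<Longrightarrow> \<rho> r t) \<Longrightarrow>
      card {g \<in> G. g - 1\<^sub>m N \<in> pat N \<rho>} = card (GG \<inter> pat N \<rho>)"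
    and bruhat: "\<And>g. g \<in> G \<Longrightarrow> \<exists>b1 p b2. b1 \<in> G \<inter> pat N (\<le>) \<and> b2 \<in> G \<inter> pat N (\<le>) \<and>
      p permutes {..<N} \<and> pmat N p \<in> G \<and> g = b1 * pmat N p * b2"
begin

text \<open>The suffix \<open>g\<close> marks the group and \<open>a\<close> the Lie algebra. Levi part and radical are described by the
block-diagonal part inside the parabolic, because it is this map that splits \<open>P\<close> into \<open>L\<close> and \<open>U\<close>.\<close>

definition Pg :: "(nat \<Rightarrow> nat) \<Rightarrow> 'a mat set" where "Pg b = G \<inter> pat N (upper b)"
definition Lg :: "(nat \<Rightarrow> nat) \<Rightarrow> 'a mat set" where "Lg b = {g \<in> Pg b. blk N b g = g}"
definition Ug :: "(nat \<Rightarrow> nat) \<Rightarrow> 'a mat set" where "Ug b = {g \<in> Pg b. blk N b g = 1\<^sub>m N}"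
definition Pa :: "(nat \<Rightarrow> nat) \<Rightarrow> 'a mat set" where "Pa b = GG \<inter> pat N (upper b)"
definition La :: "(nat \<Rightarrow> nat) \<Rightarrow> 'a mat set" where "La b = {X \<in> Pa b. blk N b X = X}"
definition Ua :: "(nat \<Rightarrow> nat) \<Rightarrow> 'a mat set" where "Ua b = {X \<in> Pa b. blk N b X = 0\<^sub>m N N}"
definition parab :: "(nat \<Rightarrow> nat) \<Rightarrow> 'a parabolic" where
  "parab b = \<lparr>levi = Lg b, rad = Ug b, levi_alg = La b, rad_alg = Ua b\<rparr>"

lemma G_GL: "g \<in> G \<Longrightarrow> g \<in> carrier (GL N)"
  using subgroup.subset[OF G_subgroup] by blast
lemma G_mult: "g \<in> G \<Longrightarrow> h \<in> G \<Longrightarrow> g * h \<in> G"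
  using subgroup.m_closed[OF G_subgroup, of g h] by simp
lemma G_iv: "g \<in> G \<Longrightarrow> iv N g \<in> G"
  using subgroup.m_inv_closed[OF G_subgroup, of g] by simp
lemma G_one: "1\<^sub>m N \<in> G"
  using subgroup.one_closed[OF G_subgroup] by simp
lemma GG_mat: "X \<in> GG \<Longrightarrow> X \<in> carrier_mat N N"
  using GG_carrier by blast

lemma subgroup_if_closed:
  assumes "K \<subseteq> G" "1\<^sub>m N \<in> K" "\<And>g h. g \<in> K \<Longrightarrow> h \<in> K \<Longrightarrow> g * h \<in> K"
  shows "subgroup K (GL N)"
  using assms G_GL by (intro subgroup_GL_if_closed) auto

lemma Pg_subgroup: "subgroup (Pg b) (GL N)"
  by (rule subgroup_if_closed)
    (auto simp: Pg_def G_mult G_one pat_upper_mult pat_one)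

lemma Lg_subgroup: "subgroup (Lg b) (GL N)"
  by (rule subgroup_if_closed)
    (auto simp: Lg_def Pg_def G_mult G_one pat_upper_mult pat_one blk_mult)

lemma Pg_D: "g \<in> Pg b \<Longrightarrow> g \<in> G" "g \<in> Pg b \<Longrightarrow> g \<in> pat N (upper b)"
    "g \<in> Pg b \<Longrightarrow> g \<in> carrier (GL N)" "g \<in> Pg b \<Longrightarrow> g \<in> carrier_mat N N"
  using G_GL GL_carrier by (auto simp: Pg_def)

lemma Lg_Pg: "g \<in> Lg b \<Longrightarrow> g \<in> Pg b" and Ug_Pg: "g \<in> Ug b \<Longrightarrow> g \<in> Pg b"
  by (simp_all add: Lg_def Ug_def)

lemma subgroupD:
  assumes "subgroup K (GL N)"
  shows "g \<in> K \<Longrightarrow> iv N g \<in> K" "g \<in> K \<Longrightarrow> h \<in> K \<Longrightarrow> g * h \<in> K"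
  using subgroup.m_inv_closed[OF assms, of g] subgroup.m_closed[OF assms, of g h] by simp_all

lemma finite_sets: "finite G" "finite GG" "finite (Pg b)" "finite (Lg b)" "finite (Ug b)"
    "finite (Pa b)" "finite (La b)" "finite (Ua b)"
proof -
  show "finite G" by (rule finite_subset[OF _ finite_GL[of N]]) (use G_GL in blast)
  then show "finite (Pg b)" "finite (Lg b)" "finite (Ug b)" by (auto simp: Pg_def Lg_def Ug_def)
  show "finite GG" by (rule finite_subset[OF GG_carrier finite_carrier_mat])
  then show "finite (Pa b)" "finite (La b)" "finite (Ua b)" by (auto simp: Pa_def La_def Ua_def)
qed

lemma blk_Lg: "adm b \<Longrightarrow> p \<in> Pg b \<Longrightarrow> blk N b p \<in> Lg b"
  using blk_G by (simp add: Lg_def Pg_def)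

lemma blk_La: "adm b \<Longrightarrow> X \<in> Pa b \<Longrightarrow> blk N b X \<in> La b"
  using blk_GG by (simp add: La_def Pa_def)

lemma blk_iv:
  assumes "adm b" "p \<in> Pg b"
  shows "blk N b (iv N p) = iv N (blk N b p)"
proof (rule iv_unique[symmetric])
  have "iv N p \<in> Pg b" using assms Pg_subgroup subgroupD by blast
  then show "blk N b (iv N p) * blk N b p = 1\<^sub>m N"
    using assms Pg_D[of "iv N p"] Pg_D[of p] by (simp add: blk_mult[symmetric])
qed simp_all

text \<open>On \<open>S \<inter> P\<close> the block-diagonal part is an idempotent endomorphism, so \<open>S \<inter> P\<close> is the semidirect product
of its image and its kernel. With \<open>S\<close> equal to \<open>G\<close>, to a Levi subgroup or to another parabolic subgroup, this
covers all factorizations that are needed.\<close>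

lemma Levi_decomposition:
  assumes b: "adm b" and S: "subgroup S (GL N)" "S \<subseteq> G"
    and blk: "\<And>p. p \<in> S \<inter> Pg b \<Longrightarrow> blk N b p \<in> S"
  shows "bij_betw (\<lambda>(l, u). l * u) ((S \<inter> Lg b) \<times> (S \<inter> Ug b)) (S \<inter> Pg b)"
    and "\<And>l u. l \<in> Lg b \<Longrightarrow> u \<in> Ug b \<Longrightarrow> blk N b (l * u) = l"
proof -
  show blk_lu: "blk N b (l * u) = l" if "l \<in> Lg b" "u \<in> Ug b" for l u
    using that Pg_D[of l b] Pg_D[of u b] by (simp add: Lg_def Ug_def blk_mult)
  note cl = subgroupD[OF S(1)] subgroupD[OF Pg_subgroup]
  show "bij_betw (\<lambda>(l, u). l * u) ((S \<inter> Lg b) \<times> (S \<inter> Ug b)) (S \<inter> Pg b)"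
  proof (rule bij_betw_byWitness[where f' = "\<lambda>p. (blk N b p, iv N (blk N b p) * p)"], goal_cases)
    case 1
    show ?case
    proof (clarsimp simp: blk_lu)
      fix l u assume "l \<in> Lg b" "u \<in> Ug b"
      then have "l \<in> carrier (GL N)" "u \<in> carrier_mat N N"
        using Pg_D(3)[OF Lg_Pg] Pg_D(4)[OF Ug_Pg] by simp_all
      then show "iv N l * (l * u) = u" by simp
    qed
  next
    case 2
    show ?case
    proof (clarsimp)
      fix p assume "p \<in> Pg b"
      then show "blk N b p * (iv N (blk N b p) * p) = p"
        using Pg_D[of p] Pg_D[OF Lg_Pg[OF blk_Lg[OF b]], of p] by simp
    qed
  next
    case 3
    show ?case using cl Lg_Pg Ug_Pg by auto
  next
    case 4
    show ?case
    proof (rule image_subsetI, simp)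
      fix p assume p: "p \<in> S \<and> p \<in> Pg b"
      then have l: "blk N b p \<in> Lg b" "blk N b p \<in> S" using blk_Lg[OF b] blk by auto
      have il: "iv N (blk N b p) \<in> Pg b" using l Lg_Pg cl by blast
      have "blk N b (iv N (blk N b p) * p) = iv N (blk N b p) * blk N b p"
        using il p Pg_D[of p] Pg_D[OF il] blk_iv[OF b Lg_Pg[OF l(1)]] by (simp add: blk_mult)
      also have "\<dots> = 1\<^sub>m N" using Pg_D[OF Lg_Pg[OF l(1)]] by simp
      finally have "iv N (blk N b p) * p \<in> Ug b" using il p cl by (simp add: Ug_def)
      then show "blk N b p \<in> S \<and> blk N b p \<in> Lg b \<and>
          iv N (blk N b p) * p \<in> S \<and> iv N (blk N b p) * p \<in> Ug b"
        using l p cl by blast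
    qed
  qed
qed

text \<open>The additive counterpart, with the block-diagonal part as an idempotent linear map.\<close>

lemma algebra_decomposition:
  assumes b: "adm b" and T: "T \<subseteq> GG" "\<And>X Y. X \<in> T \<Longrightarrow> Y \<in> T \<Longrightarrow> X + Y \<in> T"
      "\<And>X Y. X \<in> T \<Longrightarrow> Y \<in> T \<Longrightarrow> X - Y \<in> T"
    and blk: "\<And>X. X \<in> T \<inter> Pa b \<Longrightarrow> blk N b X \<in> T"
  shows "bij_betw (\<lambda>(Y, Z). Y + Z) ((T \<inter> La b) \<times> (T \<inter> Ua b)) (T \<inter> Pa b)"
    and "\<And>Y Z. Y \<in> La b \<Longrightarrow> Z \<in> Ua b \<Longrightarrow> blk N b (Y + Z) = Y"
proof -
  have car: "X \<in> Pa b \<Longrightarrow> X \<in> carrier_mat N N" "X \<in> La b \<Longrightarrow> X \<in> Pa b" "X \<in> Ua b \<Longrightarrow> X \<in> Pa b" for X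
    by (simp_all add: Pa_def La_def Ua_def GG_mat)
  show blk_YZ: "blk N b (Y + Z) = Y" if YZ: "Y \<in> La b" "Z \<in> Ua b" for Y Z
  proof -
    have c: "Y \<in> carrier_mat N N" "Z \<in> carrier_mat N N" using YZ car by blast+
    have "blk N b Y = Y" "blk N b Z = 0\<^sub>m N N" using YZ by (simp_all add: La_def Ua_def)
    then show ?thesis using c by (simp add: blk_add)
  qed
  show "bij_betw (\<lambda>(Y, Z). Y + Z) ((T \<inter> La b) \<times> (T \<inter> Ua b)) (T \<inter> Pa b)"
  proof (rule bij_betw_byWitness[where f' = "\<lambda>X. (blk N b X, X - blk N b X)"], goal_cases)
    case 1
    show ?case
    proof (clarsimp simp: blk_YZ)
      fix Y Z assume "Y \<in> La b" "Z \<in> Ua b"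
      then have "Y \<in> carrier_mat N N" "Z \<in> carrier_mat N N" using car by blast+
      then show "Y + Z - Y = Z" by (rule mat_add_diff_cancel(2))
    qed
  next
    case 2
    show ?case
    proof
      fix X assume "X \<in> T \<inter> Pa b"
      then have "X \<in> carrier_mat N N" using car(1) by blast
      then show "(\<lambda>(Y, Z). Y + Z) (blk N b X, X - blk N b X) = X"
        by (simp add: mat_add_diff_cancel(1)[OF blk_carrier])
    qed
  next
    case 3
    show ?case
    proof (rule image_subsetI)
      fix x assume "x \<in> (T \<inter> La b) \<times> (T \<inter> Ua b)"
      then obtain Y Z where YZ: "x = (Y, Z)" "Y \<in> T" "Y \<in> La b" "Z \<in> T" "Z \<in> Ua b" by blast
      have "Y \<in> Pa b" "Z \<in> Pa b" using YZ car(2,3) by blast+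
      then have "Y + Z \<in> Pa b" by (simp add: Pa_def GG_add pat_add)
      then show "(\<lambda>(Y, Z). Y + Z) x \<in> T \<inter> Pa b" using YZ T(2) by simp
    qed
  next
    case 4
    show ?case
    proof (rule image_subsetI)
      fix X assume "X \<in> T \<inter> Pa b"
      then have X: "X \<in> T \<and> X \<in> Pa b" by simp
      then have "blk N b X \<in> La b" "blk N b X \<in> T" using blk_La[OF b] blk by auto
      moreover have "X - blk N b X \<in> Ua b"
        using X car(1)[of X] \<open>blk N b X \<in> La b\<close>
        by (simp add: Ua_def La_def Pa_def GG_diff pat_diff blk_diff)
      ultimately show "(blk N b X, X - blk N b X) \<in> (T \<inter> La b) \<times> (T \<inter> Ua b)"
        using X T(3) by simp
    qed
  qed
qed

text \<open>What the defining constructions amount to for a parabolic cut out of a subgroup \<open>S\<close> with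
  Lie algebra \<open>T\<close> by a grading.\<close>

lemma par_group_cut:
  assumes "adm b" "subgroup S (GL N)" "S \<subseteq> G" "\<And>p. p \<in> S \<inter> Pg b \<Longrightarrow> blk N b p \<in> S"
    and "levi Q = S \<inter> Lg b" "rad Q = S \<inter> Ug b"
  shows "par_group N Q = S \<inter> Pg b"
proof -
  have "par_group N Q = (\<lambda>(l, u). l * u) ` ((S \<inter> Lg b) \<times> (S \<inter> Ug b))"
    by (auto simp: par_group_def set_mult_def assms(5,6))
  then show ?thesis
    using Levi_decomposition(1)[OF assms(1-4)] by (simp add: bij_betw_def)
qed

lemma par_alg_cut:
  assumes b: "adm b" and T: "T \<subseteq> GG" "\<And>X Y. X \<in> T \<Longrightarrow> Y \<in> T \<Longrightarrow> X + Y \<in> T"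
      "\<And>X Y. X \<in> T \<Longrightarrow> Y \<in> T \<Longrightarrow> X - Y \<in> T" "\<And>X. X \<in> T \<inter> Pa b \<Longrightarrow> blk N b X \<in> T"
    and Q: "levi_alg Q = T \<inter> La b" "rad_alg Q = T \<inter> Ua b"
  shows "par_alg Q = T \<inter> Pa b" "\<And>X. X \<in> T \<inter> Pa b \<Longrightarrow> levi_proj Q X = blk N b X"
proof -
  note dec = algebra_decomposition[OF b T]
  have "par_alg Q = (\<lambda>(Y, Z). Y + Z) ` ((T \<inter> La b) \<times> (T \<inter> Ua b))"
    by (auto simp: par_alg_def Q)
  then show "par_alg Q = T \<inter> Pa b" using dec(1) by (simp add: bij_betw_def)
  fix X assume "X \<in> T \<inter> Pa b"
  then have "X \<in> (\<lambda>(Y, Z). Y + Z) ` ((T \<inter> La b) \<times> (T \<inter> Ua b))"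
    using dec(1) unfolding bij_betw_def by blast
  then obtain Y Z where YZ: "Y \<in> T \<inter> La b" "Z \<in> T \<inter> Ua b" "X = Y + Z"
    by (elim imageE SigmaE) simp
  then have "blk N b X = Y" using dec(2) by simp
  moreover have "levi_proj Q X = Y"
    unfolding levi_proj_def
  proof (rule the_equality)
    show "Y \<in> levi_alg Q \<and> (\<exists>Z\<in>rad_alg Q. X = Y + Z)" using YZ Q by auto
    fix Y' assume "Y' \<in> levi_alg Q \<and> (\<exists>Z\<in>rad_alg Q. X = Y' + Z)"
    then obtain Z' where "Y' \<in> La b" "Z' \<in> Ua b" "X = Y' + Z'" using Q by auto
    then show "Y' = Y" using dec(2)[of Y' Z'] \<open>blk N b X = Y\<close> by simp
  qed
  ultimately show "levi_proj Q X = blk N b X" by simp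
qed

lemma La_Pa: "X \<in> La b \<Longrightarrow> X \<in> Pa b" and Ua_Pa: "X \<in> Ua b \<Longrightarrow> X \<in> Pa b"
  by (simp_all add: La_def Ua_def)

lemma Pa_D: "X \<in> Pa b \<Longrightarrow> X \<in> GG" "X \<in> Pa b \<Longrightarrow> X \<in> pat N (upper b)"
    "X \<in> Pa b \<Longrightarrow> X \<in> carrier_mat N N"
  by (simp_all add: Pa_def GG_mat)

lemma Pa_add: "X \<in> Pa b \<Longrightarrow> Y \<in> Pa b \<Longrightarrow> X + Y \<in> Pa b"
  and Pa_diff: "X \<in> Pa b \<Longrightarrow> Y \<in> Pa b \<Longrightarrow> X - Y \<in> Pa b"
  by (simp_all add: Pa_def GG_add GG_diff pat_add pat_diff)

lemma blk_La_add_Ua: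
  assumes "adm b" "Y \<in> La b" "Z \<in> Ua b"
  shows "blk N b (Y + Z) = Y"
proof (rule algebra_decomposition(2)[OF assms(1) subset_refl GG_add GG_diff _ assms(2,3)])
  show "blk N b X \<in> GG" if "X \<in> GG \<inter> Pa b" for X using that blk_GG[OF assms(1)] by blast
qed

lemma La_add: "X \<in> La b \<Longrightarrow> Y \<in> La b \<Longrightarrow> X + Y \<in> La b"
  and La_diff: "X \<in> La b \<Longrightarrow> Y \<in> La b \<Longrightarrow> X - Y \<in> La b"
  using Pa_D[of X b] Pa_D[of Y b] by (auto simp: La_def Pa_add Pa_diff blk_add blk_diff)

lemma Ua_add: "X \<in> Ua b \<Longrightarrow> Y \<in> Ua b \<Longrightarrow> X + Y \<in> Ua b"
  and Ua_diff: "X \<in> Ua b \<Longrightarrow> Y \<in> Ua b \<Longrightarrow> X - Y \<in> Ua b"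
  using Pa_D[of X b] Pa_D[of Y b] by (auto simp: Ua_def Pa_add Pa_diff blk_add blk_diff)

text \<open>Block-diagonal parts for two gradings commute, so what one of them defines is stable under the
other.\<close>

lemma blk_Lg_cut: "adm c \<Longrightarrow> p \<in> Lg b \<inter> Pg c \<Longrightarrow> blk N c p \<in> Lg b"
  using blk_G[of c p] blk_pat[of p N "upper b" c]
  by (auto simp: Lg_def Pg_def) (metis blk_commute)

lemma blk_La_cut: "adm c \<Longrightarrow> X \<in> La b \<Longrightarrow> blk N c X \<in> La b"
  using blk_GG[of c X] blk_pat[of X N "upper b" c]
  by (auto simp: La_def Pa_def) (metis blk_commute)

lemma blk_Ua_cut: "adm c \<Longrightarrow> X \<in> Ua b \<Longrightarrow> blk N c X \<in> Ua b"
  using blk_GG[of c X] blk_pat[of X N "upper b" c]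
  by (auto simp: Ua_def Pa_def) (metis blk_commute blk_zero)

lemma par_group_parab: "adm b \<Longrightarrow> par_group N (parab b) = Pg b"
  using par_group_cut[of b G "parab b"] G_subgroup Lg_Pg Ug_Pg Pg_D(1) blk_G
  by (auto simp: parab_def Lg_def Ug_def Pg_def intro!: arg_cong2[where f = "(\<inter>)"])

lemma par_alg_parab:
  assumes "adm b"
  shows "par_alg (parab b) = Pa b" "\<And>X. X \<in> Pa b \<Longrightarrow> levi_proj (parab b) X = blk N b X"
proof -
  have eq: "GG \<inter> La b = La b" "GG \<inter> Ua b = Ua b" "GG \<inter> Pa b = Pa b"
    by (auto simp: La_def Ua_def Pa_def)
  note * = par_alg_cut[where T = GG and Q = "parab b", OF assms subset_refl GG_add GG_diff,
      unfolded eq, simplified parab_def parabolic.simps]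
  show "par_alg (parab b) = Pa b" "\<And>X. X \<in> Pa b \<Longrightarrow> levi_proj (parab b) X = blk N b X"
    using * blk_GG[OF assms] Pa_D(1) by (auto simp: parab_def)
qed

section \<open>Sums over cosets of the nilradical\<close>

lemma Ad_Pa:
  assumes "p \<in> Pg b" "X \<in> Pa b"
  shows "Ad N p X \<in> Pa b"
proof -
  have "iv N p \<in> Pg b" using assms subgroupD[OF Pg_subgroup] by blast
  then show ?thesis
    using assms GG_Ad by (simp add: Pa_def Pg_def Ad_def pat_upper_mult)
qed

lemma blk_Ad:
  assumes "adm b" "p \<in> Pg b" "X \<in> Pa b"
  shows "blk N b (Ad N p X) = Ad N (blk N b p) (blk N b X)"
proof -
  have "iv N p \<in> Pg b" using assms subgroupD[OF Pg_subgroup] by blast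
  then show ?thesis
    using assms Pg_D(2) Pa_D(2) by (simp add: Ad_def blk_mult pat_upper_mult blk_iv)
qed

lemma Ad_La: "adm b \<Longrightarrow> l \<in> Lg b \<Longrightarrow> X \<in> La b \<Longrightarrow> Ad N l X \<in> La b"
  using Ad_Pa[of l b X] blk_Ad[of b l X] by (simp add: Lg_def La_def)

lemma Ad_Pa_iff:
  assumes "p \<in> Pg b" "X \<in> GG"
  shows "Ad N p X \<in> Pa b \<longleftrightarrow> X \<in> Pa b"
proof
  assume "Ad N p X \<in> Pa b"
  then have "Ad N (iv N p) (Ad N p X) \<in> Pa b"
    using subgroupD(1)[OF Pg_subgroup assms(1)] by (rule Ad_Pa[rotated])
  moreover have "p \<in> carrier (GL N)" "X \<in> carrier_mat N N"
    using assms Pg_D(3) GG_mat by blast+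
  ultimately show "X \<in> Pa b" by simp
qed (rule Ad_Pa[OF assms(1)])

text \<open>\<open>Y + Ua b\<close> is the set of elements of \<open>Pa b\<close> with block-diagonal part \<open>Y\<close>. As the block-diagonal part of
\<open>Ad N p X\<close> is obtained from that of \<open>X\<close> by conjugation with that of \<open>p\<close>, this set is mapped onto the one for
\<open>Ad N (blk N b p) Y\<close>.\<close>

lemma sum_over_radical_translate:
  fixes \<psi> :: "'a mat \<Rightarrow> real"
  assumes b: "adm b" and p: "p \<in> Pg b" and Y: "Y \<in> La b"
  shows "(\<Sum>Z\<in>Ua b. \<psi> (Ad N p (Y + Z))) = (\<Sum>Z\<in>Ua b. \<psi> (Ad N (blk N b p) Y + Z))"
proof -
  let ?l = "blk N b p"
  have l: "?l \<in> Lg b" using b p by (rule blk_Lg)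
  have ip: "iv N p \<in> Pg b" using p subgroupD[OF Pg_subgroup] by blast
  have lY: "Ad N ?l Y \<in> La b" using b l Y by (rule Ad_La)
  have bil: "blk N b (iv N p) = iv N ?l" using b p by (rule blk_iv)
  have fwd: "Ad N p (Y + Z) - Ad N ?l Y \<in> Ua b" if "Z \<in> Ua b" for Z
  proof -
    have YZ: "Y + Z \<in> Pa b" using Y that by (simp add: Pa_add La_Pa Ua_Pa)
    have "blk N b (Y + Z) = Y"
      using Y that by (rule blk_La_add_Ua[OF b])
    then have "blk N b (Ad N p (Y + Z)) = Ad N ?l Y" using blk_Ad[OF b p YZ] by simp
    moreover have "Ad N p (Y + Z) \<in> Pa b" using p YZ by (rule Ad_Pa)
    ultimately show ?thesis
      using lY Pa_D(3) La_Pa[OF lY] by (auto simp: Ua_def Pa_diff blk_diff La_def)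
  qed
  have bwd: "Ad N (iv N p) (Ad N ?l Y + Z) - Y \<in> Ua b" if "Z \<in> Ua b" for Z
  proof -
    have YZ: "Ad N ?l Y + Z \<in> Pa b" using lY that by (simp add: Pa_add La_Pa Ua_Pa)
    have "blk N b (Ad N ?l Y + Z) = Ad N ?l Y"
      using lY that by (rule blk_La_add_Ua[OF b])
    then have "blk N b (Ad N (iv N p) (Ad N ?l Y + Z)) = Y"
      using blk_Ad[OF b ip YZ] bil Pg_D(3)[OF Lg_Pg[OF l]] Pa_D(3)[OF La_Pa[OF Y]] by simp
    moreover have "Ad N (iv N p) (Ad N ?l Y + Z) \<in> Pa b" using ip YZ by (rule Ad_Pa)
    ultimately show ?thesis
      using Y Pa_D(3) La_Pa[OF Y] by (auto simp: Ua_def Pa_diff blk_diff La_def)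
  qed
  have car: "Z \<in> Ua b \<Longrightarrow> Z \<in> carrier_mat N N" for Z using Pa_D(3)[OF Ua_Pa] .
  have Yc: "Y \<in> carrier_mat N N" "Ad N ?l Y \<in> carrier_mat N N"
    using Pa_D(3)[OF La_Pa] Y lY by auto
  have pc: "p \<in> carrier (GL N)" "iv N p \<in> carrier (GL N)" using p Pg_D(3) by auto
  show ?thesis
  proof (rule sum.reindex_bij_witness[where j = "\<lambda>Z. Ad N p (Y + Z) - Ad N ?l Y"
        and i = "\<lambda>Z. Ad N (iv N p) (Ad N ?l Y + Z) - Y"], goal_cases)
    case (1 Z)
    then show ?case using car Yc pc by (simp add: mat_add_diff_cancel[of _ N N])
  next
    case (2 Z)
    then show ?case using fwd by simp
  next
    case (3 Z)
    then show ?case using car Yc pc by (simp add: mat_add_diff_cancel[of _ N N])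
  next
    case (4 Z)
    then show ?case using bwd by simp
  next
    case (5 Z)
    then show ?case using car Yc pc by (simp add: mat_add_diff_cancel[of _ N N])
  qed
qed

text \<open>The block-diagonal part for \<open>b\<close> of \<open>X + Z\<close> is \<open>X\<close>, and it inherits the pattern for \<open>c\<close>; hence
\<open>X + Z \<in> Pa c\<close> only if both summands are in \<open>Pa c\<close>. Then \<open>Z\<close> has a component in \<open>La c\<close> and one in \<open>Ua c\<close>, and
the latter is invisible to \<open>blk N c\<close>.\<close>

lemma sum_over_radical_two_gradings:
  fixes \<phi> :: "'a mat \<Rightarrow> real"
  assumes b: "adm b" and c: "adm c" and X: "X \<in> La b"
  shows "(\<Sum>Z\<in>Ua b. if X + Z \<in> Pa c then \<phi> (blk N c (X + Z)) else 0) =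
    real (card (Ua b \<inter> Ua c)) *
      (if X \<in> Pa c then \<Sum>Z\<in>Ua b \<inter> La c. \<phi> (blk N c X + Z) else 0)"
proof -
  have Xc: "X \<in> carrier_mat N N" using Pa_D(3)[OF La_Pa[OF X]] .
  have car: "Z \<in> Ua b \<Longrightarrow> Z \<in> carrier_mat N N" for Z using Pa_D(3)[OF Ua_Pa] .
  have blkb: "blk N b (X + Z) = X" if "Z \<in> Ua b" for Z
    using X that by (rule blk_La_add_Ua[OF b])
  have split: "X + Z \<in> Pa c \<longleftrightarrow> X \<in> Pa c \<and> Z \<in> Pa c" if Z: "Z \<in> Ua b" for Z
  proof
    assume A: "X + Z \<in> Pa c"
    have "blk N b (X + Z) \<in> pat N (upper c)" using Pa_D(2)[OF A] by (rule blk_pat)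
    then have XP: "X \<in> Pa c" using blkb[OF Z] X Pa_D(1)[OF La_Pa[OF X]] by (simp add: Pa_def)
    moreover have "Z = (X + Z) - X" using Xc car[OF Z] by (simp add: mat_add_diff_cancel[of _ N N])
    ultimately show "X \<in> Pa c \<and> Z \<in> Pa c" using A Pa_diff[of "X + Z" c X] by simp
  qed (simp add: Pa_add)
  show ?thesis
  proof (cases "X \<in> Pa c")
    case False
    then show ?thesis using split by simp
  next
    case True
    note dec = algebra_decomposition[OF c, of "Ua b"]
    have bij: "bij_betw (\<lambda>(Y, Z). Y + Z) ((Ua b \<inter> La c) \<times> (Ua b \<inter> Ua c)) (Ua b \<inter> Pa c)"
      using Pa_D(1) Ua_Pa Ua_add Ua_diff blk_Ua_cut[OF c] by (intro dec(1)) auto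
    have "(\<Sum>Z\<in>Ua b. if X + Z \<in> Pa c then \<phi> (blk N c (X + Z)) else 0) =
        (\<Sum>Z\<in>Ua b \<inter> Pa c. \<phi> (blk N c (X + Z)))"
      using True split finite_sets(8)[of b] by (simp add: sum.inter_restrict cong: sum.cong)
    also have "\<dots> = (\<Sum>(Y, Z)\<in>(Ua b \<inter> La c) \<times> (Ua b \<inter> Ua c). \<phi> (blk N c (X + (Y + Z))))"
      using sum.reindex_bij_betw[OF bij, of "\<lambda>Z. \<phi> (blk N c (X + Z))"] by (simp add: case_prod_beta)
    also have "\<dots> = (\<Sum>(Y, Z)\<in>(Ua b \<inter> La c) \<times> (Ua b \<inter> Ua c). \<phi> (blk N c X + Y))"
    proof (intro sum.cong refl, clarsimp)
      fix Y Z assume YZ: "Y \<in> Ua b" "Y \<in> La c" "Z \<in> Ua b" "Z \<in> Ua c"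
      have "blk N c (Y + Z) = Y" using Pa_D(1) Ua_Pa Ua_add Ua_diff blk_Ua_cut[OF c] YZ
        by (intro dec(2)) auto
      then show "\<phi> (blk N c (X + (Y + Z))) = \<phi> (blk N c X + Y)"
        using Xc car YZ by (simp add: blk_add)
    qed
    also have "\<dots> = real (card (Ua b \<inter> Ua c)) * (\<Sum>Y\<in>Ua b \<inter> La c. \<phi> (blk N c X + Y))"
      by (simp add: sum.cartesian_product[symmetric] sum_distrib_left)
    finally show ?thesis using True by simp
  qed
qed

lemma card_Ua_cut:
  assumes "adm c"
  shows "card (Ua b \<inter> Pa c) = card (Ua b \<inter> La c) * card (Ua b \<inter> Ua c)"
proof -
  have "bij_betw (\<lambda>(Y, Z). Y + Z) ((Ua b \<inter> La c) \<times> (Ua b \<inter> Ua c)) (Ua b \<inter> Pa c)"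
    using assms Pa_D(1) Ua_Pa Ua_add Ua_diff blk_Ua_cut by (intro algebra_decomposition(1)) auto
  then show ?thesis using bij_betw_same_card by (fastforce simp: card_cartesian_product)
qed

section \<open>Conjugation by permutation matrices\<close>

lemma Ad_G_iff:
  assumes g: "g \<in> G" and X: "X \<in> carrier_mat N N"
  shows "Ad N g X \<in> G \<longleftrightarrow> X \<in> G" "Ad N g X \<in> GG \<longleftrightarrow> X \<in> GG"
proof -
  have gc: "g \<in> carrier (GL N)" using g by (rule G_GL)
  have clos: "Ad N h Z \<in> G" if "h \<in> G" "Z \<in> G" for h Z
    using that by (simp add: Ad_def G_mult G_iv)
  show "Ad N g X \<in> G \<longleftrightarrow> X \<in> G"
    using clos[OF g, of X] clos[OF G_iv[OF g], of "Ad N g X"] gc X by auto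
  show "Ad N g X \<in> GG \<longleftrightarrow> X \<in> GG"
    using GG_Ad[OF g, of X] GG_Ad[OF G_iv[OF g], of "Ad N g X"] gc X by auto
qed

text \<open>Conjugation by the permutation matrix of \<open>p\<close> turns everything defined by \<open>b\<close> into its analogue for
\<open>b \<circ> p\<inverse>\<close>. In this way \<open>w P w\<inverse>\<close> is again given by a grading.\<close>

lemma Ad_twist_iff:
  fixes b :: "nat \<Rightarrow> nat"
  assumes p: "p permutes {..<N}" "pmat N p \<in> G" and X: "X \<in> carrier_mat N N"
  defines "w \<equiv> pmat N p" and "c \<equiv> b \<circ> pinv p"
  shows "Ad N w X \<in> Pg c \<longleftrightarrow> X \<in> Pg b" "Ad N w X \<in> Lg c \<longleftrightarrow> X \<in> Lg b"
    "Ad N w X \<in> Ug c \<longleftrightarrow> X \<in> Ug b" "Ad N w X \<in> Pa c \<longleftrightarrow> X \<in> Pa b"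
    "Ad N w X \<in> La c \<longleftrightarrow> X \<in> La b" "Ad N w X \<in> Ua c \<longleftrightarrow> X \<in> Ua b"
proof -
  have w: "w \<in> G" "w \<in> carrier (GL N)" using p by (simp_all add: w_def)
  have pat: "Ad N w X \<in> pat N (upper c) \<longleftrightarrow> X \<in> pat N (upper b)"
    unfolding w_def c_def by (rule Ad_pmat_pat[OF p(1) X])
  have blk: "blk N c (Ad N w X) = Ad N w (blk N b X)"
    unfolding w_def c_def by (rule Ad_pmat_blk[OF p(1) X, symmetric])
  have inj: "Ad N w A = Ad N w B \<longleftrightarrow> A = B" if "A \<in> carrier_mat N N" "B \<in> carrier_mat N N" for A B
    using w(2) that by (metis Ad_iv(2))
  have one: "Ad N w (1\<^sub>m N) = 1\<^sub>m N" using w(2) by (simp add: Ad_def)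
  have zero: "Ad N w (0\<^sub>m N N) = 0\<^sub>m N N"
    using GL_carrier[OF w(2)] GL_carrier[OF GL_iv[OF w(2)]] by (simp add: Ad_def)
  have b1: "blk N c (Ad N w X) = Ad N w X \<longleftrightarrow> blk N b X = X"
    using inj[of "blk N b X" X] X by (simp add: blk)
  have b2: "blk N c (Ad N w X) = 1\<^sub>m N \<longleftrightarrow> blk N b X = 1\<^sub>m N"
    using inj[of "blk N b X" "1\<^sub>m N"] by (simp add: blk one)
  have b3: "blk N c (Ad N w X) = 0\<^sub>m N N \<longleftrightarrow> blk N b X = 0\<^sub>m N N"
    using inj[of "blk N b X" "0\<^sub>m N N"] by (simp add: blk zero)
  note * = pat Ad_G_iff[OF w(1) X] b1 b2 b3
  show "Ad N w X \<in> Pg c \<longleftrightarrow> X \<in> Pg b" "Ad N w X \<in> Lg c \<longleftrightarrow> X \<in> Lg b"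
    "Ad N w X \<in> Ug c \<longleftrightarrow> X \<in> Ug b" "Ad N w X \<in> Pa c \<longleftrightarrow> X \<in> Pa b"
    "Ad N w X \<in> La c \<longleftrightarrow> X \<in> La b" "Ad N w X \<in> Ua c \<longleftrightarrow> X \<in> Ua b"
    unfolding Pg_def Lg_def Ug_def Pa_def La_def Ua_def using * by simp_all
qed

lemma mat_subsets: "Pg b \<subseteq> carrier_mat N N" "Lg b \<subseteq> carrier_mat N N" "Ug b \<subseteq> carrier_mat N N"
    "Pa b \<subseteq> carrier_mat N N" "La b \<subseteq> carrier_mat N N" "Ua b \<subseteq> carrier_mat N N"
  using Pg_D(4) Lg_Pg Ug_Pg Pa_D(3) La_Pa Ua_Pa by blast+

lemma Ad_twist_image:
  assumes p: "p permutes {..<N}" "pmat N p \<in> G"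
  shows "Ad N (pmat N p) ` Pg b = Pg (b \<circ> pinv p)" "Ad N (pmat N p) ` Lg b = Lg (b \<circ> pinv p)"
    "Ad N (pmat N p) ` Ug b = Ug (b \<circ> pinv p)" "Ad N (pmat N p) ` La b = La (b \<circ> pinv p)"
    "Ad N (pmat N p) ` Ua b = Ua (b \<circ> pinv p)"
  by (rule Ad_image_eq; (rule pmat_GL[OF p(1)] mat_subsets Ad_twist_iff[OF p], assumption?))+

lemma par_cut_parab:
  assumes "p permutes {..<N}" "pmat N p \<in> G"
  shows "par_cut N (parab b') (parab b) (pmat N p) =
    \<lparr>levi = Lg b' \<inter> Lg (b \<circ> pinv p), rad = Lg b' \<inter> Ug (b \<circ> pinv p),
     levi_alg = La b' \<inter> La (b \<circ> pinv p), rad_alg = La b' \<inter> Ua (b \<circ> pinv p)\<rparr>"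
  by (simp add: par_cut_def parab_def Ad_twist_image[OF assms])

section \<open>Double cosets\<close>

lemma pmat_Lg:
  assumes "p permutes {..<N}" "pmat N p \<in> G" "\<And>s. s < N \<Longrightarrow> b (p s) = b s"
  shows "pmat N p \<in> Lg b"
proof -
  have z: "pmat N p $$ (r, s) = 0" if "r < N" "s < N" "b r \<noteq> b s" for r s
    using that assms(3)[of s] by (auto simp: pmat_def)
  have "pmat N p \<in> pat N (upper b)"
    by (simp add: pat_def) (metis z order_refl)
  moreover have "blk N b (pmat N p) = (pmat N p :: 'a mat)"
  proof (rule eq_matI)
    fix r s assume "r < dim_row (pmat N p :: 'a mat)" "s < dim_col (pmat N p :: 'a mat)"
    then have "r < N" "s < N" by (simp_all add: pmat_def)
    then show "blk N b (pmat N p) $$ (r, s) = pmat N p $$ (r, s)"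
      using z[of r s] by (cases "b r = b s") auto
  qed (simp_all add: pmat_def)
  ultimately show ?thesis using assms by (simp add: Lg_def Pg_def)
qed

lemma borel_Pg:
  assumes "mono_on {..<N} b" "g \<in> G \<inter> pat N (\<le>)"
  shows "g \<in> Pg b"
  using assms pat_mono[of g N "(\<le>)" "upper b"] by (auto simp: Pg_def mono_on_def)

text \<open>Write the common value as \<open>b1 \<pi> b2\<close> with triangular \<open>b1\<close>, \<open>b2\<close> and a permutation \<open>\<pi>\<close>. Then
\<open>(b1\<inverse> x) u = \<pi> b2\<close>, and the entries at \<open>(\<pi> s, s)\<close> on the right are diagonal entries of \<open>b2\<close>, hence nonzero.
As \<open>b1\<inverse> x\<close> is block upper triangular for \<open>b'\<close>, this gives \<open>b' (\<pi> s) \<le> b' (u s)\<close> for all \<open>s\<close>, and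
equality by comparing sums. So \<open>\<pi>\<close> and \<open>u\<close> differ by a permutation of the rows that preserves \<open>b'\<close>. In the
same way \<open>\<pi>\<close> and \<open>v\<close> differ by a permutation of the columns that preserves \<open>b\<close>. Taking \<open>\<pi>\<close> from the
decomposition inside \<open>G\<close> ensures that these permutations belong to \<open>G\<close>.\<close>

lemma same_double_coset:
  assumes b: "mono_on {..<N} b" and b': "mono_on {..<N} b'"
    and u: "u permutes {..<N}" "pmat N u \<in> G" and v: "v permutes {..<N}" "pmat N v \<in> G"
    and x: "x \<in> Pg b'" and y: "y \<in> Pg b" and eq: "x * pmat N u = pmat N v * y"
  obtains \<sigma> \<tau> where "\<sigma> permutes {..<N}" "pmat N \<sigma> \<in> Lg b'" "\<tau> permutes {..<N}" "pmat N \<tau> \<in> Lg b"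
    "v = \<sigma> \<circ> u \<circ> \<tau>"
proof -
  have "x * pmat N u \<in> G" using x u Pg_D(1) G_mult by blast
  from bruhat[OF this] obtain b1 p b2 where
    B: "b1 \<in> G \<inter> pat N (\<le>)" "b2 \<in> G \<inter> pat N (\<le>)" and
    p: "p permutes {..<N}" "pmat N p \<in> G" and m: "x * pmat N u = b1 * pmat N p * b2"
    by blast
  have car: "x \<in> carrier_mat N N" "y \<in> carrier_mat N N" "b1 \<in> carrier (GL N)" "b2 \<in> carrier (GL N)"
    using x y B G_GL Pg_D(4) by blast+
  note carm = car(1,2) GL_carrier[OF car(3)] GL_carrier[OF car(4)]
    GL_carrier[OF GL_iv[OF car(3)]] GL_carrier[OF GL_iv[OF car(4)]]
  have A: "iv N b1 * x \<in> Pg b'"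
    using borel_Pg[OF b' B(1)] x subgroupD[OF Pg_subgroup] by blast
  have Ae: "(iv N b1 * x) * pmat N u = pmat N p * b2"
    using m carm car(3) by (simp add: mat_assoc[of _ N])
  have C: "y * iv N b2 \<in> Pg b"
    using borel_Pg[OF b B(2)] y subgroupD[OF Pg_subgroup] by blast
  have "pmat N v * (y * iv N b2) = (b1 * pmat N p * b2) * iv N b2"
    using m eq carm by (simp add: mat_assoc[of _ N, symmetric])
  also have "\<dots> = b1 * pmat N p"
    using carm car(4) by (simp add: mat_assoc[of _ N])
  finally have Ce: "pmat N v * (y * iv N b2) = b1 * pmat N p" .
  have piv: "pinv v permutes {..<N}" "pinv u permutes {..<N}" "pinv p permutes {..<N}"
    using u v p by (auto intro: permutes_inv)
  have b'_le: "b' (p s) \<le> b' (u s)" if s: "s < N" for s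
  proof -
    have lt: "p s < N" "u s < N" using s permutes_lt[OF p(1)] permutes_lt[OF u(1)] by auto
    have "((iv N b1 * x) * pmat N u) $$ (p s, s) = (iv N b1 * x) $$ (p s, u s)"
      using s lt carm u by (intro pmat_mult_right) simp_all
    moreover have "(pmat N p * b2) $$ (p s, s) = b2 $$ (s, s)"
      using s lt carm p by (subst pmat_mult_left) (simp_all add: permutes_inverses[OF p(1)])
    ultimately have "(iv N b1 * x) $$ (p s, u s) \<noteq> 0"
      using Ae triangular_diag_nonzero[OF car(4) IntD2[OF B(2)] s] by metis
    then show ?thesis using pat_zero[OF Pg_D(2)[OF A] lt] by blast
  qed
  have b_le: "b (pinv v (p s)) \<le> b s" if s: "s < N" for s
  proof -
    have lt: "p s < N" "pinv v (p s) < N" using s permutes_lt[OF p(1)] permutes_lt[OF piv(1)] by auto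
    have "(pmat N v * (y * iv N b2)) $$ (p s, s) = (y * iv N b2) $$ (pinv v (p s), s)"
      using s lt carm v by (intro pmat_mult_left) simp_all
    moreover have "(b1 * pmat N p) $$ (p s, s) = b1 $$ (p s, p s)"
      using s lt carm p by (intro pmat_mult_right) simp_all
    ultimately have "(y * iv N b2) $$ (pinv v (p s), s) \<noteq> 0"
      using Ce triangular_diag_nonzero[OF car(3) IntD2[OF B(1)] lt(1)] by metis
    then show ?thesis using pat_zero[OF Pg_D(2)[OF C] lt(2) s] by blast
  qed
  have b'_eq: "b' (p s) = b' (u s)" if "s < N" for s
    using permutes_preserves_if_le[where b = b', OF p(1) u(1) b'_le that] by simp
  have perm\<tau>: "(pinv v \<circ> p) permutes {..<N}" using p(1) piv(1) by (rule permutes_compose)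
  have b_eq: "b ((pinv v \<circ> p) s) = b s" if "s < N" for s
    using permutes_preserves_if_le[where b = b, OF perm\<tau> permutes_id _ that] b_le by simp
  define \<sigma> where "\<sigma> = p \<circ> pinv u"
  define \<tau> where "\<tau> = pinv p \<circ> v"
  have G\<sigma>: "pmat N \<sigma> \<in> G"
    using G_mult[OF p(2) G_iv[OF u(2)]] p(1) u(1) piv by (simp add: iv_pmat pmat_mult \<sigma>_def)
  have G\<tau>: "pmat N \<tau> \<in> G"
    using G_mult[OF G_iv[OF p(2)] v(2)] p(1) v(1) piv by (simp add: iv_pmat pmat_mult \<tau>_def)
  show thesis
  proof (rule that)
    show \<sigma>: "\<sigma> permutes {..<N}" and \<tau>: "\<tau> permutes {..<N}"
      unfolding \<sigma>_def \<tau>_def using p(1) v(1) piv by (auto intro: permutes_compose)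
    show "pmat N \<sigma> \<in> Lg b'"
    proof (rule pmat_Lg[OF \<sigma> G\<sigma>])
      fix s assume "s < N"
      then show "b' (\<sigma> s) = b' s"
        using b'_eq[of "pinv u s"] permutes_lt[OF piv(2)] by (simp add: \<sigma>_def permutes_inverses[OF u(1)])
    qed
    show "pmat N \<tau> \<in> Lg b"
    proof (rule pmat_Lg[OF \<tau> G\<tau>])
      fix s assume "s < N"
      then have lt: "\<tau> s < N" using permutes_lt[OF \<tau>] by simp
      have "(pinv v \<circ> p) (\<tau> s) = s"
        by (simp add: \<tau>_def permutes_inverses[OF p(1)] permutes_inverses[OF v(1)])
      then show "b (\<tau> s) = b s" using b_eq[OF lt] by simp
    qed
    show "v = \<sigma> \<circ> u \<circ> \<tau>"
      by (auto simp: \<sigma>_def \<tau>_def fun_eq_iff permutes_inverses[OF u(1)] permutes_inverses[OF p(1)])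
  qed
qed

text \<open>Since \<open>Pg b'\<close> and \<open>Pg b\<close> contain the triangular matrices of \<open>G\<close>, the Bruhat decomposition shows that
representatives from \<open>W\<close> suffice.\<close>

lemma double_cosets_partition:
  assumes b: "mono_on {..<N} b" and b': "mono_on {..<N} b'"
    and W: "W = perm_mats N \<inter> G"
    and D: "double_coset_reps N D (W \<inter> Lg b') W (W \<inter> Lg b)"
  defines "C \<equiv> \<lambda>w. (\<lambda>(x, y). x * w * y) ` (Pg b' \<times> Pg b)"
  shows "G = (\<Union>w\<in>D. C w)" "\<And>v w. v \<in> D \<Longrightarrow> w \<in> D \<Longrightarrow> v \<noteq> w \<Longrightarrow> C v \<inter> C w = {}"
proof -
  have DW: "D \<subseteq> W" and ex1: "\<And>x. x \<in> W \<Longrightarrow>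
      \<exists>!w. w \<in> D \<and> x \<in> ((W \<inter> Lg b') #>\<^bsub>GL N\<^esub> w) <#>\<^bsub>GL N\<^esub> (W \<inter> Lg b)"
    using D by (auto simp: double_coset_reps_def)
  have mem: "x \<in> ((W \<inter> Lg b') #>\<^bsub>GL N\<^esub> w) <#>\<^bsub>GL N\<^esub> (W \<inter> Lg b) \<longleftrightarrow>
      (\<exists>k\<in>W \<inter> Lg b'. \<exists>h\<in>W \<inter> Lg b. x = k * w * h)" for x w
    by (auto simp: r_coset_def set_mult_def)
  have W_perm: "\<exists>p. p permutes {..<N} \<and> pmat N p \<in> G \<and> w = pmat N p" if "w \<in> W" for w
    using that unfolding W perm_mats_eq by blast
  have WG: "w \<in> W \<Longrightarrow> w \<in> G" for w using W by blast
  show "G = (\<Union>w\<in>D. C w)"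
  proof
    show "G \<subseteq> (\<Union>w\<in>D. C w)"
    proof
      fix g assume "g \<in> G"
      from bruhat[OF this] obtain b1 p b2 where
        B: "b1 \<in> G \<inter> pat N (\<le>)" "b2 \<in> G \<inter> pat N (\<le>)" and
        p: "p permutes {..<N}" "pmat N p \<in> G" and g: "g = b1 * pmat N p * b2"
        by blast
      have "pmat N p \<in> W" using p W perm_mats_eq[of N] by auto
      then obtain w k h where w: "w \<in> D" "k \<in> Lg b'" "h \<in> Lg b" "pmat N p = k * w * h"
        using ex1[of "pmat N p"] mem by blast
      have x: "b1 * k \<in> Pg b'" and y: "h * b2 \<in> Pg b"
        using borel_Pg[OF b' B(1)] borel_Pg[OF b B(2)] w Lg_Pg subgroupD(2)[OF Pg_subgroup] by blast+
      have "b1 \<in> carrier_mat N N" "b2 \<in> carrier_mat N N" "k \<in> carrier_mat N N" "h \<in> carrier_mat N N"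
        "w \<in> carrier_mat N N"
        using B w DW WG G_GL GL_carrier Lg_Pg Pg_D(4) by blast+
      then have "g = (b1 * k) * w * (h * b2)" using g w(4) by (simp add: mat_assoc[of _ N])
      then have "g \<in> C w" using x y unfolding C_def by (intro image_eqI[of _ _ "(b1 * k, h * b2)"]) simp_all
      then show "g \<in> (\<Union>w\<in>D. C w)" using w(1) by blast
    qed
    show "(\<Union>w\<in>D. C w) \<subseteq> G"
      using DW WG Pg_D(1) G_mult by (auto simp: C_def)
  qed
  fix v w assume vw: "v \<in> D" "w \<in> D" "v \<noteq> w"
  show "C v \<inter> C w = {}"
  proof (rule ccontr)
    assume "C v \<inter> C w \<noteq> {}"
    then obtain g where "g \<in> C v" "g \<in> C w" by blast
    then obtain x1 y1 x2 y2 where xy: "x1 \<in> Pg b'" "y1 \<in> Pg b" "x2 \<in> Pg b'" "y2 \<in> Pg b"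
      and e: "x1 * v * y1 = x2 * w * y2"
      unfolding C_def by (elim imageE SigmaE) simp
    obtain s where s: "s permutes {..<N}" "pmat N s \<in> G" "v = pmat N s" using W_perm vw DW by blast
    obtain t where t: "t permutes {..<N}" "pmat N t \<in> G" "w = pmat N t" using W_perm vw DW by blast
    have GLm: "x1 \<in> carrier (GL N)" "y1 \<in> carrier (GL N)" "x2 \<in> carrier (GL N)" "y2 \<in> carrier (GL N)"
      using xy Pg_D(3) by blast+
    note carm = GLm[THEN GL_carrier] GLm[THEN GL_iv, THEN GL_carrier]
    have "(iv N x2 * x1) * pmat N s = iv N x2 * ((x1 * v * y1) * iv N y1)"
      using carm GLm(2) by (simp add: s(3) mat_assoc[of _ N])
    also have "\<dots> = pmat N t * (y2 * iv N y1)"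
      unfolding e using carm GLm(3) by (simp add: t(3) mat_assoc[of _ N])
    finally have e': "(iv N x2 * x1) * pmat N s = pmat N t * (y2 * iv N y1)" .
    have "iv N x2 * x1 \<in> Pg b'" "y2 * iv N y1 \<in> Pg b"
      using xy subgroupD[OF Pg_subgroup] by blast+
    then obtain \<sigma> \<tau> where st: "\<sigma> permutes {..<N}" "pmat N \<sigma> \<in> Lg b'" "\<tau> permutes {..<N}"
      "pmat N \<tau> \<in> Lg b" "t = \<sigma> \<circ> s \<circ> \<tau>"
      using same_double_coset[OF b b' s(1,2) t(1,2) _ _ e'] by blast
    have "w = pmat N \<sigma> * v * pmat N \<tau>"
      using st s t permutes_compose[OF s(1) st(1)] by (simp add: pmat_mult)
    moreover have "pmat N \<sigma> \<in> W" "pmat N \<tau> \<in> W"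
      using st W perm_mats_eq[of N] Lg_Pg Pg_D(1) by blast+
    ultimately have 1: "w \<in> ((W \<inter> Lg b') #>\<^bsub>GL N\<^esub> v) <#>\<^bsub>GL N\<^esub> (W \<inter> Lg b)"
      using st by (auto simp: mem)
    have "pmat N id \<in> perm_mats N" unfolding perm_mats_eq using permutes_id by blast
    moreover have "pmat N id \<in> Lg b'" "pmat N id \<in> Lg b"
      by (rule pmat_Lg; simp add: G_one permutes_id[unfolded id_def])+
    ultimately have "1\<^sub>m N \<in> W \<inter> Lg b'" "1\<^sub>m N \<in> W \<inter> Lg b"
      using W G_one by simp_all
    then have "w \<in> ((W \<inter> Lg b') #>\<^bsub>GL N\<^esub> w) <#>\<^bsub>GL N\<^esub> (W \<inter> Lg b)"
      unfolding mem using t by (intro bexI[of _ "1\<^sub>m N"]) simp_all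
    with 1 show False using ex1[of w] vw DW by blast
  qed
qed

text \<open>The radical of \<open>b\<close> intersected with the parabolic of \<open>c\<close>, described by a single pattern above the
diagonal.\<close>

lemma unipotent_pattern:
  assumes "g \<in> carrier_mat N N"
  shows "g - 1\<^sub>m N \<in> pat N (\<lambda>r s. b r < b s \<and> c r \<le> c s) \<longleftrightarrow>
    g \<in> pat N (upper b) \<and> blk N b g = 1\<^sub>m N \<and> g \<in> pat N (upper c)"
proof
  assume A: "g - 1\<^sub>m N \<in> pat N (\<lambda>r s. b r < b s \<and> c r \<le> c s)"
  have e: "g $$ (r, s) = (if r = s then 1 else 0)" if "r < N" "s < N" "\<not> (b r < b s \<and> c r \<le> c s)" for r s
    using pat_zero[OF A that] that assms by (auto split: if_splits)
  have "blk N b g = 1\<^sub>m N"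
    using e by (intro eq_matI) auto
  moreover have "g \<in> pat N (upper b)" "g \<in> pat N (upper c)"
    unfolding pat_def using e assms by auto
  ultimately show "g \<in> pat N (upper b) \<and> blk N b g = 1\<^sub>m N \<and> g \<in> pat N (upper c)" by simp
next
  assume A: "g \<in> pat N (upper b) \<and> blk N b g = 1\<^sub>m N \<and> g \<in> pat N (upper c)"
  have "(g - 1\<^sub>m N) $$ (r, s) = 0" if rs: "r < N" "s < N" "\<not> (b r < b s \<and> c r \<le> c s)" for r s
  proof (cases "b r = b s")
    case True
    have "blk N b g $$ (r, s) = 1\<^sub>m N $$ (r, s)" using A by simp
    then show ?thesis using True rs assms by simp
  next
    case False
    then have "r \<noteq> s" "\<not> b r \<le> b s \<or> \<not> c r \<le> c s" using rs by auto
    then show ?thesis using A rs assms pat_zero[of g N _ r s] by auto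
  qed
  moreover have "g - 1\<^sub>m N \<in> carrier_mat N N" by (rule minus_carrier_mat) simp
  ultimately show "g - 1\<^sub>m N \<in> pat N (\<lambda>r s. b r < b s \<and> c r \<le> c s)" unfolding pat_def by blast
qed

lemma nilpotent_pattern:
  assumes "X \<in> carrier_mat N N"
  shows "X \<in> pat N (\<lambda>r s. b r < b s \<and> c r \<le> c s) \<longleftrightarrow>
    X \<in> pat N (upper b) \<and> blk N b X = 0\<^sub>m N N \<and> X \<in> pat N (upper c)"
proof
  assume A: "X \<in> pat N (\<lambda>r s. b r < b s \<and> c r \<le> c s)"
  have "blk N b X = 0\<^sub>m N N"
    using pat_zero[OF A] by (intro eq_matI) auto
  then show "X \<in> pat N (upper b) \<and> blk N b X = 0\<^sub>m N N \<and> X \<in> pat N (upper c)"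
    using A by (auto simp: pat_def)
next
  assume A: "X \<in> pat N (upper b) \<and> blk N b X = 0\<^sub>m N N \<and> X \<in> pat N (upper c)"
  have "X $$ (r, s) = 0" if rs: "r < N" "s < N" "\<not> (b r < b s \<and> c r \<le> c s)" for r s
  proof (cases "b r = b s")
    case True
    have "blk N b X $$ (r, s) = 0\<^sub>m N N $$ (r, s)" using A by simp
    then show ?thesis using True rs by simp
  next
    case False
    then have "\<not> b r \<le> b s \<or> \<not> c r \<le> c s" using rs by auto
    then show ?thesis using A rs pat_zero[of X N _ r s] by auto
  qed
  then show "X \<in> pat N (\<lambda>r s. b r < b s \<and> c r \<le> c s)" using assms by (simp add: pat_def)
qed

lemma card_radical_eq:
  assumes b: "mono_on {..<N} b"
  shows "card (Ug b \<inter> Pg c) = card (Ua b \<inter> Pa c)"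
proof -
  let ?\<rho> = "\<lambda>r s. b r < b s \<and> c r \<le> c s"
  have "Ug b \<inter> Pg c = {g \<in> G. g - 1\<^sub>m N \<in> pat N ?\<rho>}"
    using unipotent_pattern[of _ b c] GL_carrier[OF G_GL] by (auto simp: Ug_def Pg_def)
  moreover have "Ua b \<inter> Pa c = GG \<inter> pat N ?\<rho>"
    using nilpotent_pattern[of _ b c] GG_mat by (auto simp: Ua_def Pa_def)
  moreover have "r < s" if "r < N" "s < N" "?\<rho> r s" for r s
    using mono_onD[OF b, of s r] that by (cases "r < s") auto
  moreover have "card {g \<in> G. g - 1\<^sub>m N \<in> pat N ?\<rho>} = card (GG \<inter> pat N ?\<rho>)"
    using calculation(3) by (intro card_unipotent) (assumption, auto)
  ultimately show ?thesis by simp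
qed

section \<open>The Mackey formula for graded matrix groups\<close>

text \<open>The number \<open>h w X\<close> in the proof is what restriction and transport make of \<open>\<Phi>\<close>, extended by zero from the
Lie algebra of \<open>P'\<^sub>w\<close>. Both sides at \<open>Y\<close> are the sum, over \<open>w\<close> and over \<open>g \<in> L'\<close>, of
\<open>h w (Ad N (iv N g) Y)\<close> divided by \<open>|L' \<inter> w P w\<inverse>|\<close>.\<close>

theorem mackey_formula:
  assumes b: "adm b" "mono_on {..<N} b" and b': "adm b'" "mono_on {..<N} b'"
    and W: "W = perm_mats N \<inter> G"
    and D: "double_coset_reps N D (W \<inter> Lg b') W (W \<inter> Lg b)"
    and R: "left_coset_reps N R G (par_group N (parab b))"
    and S: "\<And>w. w \<in> D \<Longrightarrow> left_coset_reps N (S w) (Lg b') (par_group N (par_cut N (parab b') (parab b) w))"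
    and \<Phi>: "\<Phi> \<in> invariant_funs N (Lg b) (La b)"
  shows "(par_res (parab b') \<circ> par_ind N R GG (parab b)) \<Phi> =
    (\<lambda>X\<in>La b'. \<Sum>w\<in>D.
       (par_ind N (S w) (La b') (par_cut N (parab b') (parab b) w)
        \<circ> transport N (levi_alg (par_cut N (parab b') (parab b) w)) w
        \<circ> par_res (par_cut N (parab b) (parab b') (iv N w))) \<Phi> X)"
proof -
  have "\<forall>w\<in>D. \<exists>p. p permutes {..<N} \<and> pmat N p \<in> G \<and> w = pmat N p"
    using D unfolding double_coset_reps_def W perm_mats_eq by blast
  then obtain p where p: "p w permutes {..<N}" "pmat N (p w) \<in> G" "w = pmat N (p w)" if "w \<in> D" for w
    by metis
  have pw: "pmat N (p w) = w" if "w \<in> D" for w using p(3)[OF that] by simp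
  define c where "c w = b \<circ> pinv (p w)" for w
  have c: "adm (c w)" if "w \<in> D" for w
    unfolding c_def by (rule adm_perm[OF b(1) p(1,2)[OF that]])
  have DG: "w \<in> G" "w \<in> carrier (GL N)" if "w \<in> D" for w
    using p(2)[OF that] G_GL unfolding pw[OF that] by blast+
  have finD: "finite D"
    using finite_subset[OF _ finite_sets(1)] DG(1) by blast
  \<comment> \<open>The function \<open>\<Phi>'\<close> of the definition of induction.\<close>
  define infl where "infl X = (if X \<in> Pa b then \<Phi> (blk N b X) else 0)" for X
  have infl_Ad: "infl (Ad N x X) = infl X" if x: "x \<in> Pg b" and X: "X \<in> GG" for x X
  proof (cases "X \<in> Pa b")
    case True
    have "\<Phi> (Ad N (blk N b x) (blk N b X)) = \<Phi> (blk N b X)"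
      using \<Phi> blk_Lg[OF b(1) x] blk_La[OF b(1) True] by (auto simp: invariant_funs_def)
    then show ?thesis using True Ad_Pa[OF x True] blk_Ad[OF b(1) x True] by (simp add: infl_def)
  next
    case False
    then show ?thesis using Ad_Pa_iff[OF x X] by (simp add: infl_def)
  qed
  define \<psi> where "\<psi> w X = infl (Ad N (iv N w) X)" for w X
  have Pg_c: "x \<in> Pg (c w) \<longleftrightarrow> Ad N (iv N w) x \<in> Pg b" if w: "w \<in> D" and x: "x \<in> carrier_mat N N" for w x
    using Ad_twist_iff(1)[OF p(1,2)[OF w], of "Ad N (iv N w) x" b] DG[OF w] x pw[OF w]
    by (simp add: c_def)
  have Pa_c: "X \<in> Pa (c w) \<longleftrightarrow> Ad N (iv N w) X \<in> Pa b" if w: "w \<in> D" and X: "X \<in> carrier_mat N N" for w X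
    using Ad_twist_iff(4)[OF p(1,2)[OF w], of "Ad N (iv N w) X" b] DG[OF w] X pw[OF w]
    by (simp add: c_def)
  have blk_c: "Ad N (iv N w) (blk N (c w) X) = blk N b (Ad N (iv N w) X)"
    if w: "w \<in> D" and X: "X \<in> carrier_mat N N" for w X
  proof -
    have "blk N (c w) (Ad N w (Ad N (iv N w) X)) = Ad N w (blk N b (Ad N (iv N w) X))"
      using Ad_pmat_blk[OF p(1)[OF w], of "Ad N (iv N w) X" b] DG(2)[OF w] X pw[OF w]
      by (simp add: c_def)
    then show ?thesis using DG(2)[OF w] X by simp
  qed
  have \<psi>_eq: "\<psi> w X = (if X \<in> Pa (c w) then \<Phi> (Ad N (iv N w) (blk N (c w) X)) else 0)"
    if w: "w \<in> D" and X: "X \<in> carrier_mat N N" for w X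
    using Pa_c[OF w X] blk_c[OF w X] by (simp add: \<psi>_def infl_def)
  have \<psi>_Ad: "\<psi> w (Ad N x X) = \<psi> w X" if w: "w \<in> D" and x: "x \<in> Pg (c w)" and X: "X \<in> GG" for w x X
  proof -
    have xc: "x \<in> carrier (GL N)" "X \<in> carrier_mat N N" "iv N w \<in> carrier (GL N)"
      using x X Pg_D(3) GG_mat DG(2)[OF w] by auto
    have "iv N w * x = Ad N (iv N w) x * iv N w"
      using xc DG(2)[OF w] by (simp add: Ad_def mat_assoc[of _ N])
    moreover have y: "Ad N (iv N w) x \<in> Pg b" using Pg_c[OF w] x xc(1) by simp
    ultimately have "Ad N (iv N w) (Ad N x X) = Ad N (Ad N (iv N w) x) (Ad N (iv N w) X)"
      using xc Pg_D(3)[OF y] by (simp add: Ad_Ad)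
    then show ?thesis
      using infl_Ad[OF y GG_Ad[OF G_iv[OF DG(1)[OF w]] X]] by (simp add: \<psi>_def)
  qed
  define h where "h w X = (if X \<in> Pa (c w)
      then \<Sum>Z\<in>Ua b' \<inter> La (c w). \<Phi> (Ad N (iv N w) (blk N (c w) X + Z)) else 0)
      / real (card (Ua b' \<inter> La (c w)))" for w X
  have pos: "card (Pg b) > 0" "card (Ua b') > 0" "card (Ua b' \<inter> La e) > 0" "card (Pg b' \<inter> Pg e) > 0"
     "card (Lg b' \<inter> Pg e) > 0" for e
  proof -
    have gt: "card A > 0" if "finite A" "x \<in> A" for A and x :: "'a mat"
      using that card_gt_0_iff by blast
    have "1\<^sub>m N \<in> Pg e" for e using G_one by (simp add: Pg_def pat_one)
    moreover have "1\<^sub>m N \<in> Lg e" for e using \<open>1\<^sub>m N \<in> Pg e\<close> by (simp add: Lg_def)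
    moreover have "0\<^sub>m N N \<in> Pa e" for e using GG_zero by (simp add: Pa_def pat_def)
    moreover have "0\<^sub>m N N \<in> La e" "0\<^sub>m N N \<in> Ua e" for e using \<open>0\<^sub>m N N \<in> Pa e\<close> by (simp_all add: La_def Ua_def)
    ultimately have m: "1\<^sub>m N \<in> Pg b" "0\<^sub>m N N \<in> Ua b'" "0\<^sub>m N N \<in> Ua b' \<inter> La e"
       "1\<^sub>m N \<in> Pg b' \<inter> Pg e" "1\<^sub>m N \<in> Lg b' \<inter> Pg e"
      by simp_all
    show "card (Pg b) > 0" using m(1) by (rule gt[OF finite_sets(3)])
    show "card (Ua b') > 0" using m(2) by (rule gt[OF finite_sets(8)])
    show "card (Ua b' \<inter> La e) > 0" using m(3) by (rule gt[OF finite_Int[OF disjI1[OF finite_sets(8)]]])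
    show "card (Pg b' \<inter> Pg e) > 0" using m(4) by (rule gt[OF finite_Int[OF disjI1[OF finite_sets(3)]]])
    show "card (Lg b' \<inter> Pg e) > 0" using m(5) by (rule gt[OF finite_Int[OF disjI1[OF finite_sets(4)]]])
  qed
  have sum_GG: "X + Z \<in> GG" if X: "X \<in> La b'" and Z: "Z \<in> Ua b'" for X Z
    by (rule GG_add[OF Pa_D(1)[OF La_Pa[OF X]] Pa_D(1)[OF Ua_Pa[OF Z]]])
  have sum_\<psi>: "(\<Sum>Z\<in>Ua b'. \<psi> w (X + Z)) = real (card (Ua b' \<inter> Pa (c w))) * h w X"
    if w: "w \<in> D" and X: "X \<in> La b'" for w X
  proof -
    have "(\<Sum>Z\<in>Ua b'. \<psi> w (X + Z)) =
        (\<Sum>Z\<in>Ua b'. if X + Z \<in> Pa (c w) then \<Phi> (Ad N (iv N w) (blk N (c w) (X + Z))) else 0)"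
      by (rule sum.cong[OF refl \<psi>_eq[OF w GG_mat[OF sum_GG[OF X]]]])
    also have "\<dots> = real (card (Ua b' \<inter> Ua (c w))) * (if X \<in> Pa (c w)
        then \<Sum>Z\<in>Ua b' \<inter> La (c w). \<Phi> (Ad N (iv N w) (blk N (c w) X + Z)) else 0)"
      by (rule sum_over_radical_two_gradings[OF b'(1) c[OF w] X])
    also have "\<dots> = real (card (Ua b' \<inter> Pa (c w))) * h w X"
      using pos(3)[of "c w"] by (simp add: card_Ua_cut[OF c[OF w]] h_def)
    finally show ?thesis .
  qed
  \<comment> \<open>Seen as an average of \<open>\<psi> w\<close> over \<open>X + Ua b'\<close>, the function \<open>h w\<close> inherits the invariance of \<open>\<psi> w\<close>.\<close>
  have h_Ad: "h w (Ad N x X) = h w X" if w: "w \<in> D" and x: "x \<in> Lg b' \<inter> Pg (c w)" and X: "X \<in> La b'" for w x X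
  proof -
    have xL: "x \<in> Lg b'" "x \<in> Pg b'" "blk N b' x = x" using x by (auto simp: Lg_def)
    have "real (card (Ua b' \<inter> Pa (c w))) * h w (Ad N x X) = (\<Sum>Z\<in>Ua b'. \<psi> w (Ad N x X + Z))"
      using sum_\<psi>[OF w Ad_La[OF b'(1) xL(1) X]] by simp
    also have "\<dots> = (\<Sum>Z\<in>Ua b'. \<psi> w (Ad N x (X + Z)))"
      using sum_over_radical_translate[OF b'(1) xL(2) X, of "\<psi> w"] xL(3) by simp
    also have "\<dots> = (\<Sum>Z\<in>Ua b'. \<psi> w (X + Z))"
    proof (rule sum.cong[OF refl])
      fix Z assume "Z \<in> Ua b'"
      with X have "X + Z \<in> GG" by (rule sum_GG)
      then show "\<psi> w (Ad N x (X + Z)) = \<psi> w (X + Z)" using x by (intro \<psi>_Ad[OF w]) simp_all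
    qed
    also have "\<dots> = real (card (Ua b' \<inter> Pa (c w))) * h w X" by (rule sum_\<psi>[OF w X])
    finally show ?thesis
      using pos(3)[of "c w"] card_radical_eq[OF b'(2), of "c w"] card_Ua_cut[OF c[OF w], of b']
        finite_sets(5)[of b'] card_gt_0_iff[of "Ug b' \<inter> Pg (c w)"]
        G_one by (auto simp: Ug_def Pg_def pat_one)
  qed
  have rhs: "(par_ind N (S w) (La b') (par_cut N (parab b') (parab b) w)
        \<circ> transport N (levi_alg (par_cut N (parab b') (parab b) w)) w
        \<circ> par_res (par_cut N (parab b) (parab b') (iv N w))) \<Phi> Y =
      (\<Sum>l\<in>Lg b'. h w (Ad N (iv N l) Y)) / real (card (Lg b' \<inter> Pg (c w)))"
    if w: "w \<in> D" and Y: "Y \<in> La b'" for w Y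
  proof -
    let ?Q = "par_cut N (parab b') (parab b) w" and ?Q' = "par_cut N (parab b) (parab b') (iv N w)"
    have Q: "?Q = \<lparr>levi = Lg b' \<inter> Lg (c w), rad = Lg b' \<inter> Ug (c w),
        levi_alg = La b' \<inter> La (c w), rad_alg = La b' \<inter> Ua (c w)\<rparr>"
      using par_cut_parab[OF p(1,2)[OF w], of b' b] pw[OF w] by (simp add: c_def)
    have "iv N (pmat N (p w) :: 'a mat) = pmat N (pinv (p w))" by (rule iv_pmat[OF p(1)[OF w]])
    then have ivw: "iv N w = pmat N (pinv (p w))" by (simp add: pw[OF w])
    have pp: "pinv (pinv (p w)) = p w" using p(1)[OF w] by (simp add: permutes_inv_inv)
    have Q': "levi_alg ?Q' = La b \<inter> La (b' \<circ> p w)" "rad_alg ?Q' = La b \<inter> Ua (b' \<circ> p w)"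
      using par_cut_parab[OF permutes_inv[OF p(1)[OF w]], of b b'] G_iv[OF DG(1)[OF w]]
      by (simp_all add: ivw pp)
    \<comment> \<open>\<open>w\<inverse>\<close> twists \<open>b'\<close> into \<open>b' \<circ> p w\<close>, and conjugating by \<open>w\<close> leads back to \<open>b'\<close>.\<close>
    have b'p: "b' \<circ> p w \<circ> pinv (p w) = b'"
      using permutes_inverses[OF p(1)[OF w]] by (simp add: fun_eq_iff)
    have untwisted: "X \<in> La b \<inter> La (b' \<circ> p w) \<longleftrightarrow> Ad N w X \<in> La b' \<inter> La (c w)"
       "X \<in> La b \<inter> Ua (b' \<circ> p w) \<longleftrightarrow> Ad N w X \<in> Ua b' \<inter> La (c w)" if "X \<in> carrier_mat N N" for X
      using Ad_twist_iff(5)[OF p(1,2)[OF w] that, of b] Ad_twist_iff(5)[OF p(1,2)[OF w] that, of "b' \<circ> p w"]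
        Ad_twist_iff(6)[OF p(1,2)[OF w] that, of "b' \<circ> p w"] pw[OF w]
      by (auto simp: c_def b'p)
    have wc: "w \<in> carrier (GL N)" using DG[OF w] by simp
    have bij: "bij_betw (Ad N w) (La b \<inter> Ua (b' \<circ> p w)) (Ua b' \<inter> La (c w))"
    proof (rule bij_betw_byWitness[where f' = "Ad N (iv N w)"])
      show "\<forall>X\<in>La b \<inter> Ua (b' \<circ> p w). Ad N (iv N w) (Ad N w X) = X"
        using wc mat_subsets(5)[of b] by auto
      show "\<forall>X\<in>Ua b' \<inter> La (c w). Ad N w (Ad N (iv N w) X) = X"
        using wc mat_subsets(6)[of b'] by auto
      show "Ad N w ` (La b \<inter> Ua (b' \<circ> p w)) \<subseteq> Ua b' \<inter> La (c w)"
        using untwisted(2) mat_subsets(5)[of b] by blast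
      show "Ad N (iv N w) ` (Ua b' \<inter> La (c w)) \<subseteq> La b \<inter> Ua (b' \<circ> p w)"
      proof (rule image_subsetI)
        fix X assume X: "X \<in> Ua b' \<inter> La (c w)"
        then have "X \<in> carrier_mat N N" using mat_subsets(6) by blast
        then show "Ad N (iv N w) X \<in> La b \<inter> Ua (b' \<circ> p w)"
          using untwisted(2)[of "Ad N (iv N w) X"] X wc by simp
      qed
    qed
    have Lsub: "subgroup (Lg b') (GL N)" "Lg b' \<subseteq> G" using Lg_subgroup Lg_Pg Pg_D(1) by blast+
    have grp: "par_group N ?Q = Lg b' \<inter> Pg (c w)"
      by (rule par_group_cut[OF c[OF w] Lsub blk_Lg_cut[OF c[OF w]]]) (simp_all add: Q)
    have La_GG: "La b' \<subseteq> GG" using La_Pa Pa_D(1) by blast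
    note alg = par_alg_cut[OF c[OF w] La_GG La_add La_diff, of ?Q]
    have palg: "par_alg ?Q = La b' \<inter> Pa (c w)"
      using blk_La_cut[OF c[OF w]] by (intro alg(1)) (simp_all add: Q)
    have proj: "levi_proj ?Q X = blk N (c w) X" if "X \<in> La b' \<inter> Pa (c w)" for X
      using blk_La_cut[OF c[OF w]] that by (intro alg(2)) (simp_all add: Q)
    have val: "transport N (levi_alg ?Q) w (par_res ?Q' \<Phi>) (blk N (c w) X) = h w X"
      if X: "X \<in> La b' \<inter> Pa (c w)" for X
    proof -
      let ?X = "blk N (c w) X"
      have m: "?X \<in> La b' \<inter> La (c w)"
        using X blk_La_cut[OF c[OF w], of X b'] blk_La[OF c[OF w], of X] by simp
      have m': "Ad N (iv N w) ?X \<in> La b \<inter> La (b' \<circ> p w)"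
        using untwisted(1)[of "Ad N (iv N w) ?X"] m wc by simp
      have "transport N (levi_alg ?Q) w (par_res ?Q' \<Phi>) ?X =
          (\<Sum>Z\<in>La b \<inter> Ua (b' \<circ> p w). \<Phi> (Ad N (iv N w) ?X + Z)) / real (card (La b \<inter> Ua (b' \<circ> p w)))"
        using m m' by (simp add: transport_def par_res_def Q Q')
      also have "(\<Sum>Z\<in>La b \<inter> Ua (b' \<circ> p w). \<Phi> (Ad N (iv N w) ?X + Z)) =
          (\<Sum>Z\<in>La b \<inter> Ua (b' \<circ> p w). \<Phi> (Ad N (iv N w) (?X + Ad N w Z)))"
      proof (rule sum.cong[OF refl])
        fix Z assume "Z \<in> La b \<inter> Ua (b' \<circ> p w)"
        then have "Z \<in> carrier_mat N N" using mat_subsets(5) by blast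
        then show "\<Phi> (Ad N (iv N w) ?X + Z) = \<Phi> (Ad N (iv N w) (?X + Ad N w Z))"
          using wc by (simp add: Ad_add)
      qed
      also have "\<dots> = (\<Sum>Z\<in>Ua b' \<inter> La (c w). \<Phi> (Ad N (iv N w) (?X + Z)))"
        by (rule sum.reindex_bij_betw[OF bij])
      finally show ?thesis using X unfolding bij_betw_same_card[OF bij] h_def by simp
    qed
    have "left_coset_reps N (S w) (Lg b') (Lg b' \<inter> Pg (c w))" using S[OF w] by (simp add: grp)
    then have Sw: "S w \<subseteq> Lg b'"
      "\<And>g. g \<in> Lg b' \<Longrightarrow> \<exists>!r. r \<in> S w \<and> g \<in> r <#\<^bsub>GL N\<^esub> (Lg b' \<inter> Pg (c w))"
      by (auto simp: left_coset_reps_def)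
    have "(par_ind N (S w) (La b') ?Q \<circ> transport N (levi_alg ?Q) w \<circ> par_res ?Q') \<Phi> Y =
        (\<Sum>g\<in>S w. h w (Ad N (iv N g) Y))"
    proof -
      have "(if Ad N (iv N g) Y \<in> par_alg ?Q
          then transport N (levi_alg ?Q) w (par_res ?Q' \<Phi>) (levi_proj ?Q (Ad N (iv N g) Y)) else 0)
          = h w (Ad N (iv N g) Y)" if "g \<in> S w" for g
      proof -
        have "Ad N (iv N g) Y \<in> La b'"
          using that Sw(1) Y subgroupD(1)[OF Lg_subgroup] by (intro Ad_La[OF b'(1)]) blast
        then show ?thesis
          using proj[of "Ad N (iv N g) Y"] val[of "Ad N (iv N g) Y"] by (auto simp: palg h_def)
      qed
      then show ?thesis using Y by (simp add: par_ind_def Let_def)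
    qed
    also have "real (card (Lg b' \<inter> Pg (c w))) * \<dots> = (\<Sum>l\<in>Lg b'. h w (Ad N (iv N l) Y))"
    proof (rule group.sum_over_left_coset_reps[OF group_GL _ Lg_subgroup _ finite_sets(4) Sw, symmetric])
      show "subgroup (Lg b' \<inter> Pg (c w)) (GL N)"
        using group.subgroups_Inter_pair[OF group_GL Lg_subgroup Pg_subgroup] .
      fix g x assume gx: "g \<in> Lg b'" "x \<in> Lg b' \<inter> Pg (c w)"
      have ix: "iv N x \<in> Lg b' \<inter> Pg (c w)"
        using gx(2) subgroupD(1)[OF Lg_subgroup] subgroupD(1)[OF Pg_subgroup] by blast
      have ig: "Ad N (iv N g) Y \<in> La b'"
        using gx(1) Y subgroupD(1)[OF Lg_subgroup] by (intro Ad_La[OF b'(1)]) blast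
      have "g \<in> carrier (GL N)" "x \<in> carrier (GL N)" "Y \<in> carrier_mat N N"
        using gx Y Lg_Pg Pg_D(3) mat_subsets(5) by blast+
      then have "Ad N (iv N (g * x)) Y = Ad N (iv N x) (Ad N (iv N g) Y)"
        by (simp add: iv_mult Ad_Ad)
      then show "h w (Ad N (iv N (g \<otimes>\<^bsub>GL N\<^esub> x)) Y) = h w (Ad N (iv N g) Y)"
        using h_Ad[OF w ix ig] by simp
    qed simp
    finally show ?thesis using pos(5)[of "c w"] by (simp add: field_simps)
  qed
  show ?thesis
  proof (rule ext)
    fix Y
    show "(par_res (parab b') \<circ> par_ind N R GG (parab b)) \<Phi> Y =
      (\<lambda>X\<in>La b'. \<Sum>w\<in>D.
       (par_ind N (S w) (La b') (par_cut N (parab b') (parab b) w)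
        \<circ> transport N (levi_alg (par_cut N (parab b') (parab b) w)) w
        \<circ> par_res (par_cut N (parab b) (parab b') (iv N w))) \<Phi> X) Y"
    proof (cases "Y \<in> La b'")
      case False
      then show ?thesis by (simp add: par_res_def parab_def)
    next
      case Y: True
      \<comment> \<open>The left-hand side at \<open>Y\<close> is the sum of \<open>F\<close> over representatives, divided by \<open>|Ua b'|\<close>.\<close>
      define F where "F g = (\<Sum>Z\<in>Ua b'. infl (Ad N (iv N g) (Y + Z)))" for g
      note YZ = sum_GG[OF Y]
      have F_right: "F (g * x) = F g" if g: "g \<in> G" and x: "x \<in> Pg b" for g x
        unfolding F_def
      proof (rule sum.cong[OF refl])
        fix Z assume "Z \<in> Ua b'"
        then have 1: "Y + Z \<in> GG" by (rule YZ)
        have ix: "iv N x \<in> Pg b" using x subgroupD(1)[OF Pg_subgroup] by blast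
        have "Ad N (iv N (g * x)) (Y + Z) = Ad N (iv N x) (Ad N (iv N g) (Y + Z))"
          using G_GL[OF g] Pg_D(3)[OF x] GG_mat[OF 1] by (simp add: iv_mult Ad_Ad)
        then show "infl (Ad N (iv N (g * x)) (Y + Z)) = infl (Ad N (iv N g) (Y + Z))"
          using infl_Ad[OF ix GG_Ad[OF G_iv[OF g] 1]] by simp
      qed
      have par_ind_eq: "par_ind N R GG (parab b) \<Phi> X = (\<Sum>g\<in>R. infl (Ad N (iv N g) X))" if "X \<in> GG" for X
        using that par_alg_parab(2)[OF b(1)]
        by (simp add: par_ind_def Let_def par_alg_parab(1)[OF b(1)] infl_def cong: if_cong)
      have "(par_res (parab b') \<circ> par_ind N R GG (parab b)) \<Phi> Y =
          (\<Sum>Z\<in>Ua b'. \<Sum>g\<in>R. infl (Ad N (iv N g) (Y + Z))) / real (card (Ua b'))"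
        using Y YZ par_ind_eq by (simp add: par_res_def parab_def cong: sum.cong)
      also have "(\<Sum>Z\<in>Ua b'. \<Sum>g\<in>R. infl (Ad N (iv N g) (Y + Z))) = (\<Sum>g\<in>R. F g)"
        unfolding F_def by (rule sum.swap)
      also have "(\<Sum>g\<in>R. F g) = (\<Sum>g\<in>G. F g) / real (card (Pg b))"
      proof -
        have Rr: "R \<subseteq> G" "\<And>g. g \<in> G \<Longrightarrow> \<exists>!r. r \<in> R \<and> g \<in> r <#\<^bsub>GL N\<^esub> Pg b"
          using R by (auto simp: left_coset_reps_def par_group_parab[OF b(1)])
        have "(\<Sum>g\<in>G. F g) = real (card (Pg b)) * (\<Sum>g\<in>R. F g)"
        proof (rule group.sum_over_left_coset_reps[OF group_GL Pg_subgroup G_subgroup _ finite_sets(1) Rr])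
          show "Pg b \<subseteq> G" using Pg_D(1) by blast
        qed (use F_right in simp_all)
        then show ?thesis using pos(1) by simp
      qed
      also have "(\<Sum>g\<in>G. F g) =
          (\<Sum>w\<in>D. real (card (Pg b)) * real (card (Ua b')) *
            ((\<Sum>l\<in>Lg b'. h w (Ad N (iv N l) Y)) / real (card (Lg b' \<inter> Pg (c w)))))"
      proof -
        let ?C = "\<lambda>w. (\<lambda>(x, y). x * w * y) ` (Pg b' \<times> Pg b)"
        note part = double_cosets_partition[OF b(2) b'(2) W D]
        have "(\<Sum>g\<in>G. F g) = (\<Sum>g\<in>(\<Union>w\<in>D. ?C w). F g)"
          by (rule arg_cong[OF part(1), of "sum F"])
        also have "\<dots> = (\<Sum>w\<in>D. \<Sum>g\<in>?C w. F g)"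
        proof (rule sum.UNION_disjoint[OF finD])
          show "\<forall>w\<in>D. finite (?C w)" using finite_sets(3) by blast
          show "\<forall>v\<in>D. \<forall>w\<in>D. v \<noteq> w \<longrightarrow> ?C v \<inter> ?C w = {}" using part(2) by blast
        qed
        also have "\<dots> = (\<Sum>w\<in>D. real (card (Pg b)) * real (card (Ua b')) *
            ((\<Sum>l\<in>Lg b'. h w (Ad N (iv N l) Y)) / real (card (Lg b' \<inter> Pg (c w)))))"
        proof (rule sum.cong[OF refl])
          fix w assume w: "w \<in> D"
          have conj: "(\<lambda>y. w * y * iv N w) ` Pg b = Pg (c w)"
            using Ad_twist_image(1)[OF p(1,2)[OF w], of b] pw[OF w] by (simp add: Ad_def c_def)
          have xw: "x * w \<in> G" if "x \<in> Pg b'" for x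
            using that Pg_D(1) DG(1)[OF w] G_mult by blast
          have 1: "real (card (Pg b' \<inter> Pg (c w))) * (\<Sum>g\<in>?C w. F g) =
              real (card (Pg b)) * (\<Sum>x\<in>Pg b'. F (x * w))"
            using group.sum_over_double_coset[OF group_GL Pg_subgroup finite_sets(3) Pg_subgroup finite_sets(3)
                DG(2)[OF w], of b' b F] F_right[OF xw]
            by (simp add: conj)
          have Fxw: "F (x * w) = (\<Sum>Z\<in>Ua b'. \<psi> w (Ad N (iv N (blk N b' x)) Y + Z))"
            if x: "x \<in> Pg b'" for x
          proof -
            have ix: "iv N x \<in> Pg b'" using x subgroupD(1)[OF Pg_subgroup] by blast
            have "F (x * w) = (\<Sum>Z\<in>Ua b'. \<psi> w (Ad N (iv N x) (Y + Z)))"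
              unfolding F_def \<psi>_def
              using Pg_D(3)[OF x] DG(2)[OF w] GG_mat[OF YZ]
              by (intro sum.cong refl) (simp add: iv_mult Ad_Ad)
            also have "\<dots> = (\<Sum>Z\<in>Ua b'. \<psi> w (Ad N (blk N b' (iv N x)) Y + Z))"
              by (rule sum_over_radical_translate[OF b'(1) ix Y])
            finally show ?thesis by (simp add: blk_iv[OF b'(1) x])
          qed
          have "(\<Sum>x\<in>Pg b'. F (x * w)) = (\<Sum>(l, u)\<in>Lg b' \<times> Ug b'. F (l * u * w))"
          proof -
            have "bij_betw (\<lambda>(l, u). l * u) (Lg b' \<times> Ug b') (Pg b')"
              using Levi_decomposition(1)[OF b'(1) G_subgroup subset_refl] blk_G[OF b'(1)]
              by (simp add: Pg_def Lg_def Ug_def Int_absorb1 Collect_conj_eq Int_assoc[symmetric])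
            from sum.reindex_bij_betw[OF this, of "\<lambda>x. F (x * w)"] show ?thesis
              by (simp add: case_prod_beta)
          qed
          also have "\<dots> = (\<Sum>(l, u)\<in>Lg b' \<times> Ug b'. \<Sum>Z\<in>Ua b'. \<psi> w (Ad N (iv N l) Y + Z))"
          proof (intro sum.cong refl, clarify)
            fix l u assume lu: "l \<in> Lg b'" "u \<in> Ug b'"
            have "l * u \<in> Pg b'" using lu Lg_Pg Ug_Pg subgroupD(2)[OF Pg_subgroup] by blast
            moreover have "blk N b' (l * u) = l"
              using Levi_decomposition(2)[OF b'(1) G_subgroup subset_refl _ lu] blk_G[OF b'(1)]
              by (simp add: Pg_def)
            ultimately show "F (l * u * w) = (\<Sum>Z\<in>Ua b'. \<psi> w (Ad N (iv N l) Y + Z))"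
              using Fxw[of "l * u"] by simp
          qed
          also have "\<dots> = real (card (Ug b')) * (\<Sum>l\<in>Lg b'. \<Sum>Z\<in>Ua b'. \<psi> w (Ad N (iv N l) Y + Z))"
            by (simp add: sum.cartesian_product[symmetric] sum_distrib_left)
          also have "(\<Sum>l\<in>Lg b'. \<Sum>Z\<in>Ua b'. \<psi> w (Ad N (iv N l) Y + Z)) =
              (\<Sum>l\<in>Lg b'. real (card (Ua b' \<inter> Pa (c w))) * h w (Ad N (iv N l) Y))"
          proof (rule sum.cong[OF refl])
            fix l assume "l \<in> Lg b'"
            then have "Ad N (iv N l) Y \<in> La b'"
              using Y subgroupD(1)[OF Lg_subgroup] by (intro Ad_La[OF b'(1)]) blast
            then show "(\<Sum>Z\<in>Ua b'. \<psi> w (Ad N (iv N l) Y + Z)) =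
                real (card (Ua b' \<inter> Pa (c w))) * h w (Ad N (iv N l) Y)"
              by (rule sum_\<psi>[OF w])
          qed
          finally have 2: "(\<Sum>x\<in>Pg b'. F (x * w)) = real (card (Ug b')) *
              (real (card (Ua b' \<inter> Pa (c w))) * (\<Sum>l\<in>Lg b'. h w (Ad N (iv N l) Y)))"
            by (simp add: sum_distrib_left)
          \<comment> \<open>The constant grading imposes no condition.\<close>
          have 3: "card (Ug b') = card (Ua b')"
            using card_radical_eq[OF b'(2), of "\<lambda>_. 0"]
            by (simp add: Ug_def Ua_def Pg_def Pa_def pat_def conj_ac Int_def cong: conj_cong)
          have 4: "card (Pg b' \<inter> Pg (c w)) = card (Lg b' \<inter> Pg (c w)) * card (Ua b' \<inter> Pa (c w))"
          proof -
            have "bij_betw (\<lambda>(l, u). l * u) ((Pg (c w) \<inter> Lg b') \<times> (Pg (c w) \<inter> Ug b')) (Pg (c w) \<inter> Pg b')"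
            proof (rule Levi_decomposition(1)[OF b'(1) Pg_subgroup])
              show "Pg (c w) \<subseteq> G" using Pg_D(1) by blast
              show "blk N b' x \<in> Pg (c w)" if "x \<in> Pg (c w) \<inter> Pg b'" for x
                using that blk_G[OF b'(1), of x] blk_pat[of x N "upper (c w)" b'] by (simp add: Pg_def)
            qed
            from bij_betw_same_card[OF this] show ?thesis
              using card_radical_eq[OF b'(2), of "c w"] by (simp add: card_cartesian_product Int_commute)
          qed
          have ne: "real (card (Lg b' \<inter> Pg (c w))) \<noteq> 0" "real (card (Ua b' \<inter> Pa (c w))) \<noteq> 0"
            using pos(4)[of "c w"] unfolding 4 by auto
          have "(real (card (Lg b' \<inter> Pg (c w))) * (\<Sum>g\<in>?C w. F g)) * real (card (Ua b' \<inter> Pa (c w))) =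
              (real (card (Pg b)) * real (card (Ua b')) * (\<Sum>l\<in>Lg b'. h w (Ad N (iv N l) Y)))
                * real (card (Ua b' \<inter> Pa (c w)))"
            using 1 unfolding 2 3 4 by (simp add: mult_ac)
          then have "real (card (Lg b' \<inter> Pg (c w))) * (\<Sum>g\<in>?C w. F g) =
              real (card (Pg b)) * real (card (Ua b')) * (\<Sum>l\<in>Lg b'. h w (Ad N (iv N l) Y))"
            using ne(2) by simp
          then show "(\<Sum>g\<in>?C w. F g) = real (card (Pg b)) * real (card (Ua b')) *
            ((\<Sum>l\<in>Lg b'. h w (Ad N (iv N l) Y)) / real (card (Lg b' \<inter> Pg (c w))))"
            using ne(1) by (simp add: field_simps)
        qed
        finally show ?thesis .
      qed
      also have "\<dots> / real (card (Pg b)) / real (card (Ua b')) =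
          (\<Sum>w\<in>D. (\<Sum>l\<in>Lg b'. h w (Ad N (iv N l) Y)) / real (card (Lg b' \<inter> Pg (c w))))"
        using pos(1,2) by (simp add: sum_divide_distrib)
      finally show ?thesis
        using Y rhs by (simp cong: sum.cong)
    qed
  qed
qed

end

section \<open>The Bruhat normal form of an invertible matrix\<close>

text \<open>Such a matrix is triangular with diagonal \<open>1\<close>, so its determinant is \<open>1\<close>.\<close>

lemma unipotent_GL:
  fixes g :: "'a::field mat"
  assumes g: "g \<in> carrier_mat n n" "g - 1\<^sub>m n \<in> pat n \<rho>"
    and \<rho>: "\<And>r s. r < n \<Longrightarrow> s < n \<Longrightarrow> \<rho> r s \<Longrightarrow> r < s"
  shows "g \<in> carrier (GL n)"
proof -
  have e: "g $$ (r, s) = (if r = s then 1 else 0)" if "r < n" "s < n" "\<not> r < s" for r s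
  proof -
    have "(g - 1\<^sub>m n) $$ (r, s) = 0" using pat_zero[OF g(2) that(1,2)] \<rho>[OF that(1,2)] that(3) by blast
    then show ?thesis using that(1,2) g(1) by simp
  qed
  have "upper_triangular g" using e g(1) by auto
  then have "det g = prod_list (diag_mat g)" using g(1) by (rule det_upper_triangular)
  also have "diag_mat g = map (\<lambda>_. 1) [0..<n]"
    using e g(1) by (auto simp: diag_mat_def)
  also have "prod_list \<dots> = 1" by (induction n) auto
  finally show ?thesis using g(1) by (simp add: GL_iff_det)
qed

lemma unipotent_subgroup:
  assumes \<rho>: "\<And>r s. r < n \<Longrightarrow> s < n \<Longrightarrow> \<rho> r s \<Longrightarrow> r < s" "\<And>r s t. \<rho> r s \<Longrightarrow> \<rho> s t \<Longrightarrow> \<rho> r t"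
  shows "subgroup {g \<in> carrier_mat n n. (g :: 'a::{field,finite} mat) - 1\<^sub>m n \<in> pat n \<rho>} (GL n)"
proof (rule subgroup_GL_if_closed)
  show "{g \<in> carrier_mat n n. (g :: 'a mat) - 1\<^sub>m n \<in> pat n \<rho>} \<subseteq> carrier (GL n)"
    using unipotent_GL[OF _ _ \<rho>(1)] by blast
  show "1\<^sub>m n \<in> {g \<in> carrier_mat n n. (g :: 'a mat) - 1\<^sub>m n \<in> pat n \<rho>}"
    by (simp add: pat_def minus_carrier_mat)
  fix g h :: "'a mat"
  assume "g \<in> {g \<in> carrier_mat n n. g - 1\<^sub>m n \<in> pat n \<rho>}" "h \<in> {g \<in> carrier_mat n n. g - 1\<^sub>m n \<in> pat n \<rho>}"
  then have g: "g \<in> carrier_mat n n" "g - 1\<^sub>m n \<in> pat n \<rho>" and h: "h \<in> carrier_mat n n" "h - 1\<^sub>m n \<in> pat n \<rho>"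
    by auto
  have e1: "(g - 1\<^sub>m n) * h = g * h - h"
    using minus_mult_distrib_mat[OF g(1) one_carrier_mat h(1)] h(1) by simp
  have e2: "(g - 1\<^sub>m n) * (h - 1\<^sub>m n) = (g - 1\<^sub>m n) * h - (g - 1\<^sub>m n)"
    using mult_minus_distrib_mat[of "g - 1\<^sub>m n" n n h n "1\<^sub>m n"] pat_carrier[OF g(2)] h(1) by simp
  have e3: "A - 1\<^sub>m n = ((A - h) - B + B) + (h - 1\<^sub>m n)"
    if "A \<in> carrier_mat n n" "B \<in> carrier_mat n n" for A B :: "'a mat"
    using carrier_matD[OF that(1)] carrier_matD[OF that(2)] carrier_matD[OF h(1)]
    by (intro eq_matI) simp_all
  have "g * h - 1\<^sub>m n = ((g - 1\<^sub>m n) * (h - 1\<^sub>m n) + (g - 1\<^sub>m n)) + (h - 1\<^sub>m n)"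
    unfolding e2 e1 by (rule e3[OF mat_mult_closed[OF g(1) h(1)] pat_carrier[OF g(2)]])
  also have "\<dots> \<in> pat n \<rho>"
    by (rule pat_add[OF pat_add[OF pat_mult[OF g(2) h(2) \<rho>(2)] g(2)] h(2)])
  finally show "g * h \<in> {g \<in> carrier_mat n n. g - 1\<^sub>m n \<in> pat n \<rho>}"
    using g(1) h(1) by simp
qed

text \<open>The positions in which the unipotent factor of the normal form for \<open>w\<close> may be nonzero off
  the diagonal.\<close>

definition inversion :: "(nat \<Rightarrow> nat) \<Rightarrow> nat \<Rightarrow> nat \<Rightarrow> bool" where
  "inversion w r s \<longleftrightarrow> r < s \<and> pinv w s < pinv w r"

lemma sum_powers_less:
  assumes "finite S" "\<And>r. r \<in> S \<Longrightarrow> r < (m::nat)"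
  shows "(\<Sum>r\<in>S. (2::nat) ^ r) < 2 ^ m"
proof -
  have "(\<Sum>r\<in>S. (2::nat) ^ r) \<le> (\<Sum>r<m. 2 ^ r)"
    using assms by (intro sum_mono2) auto
  also have "\<dots> < 2 ^ m" by (induction m) auto
  finally show ?thesis .
qed

text \<open>Among the matrices \<open>g * b\<close> take one for which the sum of \<open>2 ^ r\<close> over the positions \<open>(r, s)\<close> of its
nonzero entries is minimal, and let \<open>w s\<close> be the lowest row that is nonzero in column \<open>s\<close>. If the entry at
\<open>(w s, t)\<close> were nonzero for some \<open>t > s\<close>, a multiple of column \<open>s\<close> could be added to column \<open>t\<close> to
clear it. This affects only rows above \<open>w s\<close> otherwise, so it makes the sum smaller.\<close>

lemma column_echelon_form:
  fixes g :: "'a::{field,finite} mat"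
  assumes g: "g \<in> carrier (GL n)"
  obtains b w where "b \<in> carrier (GL n)" "b \<in> pat n (\<le>)" "w permutes {..<n}"
    "\<And>s. s < n \<Longrightarrow> (g * b) $$ (w s, s) \<noteq> 0"
    "\<And>r s. r < n \<Longrightarrow> s < n \<Longrightarrow> w s < r \<Longrightarrow> (g * b) $$ (r, s) = 0"
    "\<And>s t. t < n \<Longrightarrow> s < t \<Longrightarrow> (g * b) $$ (w s, t) = 0"
proof -
  define supp where "supp h s = {r. r < n \<and> h $$ (r, s) \<noteq> 0}" for h :: "'a mat" and s
  define m where "m h = (\<Sum>s<n. \<Sum>r\<in>supp h s. (2::nat) ^ r)" for h
  have fin: "finite (supp h s)" for h s by (simp add: supp_def)
  obtain b where b: "b \<in> carrier (GL n)" "b \<in> pat n (\<le>)"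
    and min: "\<And>b'. b' \<in> carrier (GL n) \<Longrightarrow> b' \<in> pat n (\<le>) \<Longrightarrow> m (g * b) \<le> m (g * b')"
    using ex_has_least_nat[of "\<lambda>b. b \<in> carrier (GL n) \<and> b \<in> pat n (\<le>)" "1\<^sub>m n" "\<lambda>b. m (g * b)"]
      pat_one[of "(\<le>)" n] by auto
  define h where "h = g * b"
  have h: "h \<in> carrier (GL n)" using g b by (simp add: h_def)
  have hc: "h \<in> carrier_mat n n" using h by (rule GL_carrier)
  define piv where "piv s = Max (supp h s)" for s
  have ne: "supp h s \<noteq> {}" if s: "s < n" for s
  proof
    assume "supp h s = {}"
    then have z: "h $$ (r, s) = 0" if "r < n" for r using that by (auto simp: supp_def)
    have "(iv n h * h) $$ (s, s) = (\<Sum>t<n. iv n h $$ (s, t) * h $$ (t, s))"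
      using s hc GL_carrier[OF GL_iv[OF h]] by (intro mat_entry_mult)
    then show False using s z h by simp
  qed
  have piv: "piv s < n" "h $$ (piv s, s) \<noteq> 0" if "s < n" for s
    using Max_in[OF fin ne[OF that]] by (simp_all add: piv_def supp_def)
  have below: "h $$ (r, s) = 0" if "r < n" "s < n" "piv s < r" for r s
  proof (rule ccontr)
    assume "h $$ (r, s) \<noteq> 0"
    then have "r \<in> supp h s" using that(1) by (simp add: supp_def)
    then have "r \<le> piv s" unfolding piv_def by (rule Max_ge[OF fin])
    then show False using that(3) by simp
  qed
  have right: "h $$ (piv s, t) = 0" if t: "t < n" and st: "s < t" for s t
  proof (rule ccontr)
    assume nz: "h $$ (piv s, t) \<noteq> 0"
    have s: "s < n" using st t by simp
    define a where "a = - h $$ (piv s, t) / h $$ (piv s, s)"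
    define E where "E = addrow_mat n a s t"
    have Ec: "E \<in> carrier_mat n n" by (simp add: E_def)
    have EGL: "E \<in> carrier (GL n)" using st by (simp add: GL_iff_det[OF Ec]) (simp add: E_def det_addrow_mat)
    have Epat: "E \<in> pat n (\<le>)" using st by (auto simp: pat_def E_def addrow_mat_def)
    have bE: "b * E \<in> carrier (GL n)" "b * E \<in> pat n (\<le>)"
      using b EGL Epat pat_upper_mult[of b n id E] by simp_all
    have "g * (b * E) = h * E" using g b Ec by (simp add: h_def mat_assoc[of _ n])
    also have "\<dots> = addcol a t s h"
      unfolding E_def by (rule addcol_mat[OF hc s, symmetric])
    finally have gbE: "g * (b * E) = addcol a t s h" .
    have ent: "addcol a t s h $$ (r, j) = (if j = t then a * h $$ (r, s) + h $$ (r, j) else h $$ (r, j))"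
      if "r < n" "j < n" for r j
      using that hc by (simp add: mat_addcol_def)
    have same: "supp (addcol a t s h) j = supp h j" if "j < n" "j \<noteq> t" for j
      using ent that by (auto simp: supp_def)
    let ?S = "supp h t" and ?S' = "supp (addcol a t s h) t"
    have r0: "piv s \<in> ?S" using nz piv(1)[OF s] by (simp add: supp_def)
    have r0': "piv s \<notin> ?S'"
      using ent[OF piv(1)[OF s] t] piv(2)[OF s] by (simp add: supp_def a_def)
    have above: "r \<in> ?S' \<longleftrightarrow> r \<in> ?S" if "piv s < r" for r
      using ent[of r t] below[of r s] that t s by (auto simp: supp_def)
    have "(\<Sum>r\<in>?S'. (2::nat) ^ r) = (\<Sum>r\<in>{r\<in>?S'. piv s < r}. 2 ^ r) + (\<Sum>r\<in>{r\<in>?S'. \<not> piv s < r}. 2 ^ r)"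
      using fin by (subst sum.union_disjoint[symmetric]) (auto intro!: sum.cong)
    also have "(\<Sum>r\<in>{r\<in>?S'. \<not> piv s < r}. (2::nat) ^ r) < 2 ^ piv s"
      using fin r0' by (intro sum_powers_less) (auto simp: not_less le_less)
    also have "{r\<in>?S'. piv s < r} = {r\<in>?S. piv s < r}" using above by auto
    also have "(\<Sum>r\<in>{r\<in>?S. piv s < r}. (2::nat) ^ r) + 2 ^ piv s = (\<Sum>r\<in>insert (piv s) {r\<in>?S. piv s < r}. 2 ^ r)"
      using fin by (subst sum.insert) auto
    also have "\<dots> \<le> (\<Sum>r\<in>?S. 2 ^ r)"
      using fin r0 by (intro sum_mono2) auto
    finally have less: "(\<Sum>r\<in>?S'. (2::nat) ^ r) < (\<Sum>r\<in>?S. 2 ^ r)" by simp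
    have "m (addcol a t s h) < m h"
      unfolding m_def
    proof (rule sum_strict_mono_ex1)
      show "\<forall>j\<in>{..<n}. (\<Sum>r\<in>supp (addcol a t s h) j. (2::nat) ^ r) \<le> (\<Sum>r\<in>supp h j. 2 ^ r)"
        using same less by (metis less_imp_le order_refl lessThan_iff)
      show "\<exists>j\<in>{..<n}. (\<Sum>r\<in>supp (addcol a t s h) j. (2::nat) ^ r) < (\<Sum>r\<in>supp h j. 2 ^ r)"
        using less t by blast
    qed simp
    then show False using min[OF bE] by (simp add: gbE h_def)
  qed
  have inj: "inj_on piv {..<n}"
  proof (rule linorder_inj_onI)
    fix s t :: nat assume "s < t" "s \<in> {..<n}" "t \<in> {..<n}"
    then show "piv s \<noteq> piv t" using right[of t s] piv(2)[of t] by auto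
  qed auto
  define w where "w s = (if s < n then piv s else s)" for s
  have "w permutes {..<n}"
  proof (rule bij_imp_permutes)
    have "inj_on w {..<n}" using inj by (rule inj_on_cong[THEN iffD1, rotated]) (simp add: w_def)
    moreover have "w ` {..<n} \<subseteq> {..<n}" using piv(1) by (auto simp: w_def)
    ultimately show "bij_betw w {..<n} {..<n}" by (simp add: bij_betw_def endo_inj_surj)
  qed (simp add: w_def)
  then show thesis
    using that[OF b, of w] piv(2) below right by (simp add: w_def h_def)
qed

text \<open>The echelon form with its pivots scaled to \<open>1\<close> and its columns sorted by their pivots is the
unipotent factor.\<close>

theorem bruhat_normal_form:
  fixes g :: "'a::{field,finite} mat"
  assumes g: "g \<in> carrier (GL n)"
  obtains u w b where "u \<in> carrier_mat n n" "u - 1\<^sub>m n \<in> pat n (inversion w)" "w permutes {..<n}"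
    "b \<in> carrier (GL n)" "b \<in> pat n (\<le>)" "g = u * pmat n w * b"
proof -
  obtain b w where b: "b \<in> carrier (GL n)" "b \<in> pat n (\<le>)" and w: "w permutes {..<n}"
    and p: "\<And>s. s < n \<Longrightarrow> (g * b) $$ (w s, s) \<noteq> 0"
    and below: "\<And>r s. r < n \<Longrightarrow> s < n \<Longrightarrow> w s < r \<Longrightarrow> (g * b) $$ (r, s) = 0"
    and right: "\<And>s t. t < n \<Longrightarrow> s < t \<Longrightarrow> (g * b) $$ (w s, t) = 0"
    using column_echelon_form[OF g] by blast
  define h where "h = g * b"
  have hc: "h \<in> carrier_mat n n" using g b by (simp add: h_def)
  define d where "d = mat n n (\<lambda>(r, s). if r = s then 1 / h $$ (w s, s) else 0)"
  have dc: "d \<in> carrier_mat n n" by (simp add: d_def)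
  have d_pat: "d \<in> pat n (\<le>)" by (auto simp: pat_def d_def)
  have d_GL: "d \<in> carrier (GL n)"
  proof (rule GL_I[OF dc])
    let ?e = "mat n n (\<lambda>(r, s). if r = s then h $$ (w s, s) else 0)"
    show "?e * d = 1\<^sub>m n"
    proof (rule eq_matI)
      fix r s assume "r < dim_row (1\<^sub>m n :: 'a mat)" "s < dim_col (1\<^sub>m n :: 'a mat)"
      then have rs: "r < n" "s < n" by simp_all
      have "(?e * d) $$ (r, s) = (\<Sum>t<n. ?e $$ (r, t) * d $$ (t, s))"
        using rs dc by (intro mat_entry_mult) simp_all
      also have "\<dots> = (\<Sum>t<n. if t = r then (if r = s then 1 else 0) else 0)"
        using rs p[of r] by (intro sum.cong) (auto simp: d_def h_def)
      finally show "(?e * d) $$ (r, s) = 1\<^sub>m n $$ (r, s)" using rs by simp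
    qed (simp_all add: d_def)
  qed simp
  have hd: "(h * d) $$ (r, s) = h $$ (r, s) / h $$ (w s, s)" if rs: "r < n" "s < n" for r s
  proof -
    have "(h * d) $$ (r, s) = (\<Sum>t<n. h $$ (r, t) * d $$ (t, s))"
      using rs hc dc by (intro mat_entry_mult)
    also have "\<dots> = (\<Sum>t<n. if t = s then h $$ (r, s) / h $$ (w s, s) else 0)"
      using rs by (intro sum.cong) (auto simp: d_def)
    finally show ?thesis using rs by simp
  qed
  define u where "u = h * d * pmat n (pinv w)"
  have wi: "pinv w permutes {..<n}" using w by (rule permutes_inv)
  have uc: "u \<in> carrier_mat n n" using hc dc by (simp add: u_def)
  have ue: "u $$ (r, s) = h $$ (r, pinv w s) / h $$ (s, pinv w s)" if rs: "r < n" "s < n" for r s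
  proof -
    have "u $$ (r, s) = (h * d) $$ (r, pinv w s)"
      unfolding u_def using rs hc dc wi by (intro pmat_mult_right) simp_all
    then show ?thesis
      using hd rs permutes_lt[OF wi] permutes_inverses[OF w] by simp
  qed
  have u_pat: "u - 1\<^sub>m n \<in> pat n (inversion w)"
  proof -
    have "(u - 1\<^sub>m n) $$ (r, s) = 0" if rs: "r < n" "s < n" "\<not> inversion w r s" for r s
    proof -
      have wlt: "pinv w s < n" "pinv w r < n" using rs permutes_lt[OF wi] by auto
      have ww: "w (pinv w s) = s" "w (pinv w r) = r" using permutes_inverses[OF w] by auto
      consider "r = s" | "s < r" | "r < s" "pinv w r < pinv w s"
        using rs(3) permutes_inj[OF wi] unfolding inversion_def
        by (metis inj_def linorder_neqE_nat)
      then show ?thesis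
      proof cases
        case 1
        then show ?thesis using ue[of r s] rs uc p[OF wlt(1)] ww by (simp add: h_def)
      next
        case 2
        then show ?thesis using ue[of r s] rs uc below[of r "pinv w s"] wlt ww by (simp add: h_def)
      next
        case 3
        then show ?thesis using ue[of r s] rs uc right[of "pinv w s" "pinv w r"] wlt ww by (simp add: h_def)
      qed
    qed
    moreover have "u - 1\<^sub>m n \<in> carrier_mat n n" by (rule minus_carrier_mat) simp
    ultimately show ?thesis unfolding pat_def by blast
  qed
  have bd: "b * d \<in> carrier (GL n)" "b * d \<in> pat n (\<le>)"
    using b d_GL d_pat pat_upper_mult[of b n id d] by simp_all
  have bd': "iv n (b * d) \<in> pat n (\<le>)"
    using upper_inverse[OF bd(1), of id] bd(2) by simp
  have "u * pmat n w = g * (b * d) * (pmat n (pinv w) * pmat n w)"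
    using g b(1) d_GL by (simp add: u_def h_def mat_assoc[of _ n])
  also have "\<dots> = g * (b * d)"
    using g b(1) d_GL by (simp add: pmat_mult[OF wi w] permutes_inv_o[OF w])
  finally have "u * pmat n w * iv n (b * d) = g * (b * d) * iv n (b * d)" by simp
  also have "\<dots> = g * ((b * d) * iv n (b * d))"
    using g bd(1) by (intro mat_assoc[of _ n]) simp_all
  also have "\<dots> = g" unfolding iv_right[OF bd(1)] using g by simp
  finally have "u * pmat n w * iv n (b * d) = g" .
  from that[OF uc u_pat w GL_iv[OF bd(1)] bd' this[symmetric]] show thesis .
qed

text \<open>The entries of both sides at \<open>(v s, s)\<close> show \<open>w\<inverse> (v s) \<le> s\<close> for all \<open>s\<close>, so \<open>w\<inverse> \<circ> v\<close> is the identity.\<close>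

lemma triangular_exchange:
  fixes x y :: "'a::{field,finite} mat"
  assumes x: "x \<in> carrier (GL n)" "x \<in> pat n (\<le>)" and y: "y \<in> carrier (GL n)" "y \<in> pat n (\<le>)"
    and v: "v permutes {..<n}" and w: "w permutes {..<n}"
    and eq: "x * pmat n v = pmat n w * y"
  shows "v = w"
proof -
  have wi: "pinv w permutes {..<n}" using w by (rule permutes_inv)
  have le: "pinv w (v s) \<le> s" if s: "s < n" for s
  proof -
    have lt: "v s < n" "pinv w (v s) < n" using s permutes_lt[OF v] permutes_lt[OF wi] by auto
    have "(x * pmat n v) $$ (v s, s) = x $$ (v s, v s)"
      using s lt v GL_carrier[OF x(1)] by (intro pmat_mult_right)
    moreover have "(pmat n w * y) $$ (v s, s) = y $$ (pinv w (v s), s)"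
      using s lt w GL_carrier[OF y(1)] by (intro pmat_mult_left)
    ultimately have "y $$ (pinv w (v s), s) \<noteq> 0"
      using eq triangular_diag_nonzero[OF x lt(1)] by metis
    then show ?thesis using pat_zero[OF y(2) lt(2) s] by blast
  qed
  have perm: "(pinv w \<circ> v) permutes {..<n}" using v wi by (rule permutes_compose)
  have "pinv w \<circ> v = id"
    by (rule permutes_natset_le[OF perm]) (use le in simp)
  then have "pinv w (v s) = s" for s by (simp add: fun_eq_iff)
  then show ?thesis
    using permutes_inverses(1)[OF w] by (metis ext)
qed

text \<open>Off the diagonal, \<open>v\<inverse> u\<close> is supported on the inversions of \<open>w\<close>. By the assumed equation, it is also
the conjugate by \<open>w\<close> of a triangular matrix, which vanishes there.\<close>

lemma bruhat_normal_form_unique: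
  fixes u v b d :: "'a::{field,finite} mat"
  assumes u: "u \<in> carrier_mat n n" "u - 1\<^sub>m n \<in> pat n (inversion w)"
    and v: "v \<in> carrier_mat n n" "v - 1\<^sub>m n \<in> pat n (inversion w)"
    and w: "w permutes {..<n}"
    and b: "b \<in> carrier (GL n)" "b \<in> pat n (\<le>)" and d: "d \<in> carrier (GL n)" "d \<in> pat n (\<le>)"
    and eq: "u * pmat n w * b = v * pmat n w * d"
  shows "u = v"
proof -
  let ?K = "{g \<in> carrier_mat n n. (g :: 'a mat) - 1\<^sub>m n \<in> pat n (inversion w)}"
  have wi: "pinv w permutes {..<n}" using w by (rule permutes_inv)
  have K: "subgroup ?K (GL n)"
    by (rule unipotent_subgroup) (auto simp: inversion_def)
  have uv: "u \<in> carrier (GL n)" "v \<in> carrier (GL n)"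
    using subgroup.mem_carrier[OF K] u v by auto
  define x where "x = iv n v * u"
  have x: "x \<in> carrier_mat n n" "x - 1\<^sub>m n \<in> pat n (inversion w)"
    using subgroup.m_closed[OF K subgroup.m_inv_closed[OF K, of v], of u] u v by (simp_all add: x_def)
  define y where "y = d * iv n b"
  have y: "y \<in> pat n (\<le>)"
    using pat_upper_mult[of d n id "iv n b"] upper_inverse[OF b(1), of id] b d by (simp add: y_def)
  have yc: "y \<in> carrier_mat n n" using b d by (simp add: y_def)
  have "x * pmat n w = iv n v * (u * pmat n w * b) * iv n b"
    using uv b(1) by (simp add: x_def mat_assoc[of _ n])
  also have "\<dots> = pmat n w * y"
    unfolding eq using uv b(1) d(1) by (simp add: y_def mat_assoc[of _ n])
  finally have xy: "x * pmat n w = pmat n w * y" .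
  have "x = 1\<^sub>m n"
  proof (rule eq_matI)
    fix r s assume "r < dim_row (1\<^sub>m n :: 'a mat)" "s < dim_col (1\<^sub>m n :: 'a mat)"
    then have rs: "r < n" "s < n" by simp_all
    have lt: "pinv w s < n" "pinv w r < n" using rs permutes_lt[OF wi] by auto
    show "x $$ (r, s) = 1\<^sub>m n $$ (r, s)"
    proof (cases "inversion w r s")
      case False
      then show ?thesis using pat_zero[OF x(2) rs] rs x(1) by auto
    next
      case True
      have "x $$ (r, s) = (x * pmat n w) $$ (r, pinv w s)"
        using pmat_mult_right[OF w x(1) rs(1) lt(1)] permutes_inverses[OF w] by simp
      also have "\<dots> = y $$ (pinv w r, pinv w s)"
        unfolding xy by (rule pmat_mult_left[OF w yc rs(1) lt(1)])
      also have "\<dots> = 0" using True pat_zero[OF y lt(2,1)] by (simp add: inversion_def)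
      finally show ?thesis using True rs by (auto simp: inversion_def)
    qed
  qed (use x(1) in auto)
  then have "v * (iv n v * u) = v" using uv by (simp add: x_def)
  then show ?thesis using uv by simp
qed

section \<open>The general linear setting\<close>

lemma GL_graded:
  "graded_matrix_group n (carrier (GL n)) (carrier_mat n n :: 'a::{field,finite} mat set) (\<lambda>_. True)"
proof (rule graded_matrix_group.intro, goal_cases)
  case 1
  show ?case using group.subgroup_self[OF group_GL] .
next
  case (7 b g)
  have "iv n g \<in> pat n (upper b)" using upper_inverse 7 by blast
  then have "blk n b (iv n g) * blk n b g = 1\<^sub>m n"
    using blk_mult[of "iv n g" n b g] 7 by simp
  then show ?case by (intro GL_I[of _ n "blk n b (iv n g)"]) simp_all
next
  case (10 \<rho>)
  have "bij_betw (\<lambda>X. X + 1\<^sub>m n) (carrier_mat n n \<inter> pat n \<rho>)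
      {g \<in> carrier (GL n). (g :: 'a mat) - 1\<^sub>m n \<in> pat n \<rho>}"
  proof (rule bij_betw_byWitness[where f' = "\<lambda>g. g - 1\<^sub>m n"])
    have c: "X + 1\<^sub>m n - 1\<^sub>m n = X" "X - 1\<^sub>m n + 1\<^sub>m n = X" if "X \<in> carrier_mat n n" for X :: "'a mat"
      using that by (auto intro!: eq_matI)
    show "\<forall>X\<in>carrier_mat n n \<inter> pat n \<rho>. X + 1\<^sub>m n - 1\<^sub>m n = (X :: 'a mat)" using c by blast
    show "\<forall>g\<in>{g \<in> carrier (GL n). (g :: 'a mat) - 1\<^sub>m n \<in> pat n \<rho>}. g - 1\<^sub>m n + 1\<^sub>m n = g"
      using c GL_carrier by blast
    show "(\<lambda>X. X + 1\<^sub>m n) ` (carrier_mat n n \<inter> pat n \<rho>) \<subseteq> {g \<in> carrier (GL n). (g :: 'a mat) - 1\<^sub>m n \<in> pat n \<rho>}"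
    proof (rule image_subsetI)
      fix X :: "'a mat" assume X: "X \<in> carrier_mat n n \<inter> pat n \<rho>"
      then have p: "X + 1\<^sub>m n - 1\<^sub>m n \<in> pat n \<rho>" using c(1)[of X] by simp
      have "X + 1\<^sub>m n \<in> carrier_mat n n" using X by simp
      then show "X + 1\<^sub>m n \<in> {g \<in> carrier (GL n). g - 1\<^sub>m n \<in> pat n \<rho>}"
        using unipotent_GL[OF _ p 10(1)] p by blast
    qed
    show "(\<lambda>g. g - 1\<^sub>m n) ` {g \<in> carrier (GL n). (g :: 'a mat) - 1\<^sub>m n \<in> pat n \<rho>} \<subseteq> carrier_mat n n \<inter> pat n \<rho>"
      using pat_carrier by blast
  qed
  then show ?case by (simp add: bij_betw_same_card)
next
  case (11 g)
  obtain u w b where n: "u \<in> carrier_mat n n" "u - 1\<^sub>m n \<in> pat n (inversion w)" "w permutes {..<n}"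
    "b \<in> carrier (GL n)" "b \<in> pat n (\<le>)" "g = u * pmat n w * b"
    using bruhat_normal_form[OF 11] by blast
  have "u \<in> carrier (GL n)" using n(1,2) by (rule unipotent_GL) (simp add: inversion_def)
  moreover have "u \<in> pat n (\<le>)"
  proof -
    have "u $$ (r, s) = 0" if "r < n" "s < n" "\<not> r \<le> s" for r s
      using pat_zero[OF n(2), of r s] that n(1) by (auto simp: inversion_def)
    then show ?thesis using n(1) by (simp add: pat_def)
  qed
  ultimately show ?case using n pmat_GL[OF n(3)] by blast
qed auto

text \<open>By determinants, a block-diagonal matrix is invertible exactly if both blocks are.\<close>

lemma GL_parabolic_eq:
  "(GL_parabolic i j :: 'a::{field,finite} parabolic) =
    graded_matrix_group.parab (i + j) (carrier (GL (i + j))) (carrier_mat (i + j) (i + j))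
      (\<lambda>r. if r < i then 0 else 1)"
proof -
  let ?n = "i + j"
  let ?b = "\<lambda>r. if r < i then 0 else 1 :: nat"
  interpret gm: graded_matrix_group ?n "carrier (GL ?n)" "carrier_mat ?n ?n :: 'a mat set" "\<lambda>_. True"
    by (rule GL_graded)
  have diag: "diag_block_mat [A, B] = four_block_mat A (0\<^sub>m i j) (0\<^sub>m j i) B"
    if "A \<in> carrier_mat i i" "B \<in> carrier_mat j j" for A B :: "'a mat"
    unfolding diag_block_mat.simps(2)[of A "[B]"] diag_block_mat_singleton Let_def using that by simp
  have La: "gm.La ?b = {diag_block_mat [A, B :: 'a mat] | A B. A \<in> carrier_mat i i \<and> B \<in> carrier_mat j j}"
  proof (intro equalityI subsetI)
    fix X assume "X \<in> gm.La ?b"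
    then have X: "X \<in> carrier_mat ?n ?n" "blk ?n ?b X = X" by (simp_all add: gm.La_def gm.Pa_def)
    have z: "X $$ (r, s) = 0" if "r < ?n" "s < ?n" "?b r \<noteq> ?b s" for r s
      using blk_index[OF that(1,2), of ?b X] X(2) that(3) by (simp split: if_splits)
    have "X = four_block_mat (mat i i (\<lambda>(r, s). X $$ (r, s))) (0\<^sub>m i j) (0\<^sub>m j i)
        (mat j j (\<lambda>(r, s). X $$ (i + r, i + s)))"
      using X(1) z by (intro eq_matI) auto
    then show "X \<in> {diag_block_mat [A, B :: 'a mat] | A B. A \<in> carrier_mat i i \<and> B \<in> carrier_mat j j}"
      using diag[of "mat i i (\<lambda>(r, s). X $$ (r, s))" "mat j j (\<lambda>(r, s). X $$ (i + r, i + s))"]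
      by (metis (mono_tags, lifting) mat_carrier mem_Collect_eq)
  next
    fix X assume "X \<in> {diag_block_mat [A, B :: 'a mat] | A B. A \<in> carrier_mat i i \<and> B \<in> carrier_mat j j}"
    then obtain A B where AB: "A \<in> carrier_mat i i" "B \<in> carrier_mat j j"
      and X: "X = four_block_mat A (0\<^sub>m i j) (0\<^sub>m j i) B" using diag by auto
    have Xc: "X \<in> carrier_mat ?n ?n" using AB by (simp add: X)
    have "X \<in> pat ?n (upper ?b)" using AB Xc by (auto simp: pat_def X)
    moreover have "blk ?n ?b X = X" using AB by (intro eq_matI) (auto simp: X)
    ultimately show "X \<in> gm.La ?b" using Xc by (simp add: gm.La_def gm.Pa_def)
  qed
  have Lg: "gm.Lg ?b = {diag_block_mat [A, B :: 'a mat] | A B. A \<in> carrier (GL i) \<and> B \<in> carrier (GL j)}"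
  proof -
    have "gm.Lg ?b = gm.La ?b \<inter> carrier (GL ?n)"
      using GL_carrier by (auto simp: gm.Lg_def gm.Pg_def gm.La_def gm.Pa_def)
    also have "\<dots> = {diag_block_mat [A, B :: 'a mat] | A B. A \<in> carrier (GL i) \<and> B \<in> carrier (GL j)}"
    proof -
      have "diag_block_mat [A, B] \<in> carrier (GL ?n) \<longleftrightarrow> A \<in> carrier (GL i) \<and> B \<in> carrier (GL j)"
        if AB: "A \<in> carrier_mat i i" "B \<in> carrier_mat j j" for A B :: "'a mat"
      proof -
        have d: "det (four_block_mat A (0\<^sub>m i j) (0\<^sub>m j i) B) = det A * det B"
          using AB by (intro det_four_block_mat_lower_left_zero) simp_all
        have c: "four_block_mat A (0\<^sub>m i j) (0\<^sub>m j i) B \<in> carrier_mat ?n ?n"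
          using AB by simp
        show ?thesis
          unfolding diag[OF AB] GL_iff_det[OF AB(1)] GL_iff_det[OF AB(2)] GL_iff_det[OF c] d by simp
      qed
      then show ?thesis unfolding La using GL_carrier by blast
    qed
    finally show ?thesis .
  qed
  have Ug: "gm.Ug ?b = {four_block_mat (1\<^sub>m i) C (0\<^sub>m j i) (1\<^sub>m j :: 'a mat) | C. C \<in> carrier_mat i j}"
  proof (intro equalityI subsetI)
    fix X assume "X \<in> gm.Ug ?b"
    then have X: "X \<in> carrier_mat ?n ?n" "X \<in> pat ?n (upper ?b)" "blk ?n ?b X = 1\<^sub>m ?n"
      using GL_carrier by (auto simp: gm.Ug_def gm.Pg_def)
    have z: "X $$ (r, s) = (if r = s then 1 else 0)" if "r < ?n" "s < ?n" "?b r = ?b s" for r s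
      using blk_index[OF that(1,2), of ?b X] X(3) that by simp
    have "X = four_block_mat (1\<^sub>m i) (mat i j (\<lambda>(r, s). X $$ (r, i + s))) (0\<^sub>m j i) (1\<^sub>m j)"
      using X(1) z pat_zero[OF X(2)] by (intro eq_matI) auto
    then show "X \<in> {four_block_mat (1\<^sub>m i) C (0\<^sub>m j i) (1\<^sub>m j :: 'a mat) | C. C \<in> carrier_mat i j}"
      by (metis (mono_tags, lifting) mat_carrier mem_Collect_eq)
  next
    fix X assume "X \<in> {four_block_mat (1\<^sub>m i) C (0\<^sub>m j i) (1\<^sub>m j :: 'a mat) | C. C \<in> carrier_mat i j}"
    then obtain C where C: "C \<in> carrier_mat i j" and X: "X = four_block_mat (1\<^sub>m i) C (0\<^sub>m j i) (1\<^sub>m j)" by blast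
    have Xc: "X \<in> carrier_mat ?n ?n" using C by (simp add: X)
    have "det X = det (1\<^sub>m i :: 'a mat) * det (1\<^sub>m j)"
      unfolding X by (rule det_four_block_mat_lower_left_zero[OF one_carrier_mat C refl one_carrier_mat])
    then have "X \<in> carrier (GL ?n)" by (simp add: GL_iff_det[OF Xc])
    moreover have "X \<in> pat ?n (upper ?b)" using C Xc by (auto simp: pat_def X)
    moreover have "blk ?n ?b X = 1\<^sub>m ?n" using C by (intro eq_matI) (auto simp: X)
    ultimately show "X \<in> gm.Ug ?b" by (simp add: gm.Ug_def gm.Pg_def)
  qed
  have Ua: "gm.Ua ?b = {four_block_mat (0\<^sub>m i i) C (0\<^sub>m j i) (0\<^sub>m j j :: 'a mat) | C. C \<in> carrier_mat i j}"
  proof (intro equalityI subsetI)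
    fix X assume "X \<in> gm.Ua ?b"
    then have X: "X \<in> carrier_mat ?n ?n" "X \<in> pat ?n (upper ?b)" "blk ?n ?b X = 0\<^sub>m ?n ?n"
      by (auto simp: gm.Ua_def gm.Pa_def)
    have z: "X $$ (r, s) = 0" if "r < ?n" "s < ?n" "?b r = ?b s" for r s
      using blk_index[OF that(1,2), of ?b X] X(3) that by simp
    have "X = four_block_mat (0\<^sub>m i i) (mat i j (\<lambda>(r, s). X $$ (r, i + s))) (0\<^sub>m j i) (0\<^sub>m j j)"
      using X(1) z pat_zero[OF X(2)] by (intro eq_matI) auto
    then show "X \<in> {four_block_mat (0\<^sub>m i i) C (0\<^sub>m j i) (0\<^sub>m j j :: 'a mat) | C. C \<in> carrier_mat i j}"
      by (metis (mono_tags, lifting) mat_carrier mem_Collect_eq)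
  next
    fix X assume "X \<in> {four_block_mat (0\<^sub>m i i) C (0\<^sub>m j i) (0\<^sub>m j j :: 'a mat) | C. C \<in> carrier_mat i j}"
    then obtain C where C: "C \<in> carrier_mat i j" and X: "X = four_block_mat (0\<^sub>m i i) C (0\<^sub>m j i) (0\<^sub>m j j)" by blast
    have Xc: "X \<in> carrier_mat ?n ?n" using C by (simp add: X)
    moreover have "X \<in> pat ?n (upper ?b)" using C Xc by (auto simp: pat_def X)
    moreover have "blk ?n ?b X = 0\<^sub>m ?n ?n" using C by (intro eq_matI) (auto simp: X)
    ultimately show "X \<in> gm.Ua ?b" by (simp add: gm.Ua_def gm.Pa_def)
  qed
  show ?thesis by (simp add: GL_parabolic_def gm.parab_def La Lg Ug Ua)
qed

section \<open>The adjoint with respect to the Hermitian form\<close>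

lemma finite_field_power_card:
  fixes x :: "'a::{field,finite}"
  shows "x ^ CARD('a) = x"
proof (cases "x = 0")
  case False
  let ?S = "UNIV - {0 :: 'a}"
  have "bij_betw (\<lambda>y. x * y) ?S ?S"
    by (rule bij_betw_byWitness[where f' = "\<lambda>y. y / x"]) (use False in auto)
  from prod.reindex_bij_betw[OF this, of "\<lambda>y. y"] have "x ^ card ?S * \<Prod>?S = \<Prod>?S"
    by (simp add: prod.distrib)
  then have one: "x ^ card ?S = 1" by simp
  have "x ^ CARD('a) = x ^ Suc (card ?S)" by (rule arg_cong[OF card_Suc_Diff1[OF finite UNIV_I, symmetric]])
  also have "\<dots> = x" unfolding power_Suc one by (rule mult_1_right)
  finally show ?thesis .
next
  case True
  then show ?thesis by (simp add: power_0_left)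
qed

text \<open>Adding \<open>1\<close> permutes the field, so the sum of all elements does not change and \<open>CARD('a)\<close> vanishes in the
field.\<close>

lemma CHAR_eq_if_card:
  assumes q: "primepow q" and card: "CARD('a::{field,finite}) = q ^ k"
  shows "prime CHAR('a)" "\<exists>m. q = CHAR('a) ^ m"
proof -
  show pr: "prime CHAR('a)"
    using prime_CHAR_semidom[where ?'a = 'a] finite_imp_CHAR_pos[where ?'a = 'a] by simp
  obtain p m where p: "prime p" "q = p ^ m" using q by (auto simp: primepow_def)
  have "(\<Sum>x\<in>UNIV. x + 1 :: 'a) = (\<Sum>x\<in>UNIV. x)"
    by (rule sum.reindex_bij_witness[of _ "\<lambda>x. x - 1" "\<lambda>x. x + 1"]) simp_all
  then have "of_nat CARD('a) = (0 :: 'a)" by (simp add: sum.distrib)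
  then have "CHAR('a) dvd CARD('a)" using of_nat_eq_0_iff_char_dvd by blast
  then have "CHAR('a) dvd p" using pr by (simp add: card p(2)) (metis prime_dvd_power power_mult)
  then have "CHAR('a) = p" using pr p(1) primes_dvd_imp_eq by blast
  then show "\<exists>m. q = CHAR('a) ^ m" using p(2) by blast
qed

text \<open>The automorphism \<open>x \<mapsto> x ^ q\<close> of the field with \<open>q\<^sup>2\<close> elements; \<open>q\<close> odd enters through \<open>2 \<noteq> 0\<close>.\<close>

locale conjugation =
  fixes q :: nat and \<sigma> :: "'a::{field,finite} \<Rightarrow> 'a"
  assumes \<sigma>_power: "\<And>x. \<sigma> x = x ^ q"
    and \<sigma>_add: "\<And>x y. \<sigma> (x + y) = \<sigma> x + \<sigma> y"
    and \<sigma>_invol: "\<And>x. \<sigma> (\<sigma> x) = x"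
    and q_pos: "q > 0"
    and two_nonzero: "(2 :: 'a) \<noteq> 0"

lemma conjugation_if_card:
  assumes q: "primepow q" "odd q" and card: "CARD('a::{field,finite}) = q\<^sup>2"
  shows "conjugation q (\<lambda>x :: 'a. x ^ q)"
proof
  obtain m where m: "q = CHAR('a) ^ m" using CHAR_eq_if_card[OF q(1) card] by blast
  show "(x + y) ^ q = x ^ q + y ^ q" for x y :: 'a
    by (rule freshmans_dream'[OF CHAR_eq_if_card(1)[OF q(1) card] m])
  show "(x ^ q) ^ q = x" for x :: 'a
    using finite_field_power_card[of x] by (simp add: card power2_eq_square power_mult)
  show "q > 0" using q(1) primepow_gt_0_nat by blast
  show "(2 :: 'a) \<noteq> 0"
  proof
    assume "(2 :: 'a) = 0"
    then have "of_nat 2 = (0 :: 'a)" by simp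
    then have "CHAR('a) dvd 2" using of_nat_eq_0_iff_char_dvd by blast
    then have "CHAR('a) = 2"
      using CHAR_eq_if_card(1)[OF q(1) card] primes_dvd_imp_eq two_is_prime_nat by blast
    moreover have "m > 0" using m q(1) by (cases m) auto
    ultimately show False using q(2) m by simp
  qed
qed simp

lemma mat_entry_mult_rect:
  assumes "A \<in> carrier_mat n m" "B \<in> carrier_mat m k" "r < n" "s < k"
  shows "(A * B) $$ (r, s) = (\<Sum>t<m. A $$ (r, t) * B $$ (t, s))"
  using assms by (simp add: scalar_prod_def atLeast0LessThan)

lemma antidiag_carrier [simp]: "antidiag m \<in> carrier_mat m m"
  by (simp add: antidiag_def)

lemma antidiag_left:
  fixes X :: "'a::field mat"
  assumes X: "X \<in> carrier_mat m k" and rs: "r < m" "s < k"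
  shows "(antidiag m * X) $$ (r, s) = X $$ (m - 1 - r, s)"
proof -
  have "(antidiag m * X) $$ (r, s) = (\<Sum>t<m. antidiag m $$ (r, t) * X $$ (t, s))"
    using assms by (intro mat_entry_mult_rect) simp_all
  also have "\<dots> = (\<Sum>t<m. if t = m - 1 - r then X $$ (m - 1 - r, s) else 0)"
    using rs by (intro sum.cong) (auto simp: antidiag_def)
  finally show ?thesis using rs by simp
qed

lemma antidiag_right:
  fixes X :: "'a::field mat"
  assumes X: "X \<in> carrier_mat k m" and rs: "r < k" "s < m"
  shows "(X * antidiag m) $$ (r, s) = X $$ (r, m - 1 - s)"
proof -
  have "(X * antidiag m) $$ (r, s) = (\<Sum>t<m. X $$ (r, t) * antidiag m $$ (t, s))"
    using assms by (intro mat_entry_mult_rect) simp_all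
  also have "\<dots> = (\<Sum>t<m. if t = m - 1 - s then X $$ (r, m - 1 - s) else 0)"
    using rs by (intro sum.cong) (auto simp: antidiag_def)
  finally show ?thesis using rs by simp
qed

lemma antidiag_square [simp]: "antidiag m * antidiag m = (1\<^sub>m m :: 'a::field mat)"
proof (rule eq_matI)
  fix r s assume "r < dim_row (1\<^sub>m m :: 'a mat)" "s < dim_col (1\<^sub>m m :: 'a mat)"
  then have rs: "r < m" "s < m" by simp_all
  show "(antidiag m * antidiag m) $$ (r, s) = (1\<^sub>m m :: 'a mat) $$ (r, s)"
    unfolding antidiag_left[OF antidiag_carrier rs] using rs by (auto simp: antidiag_def)
qed (simp_all add: antidiag_def)

lemma antidiag_cancel [simp]:
  fixes X :: "'a::field mat"
  assumes "X \<in> carrier_mat m k"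
  shows "antidiag m * (antidiag m * X) = X"
  using assoc_mult_mat[OF antidiag_carrier antidiag_carrier assms, symmetric] left_mult_one_mat[OF assms]
  by simp

context conjugation
begin

text \<open>The adjoint \<open>J X\<^sup>* J\<close>, with \<open>X\<^sup>*\<close> the conjugate transpose and \<open>J\<close> the antidiagonal matrices of the
appropriate sizes. Rectangular matrices are allowed since it is applied to blocks.\<close>

definition dag :: "'a mat \<Rightarrow> 'a mat" where
  "dag X = mat (dim_col X) (dim_row X) (\<lambda>(r, s). \<sigma> (X $$ (dim_row X - 1 - s, dim_col X - 1 - r)))"

lemma \<sigma>_zero [simp]: "\<sigma> 0 = 0" and \<sigma>_one [simp]: "\<sigma> 1 = 1"
  using q_pos by (simp_all add: \<sigma>_power)

lemma \<sigma>_mult: "\<sigma> (x * y) = \<sigma> x * \<sigma> y"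
  by (simp add: \<sigma>_power power_mult_distrib)

lemma \<sigma>_sum: "\<sigma> (\<Sum>t\<in>A. f t) = (\<Sum>t\<in>A. \<sigma> (f t))"
  by (induction A rule: infinite_finite_induct) (simp_all add: \<sigma>_add)

lemma \<sigma>_minus: "\<sigma> (- x) = - \<sigma> x"
  using \<sigma>_add[of x "- x"] by (simp add: eq_neg_iff_add_eq_0 add.commute)

lemma dag_carrier [simp]: "X \<in> carrier_mat m k \<Longrightarrow> dag X \<in> carrier_mat k m"
  by (auto simp: dag_def)

lemma dag_index:
  assumes "X \<in> carrier_mat m k" "r < k" "s < m"
  shows "dag X $$ (r, s) = \<sigma> (X $$ (m - 1 - s, k - 1 - r))"
  using assms by (auto simp: dag_def)

lemma dag_eq:
  assumes X: "X \<in> carrier_mat m k"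
  shows "antidiag k * conj_transpose q X * antidiag m = dag X"
proof (rule eq_matI)
  have c: "conj_transpose q X \<in> carrier_mat k m" using X by (auto simp: conj_transpose_def)
  fix r s assume "r < dim_row (dag X)" "s < dim_col (dag X)"
  then have rs: "r < k" "s < m" using dag_carrier[OF X] by auto
  have "(antidiag k * conj_transpose q X * antidiag m) $$ (r, s) = (antidiag k * conj_transpose q X) $$ (r, m - 1 - s)"
    using rs by (intro antidiag_right[OF mult_carrier_mat[OF antidiag_carrier c]])
  also have "\<dots> = conj_transpose q X $$ (k - 1 - r, m - 1 - s)"
    using rs by (intro antidiag_left[OF c]) auto
  also have "\<dots> = dag X $$ (r, s)"
    using rs X by (simp add: conj_transpose_def dag_index[OF X rs] \<sigma>_power)
  finally show "(antidiag k * conj_transpose q X * antidiag m) $$ (r, s) = dag X $$ (r, s)" .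
qed (use X in \<open>auto simp: antidiag_def dag_def\<close>)

lemma dag_mult:
  assumes X: "X \<in> carrier_mat m k" and Y: "Y \<in> carrier_mat k l"
  shows "dag (X * Y) = dag Y * dag X"
proof (rule eq_matI)
  have XY: "X * Y \<in> carrier_mat m l" using X Y by (rule mult_carrier_mat)
  fix r s assume "r < dim_row (dag Y * dag X)" "s < dim_col (dag Y * dag X)"
  then have rs: "r < l" "s < m" using dag_carrier[OF X] dag_carrier[OF Y] by auto
  have "dag (X * Y) $$ (r, s) = \<sigma> (\<Sum>t<k. X $$ (m - 1 - s, t) * Y $$ (t, l - 1 - r))"
    unfolding dag_index[OF XY rs] using rs by (subst mat_entry_mult_rect[OF X Y]) auto
  also have "\<dots> = (\<Sum>t<k. \<sigma> (Y $$ (t, l - 1 - r)) * \<sigma> (X $$ (m - 1 - s, t)))"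
    by (simp add: \<sigma>_sum \<sigma>_mult mult.commute)
  also have "\<dots> = (\<Sum>t<k. \<sigma> (Y $$ (k - Suc t, l - 1 - r)) * \<sigma> (X $$ (m - 1 - s, k - Suc t)))"
    by (rule sum.nat_diff_reindex[symmetric])
  also have "\<dots> = (\<Sum>t<k. dag Y $$ (r, t) * dag X $$ (t, s))"
    using rs by (intro sum.cong) (simp_all add: dag_index[OF X] dag_index[OF Y])
  also have "\<dots> = (dag Y * dag X) $$ (r, s)"
    by (rule mat_entry_mult_rect[OF dag_carrier[OF Y] dag_carrier[OF X] rs, symmetric])
  finally show "dag (X * Y) $$ (r, s) = (dag Y * dag X) $$ (r, s)" .
qed (use X Y in \<open>auto simp: dag_def\<close>)

lemma dag_add:
  assumes "X \<in> carrier_mat m k" "Y \<in> carrier_mat m k"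
  shows "dag (X + Y) = dag X + dag Y"
  using assms by (intro eq_matI) (auto simp: dag_def \<sigma>_add)

lemma dag_uminus: "dag (- X) = - dag X"
  by (intro eq_matI) (auto simp: dag_def \<sigma>_minus)

lemma dag_diff:
  assumes "X \<in> carrier_mat m k" "Y \<in> carrier_mat m k"
  shows "dag (X - Y) = dag X - dag Y"
  using assms \<sigma>_add[of _ "- _"] by (intro eq_matI) (auto simp: dag_def \<sigma>_minus diff_conv_add_uminus simp del: add_uminus_conv_diff)

lemma dag_zero [simp]: "dag (0\<^sub>m m k) = 0\<^sub>m k m"
  by (intro eq_matI) (auto simp: dag_def)

lemma dag_one [simp]: "dag (1\<^sub>m m) = 1\<^sub>m m"
  by (intro eq_matI) (auto simp: dag_def)

lemma dag_dag [simp]: "dag (dag X) = X"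
  by (intro eq_matI) (auto simp: dag_def \<sigma>_invol)

end

text \<open>The permutation with matrix \<open>J\<close>, extended by the identity.\<close>

definition mirror :: "nat \<Rightarrow> nat \<Rightarrow> nat" where
  "mirror n r = (if r < n then n - 1 - r else r)"

lemma mirror_mirror [simp]: "mirror n (mirror n r) = r"
  by (auto simp: mirror_def)

lemma mirror_less: "mirror n r < n \<longleftrightarrow> r < n"
  by (auto simp: mirror_def)

lemma mirror_less_iff: "r < n \<Longrightarrow> s < n \<Longrightarrow> mirror n r < mirror n s \<longleftrightarrow> s < r"
  unfolding mirror_def by (simp, linarith)

lemma mirror_permutes: "mirror n permutes {..<n}"
proof (rule bij_imp_permutes)
  show "bij_betw (mirror n) {..<n} {..<n}"
    by (rule bij_betw_byWitness[where f' = "mirror n"]) (auto simp: mirror_less)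
qed (simp add: mirror_def)

lemma mirror_comp [simp]: "mirror n \<circ> mirror n = id"
  by (simp add: fun_eq_iff)

context conjugation
begin

section \<open>The unitary group and its Lie algebra\<close>

lemma conj_transpose_carrier: "X \<in> carrier_mat m k \<Longrightarrow> conj_transpose q X \<in> carrier_mat k m"
  by (auto simp: conj_transpose_def)

text \<open>As \<open>J * J = 1\<close>, unitarity \<open>g\<^sup>* J g = J\<close> says that \<open>dag g\<close> is the inverse of \<open>g\<close>.\<close>

lemma unitary_group_iff: "g \<in> unitary_group q m \<longleftrightarrow> g \<in> carrier_mat m m \<and> dag g * g = 1\<^sub>m m"
proof -
  let ?J = "antidiag m :: 'a mat"
  have key: "dag g * g = ?J * (conj_transpose q g * ?J * g)" if g: "g \<in> carrier_mat m m" for g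
    unfolding dag_eq[OF g, symmetric] using g conj_transpose_carrier[OF g]
    by (simp add: mat_assoc[of _ m])
  show ?thesis
  proof
    assume "g \<in> unitary_group q m"
    then have g: "g \<in> carrier (GL m)" and e: "conj_transpose q g * ?J * g = ?J"
      by (simp_all add: unitary_group_def)
    have "dag g * g = 1\<^sub>m m" unfolding key[OF GL_carrier[OF g]] e by (rule antidiag_square)
    then show "g \<in> carrier_mat m m \<and> dag g * g = 1\<^sub>m m" using g by simp
  next
    assume A: "g \<in> carrier_mat m m \<and> dag g * g = 1\<^sub>m m"
    then have g: "g \<in> carrier_mat m m" and e: "dag g * g = 1\<^sub>m m" by simp_all
    have c: "conj_transpose q g * ?J * g \<in> carrier_mat m m"
      using conj_transpose_carrier[OF g] g by simp
    have "conj_transpose q g * ?J * g = ?J * (?J * (conj_transpose q g * ?J * g))"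
      by (rule antidiag_cancel[OF c, symmetric])
    also have "\<dots> = ?J" unfolding key[OF g, symmetric] e by simp
    finally show "g \<in> unitary_group q m"
      using GL_I[OF g dag_carrier[OF g] e] by (simp add: unitary_group_def)
  qed
qed

lemma unitary_alg_iff: "X \<in> unitary_alg q m \<longleftrightarrow> X \<in> carrier_mat m m \<and> dag X = - X"
proof -
  let ?J = "antidiag m :: 'a mat"
  have key: "?J * (conj_transpose q X * ?J + ?J * X) = dag X + X" if X: "X \<in> carrier_mat m m" for X
  proof -
    have c: "conj_transpose q X * ?J \<in> carrier_mat m m" "?J * X \<in> carrier_mat m m"
      using conj_transpose_carrier[OF X] X by simp_all
    show ?thesis
      unfolding mult_add_distrib_mat[OF antidiag_carrier c] antidiag_cancel[OF X] dag_eq[OF X, symmetric]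
      using conj_transpose_carrier[OF X] by (simp add: mat_assoc[of _ m])
  qed
  show ?thesis
  proof
    assume "X \<in> unitary_alg q m"
    then have X: "X \<in> carrier_mat m m" and e: "conj_transpose q X * ?J + ?J * X = 0\<^sub>m m m"
      by (simp_all add: unitary_alg_def)
    have "dag X + X = 0\<^sub>m m m"
      unfolding key[OF X, symmetric] e by (rule right_mult_zero_mat[OF antidiag_carrier])
    then show "X \<in> carrier_mat m m \<and> dag X = - X" using X mat_add_eq_zero_iff[OF dag_carrier[OF X] X] by simp
  next
    assume A: "X \<in> carrier_mat m m \<and> dag X = - X"
    then have X: "X \<in> carrier_mat m m" and e: "dag X + X = 0\<^sub>m m m"
      using mat_add_eq_zero_iff[OF dag_carrier, of X m m X] by auto
    have c: "conj_transpose q X * ?J + ?J * X \<in> carrier_mat m m"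
      using conj_transpose_carrier[OF X] X by simp
    have "conj_transpose q X * ?J + ?J * X = ?J * (?J * (conj_transpose q X * ?J + ?J * X))"
      by (rule antidiag_cancel[OF c, symmetric])
    also have "\<dots> = 0\<^sub>m m m"
      unfolding key[OF X] e by (rule right_mult_zero_mat[OF antidiag_carrier])
    finally show "X \<in> unitary_alg q m" using X by (simp add: unitary_alg_def)
  qed
qed

lemma dag_pat:
  assumes "X \<in> pat n \<rho>"
  shows "dag X \<in> pat n (\<lambda>r s. \<rho> (n - 1 - s) (n - 1 - r))"
proof -
  have "dag X $$ (r, s) = 0" if "r < n" "s < n" "\<not> \<rho> (n - 1 - s) (n - 1 - r)" for r s
    using dag_index[OF pat_carrier[OF assms], of r s] pat_zero[OF assms, of "n - 1 - s" "n - 1 - r"] that by simp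
  then show ?thesis using dag_carrier[OF pat_carrier[OF assms]] by (simp add: pat_def)
qed

lemma dag_pat_upper:
  assumes b: "\<And>r. r < n \<Longrightarrow> b r + b (n - 1 - r) = k" and X: "X \<in> pat n (upper b)"
  shows "dag X \<in> pat n (upper b)"
proof (rule pat_mono[OF dag_pat[OF X]])
  fix r s assume "r < n" "s < n" "b (n - 1 - s) \<le> b (n - 1 - r)"
  then show "b r \<le> b s" using b[of r] b[of s] by linarith
qed

lemma dag_pat_triangular:
  assumes X: "X \<in> pat n (\<le>)"
  shows "dag X \<in> pat n (\<le>)"
  by (rule pat_mono[OF dag_pat[OF X]]) linarith

lemma blk_dag:
  assumes b: "\<And>r. r < n \<Longrightarrow> b r + b (n - 1 - r) = k" and X: "X \<in> carrier_mat n n"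
  shows "blk n b (dag X) = dag (blk n b X)"
proof (rule eq_matI)
  fix r s assume "r < dim_row (dag (blk n b X))" "s < dim_col (dag (blk n b X))"
  then have rs: "r < n" "s < n" by (simp_all add: dag_def)
  have "b r = b s \<longleftrightarrow> b (n - 1 - s) = b (n - 1 - r)" using b[OF rs(1)] b[OF rs(2)] by linarith
  then show "blk n b (dag X) $$ (r, s) = dag (blk n b X) $$ (r, s)"
    using rs by (auto simp: dag_index[OF X] dag_index[OF blk_carrier])
qed (simp_all add: dag_def)

lemma dag_GL:
  assumes g: "g \<in> carrier (GL n)"
  shows "dag g \<in> carrier (GL n)" "dag (iv n g) = iv n (dag g)"
proof -
  have c: "g \<in> carrier_mat n n" "iv n g \<in> carrier_mat n n" using g by simp_all
  have e: "dag (iv n g) * dag g = 1\<^sub>m n"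
    unfolding dag_mult[OF c, symmetric] iv_right[OF g] by simp
  show "dag g \<in> carrier (GL n)" by (rule GL_I[OF dag_carrier[OF c(1)] dag_carrier[OF c(2)] e])
  show "dag (iv n g) = iv n (dag g)" by (rule iv_unique[OF dag_carrier[OF c(1)] dag_carrier[OF c(2)] e, symmetric])
qed

lemma dag_pmat:
  assumes p: "p permutes {..<n}"
  shows "dag (pmat n p) = pmat n (mirror n \<circ> pinv p \<circ> mirror n)"
proof (rule eq_matI)
  fix r s assume "r < dim_row (pmat n (mirror n \<circ> pinv p \<circ> mirror n) :: 'a mat)"
    "s < dim_col (pmat n (mirror n \<circ> pinv p \<circ> mirror n) :: 'a mat)"
  then have rs: "r < n" "s < n" by (simp_all add: pmat_def)
  have "mirror n s = p (mirror n r) \<longleftrightarrow> r = mirror n (pinv p (mirror n s))"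
    using permutes_inverses[OF p] mirror_mirror by metis
  then show "dag (pmat n p) $$ (r, s) = pmat n (mirror n \<circ> pinv p \<circ> mirror n) $$ (r, s)"
    unfolding dag_index[OF pmat_carrier rs] using rs by (simp add: pmat_def mirror_def)
qed (simp_all add: dag_def pmat_def)

lemma iv_dag_pmat:
  assumes p: "p permutes {..<n}"
  shows "iv n (dag (pmat n p)) = pmat n (mirror n \<circ> p \<circ> mirror n)"
proof (rule iv_unique)
  have pi: "pinv p permutes {..<n}" using p by (rule permutes_inv)
  have perm: "(mirror n \<circ> p \<circ> mirror n) permutes {..<n}" "(mirror n \<circ> pinv p \<circ> mirror n) permutes {..<n}"
    using p pi mirror_permutes by (auto intro!: permutes_compose)
  have "mirror n \<circ> p \<circ> mirror n \<circ> (mirror n \<circ> pinv p \<circ> mirror n) = id"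
    using permutes_inverses[OF p] by (simp add: fun_eq_iff)
  then show "pmat n (mirror n \<circ> p \<circ> mirror n) * dag (pmat n p) = 1\<^sub>m n"
    unfolding dag_pmat[OF p] pmat_mult[OF perm] by simp
qed simp_all

lemma unitary_iv:
  assumes "g \<in> unitary_group q n"
  shows "g \<in> carrier (GL n)" "iv n g = dag g" "iv n (dag g) = g"
proof -
  have g: "g \<in> carrier_mat n n" "dag g * g = 1\<^sub>m n" using assms by (simp_all add: unitary_group_iff)
  show gc: "g \<in> carrier (GL n)" by (rule GL_I[OF g(1) dag_carrier[OF g(1)] g(2)])
  show iv: "iv n g = dag g" by (rule iv_unique[OF g(1) dag_carrier[OF g(1)] g(2)])
  show "iv n (dag g) = g" unfolding iv[symmetric] by (rule iv_iv[OF gc])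
qed

lemma unitary_if_iv_dag:
  assumes g: "g \<in> carrier (GL n)" and e: "iv n (dag g) = g"
  shows "g \<in> unitary_group q n"
proof -
  have "dag g * iv n (dag g) = 1\<^sub>m n" using dag_GL(1)[OF g] by simp
  then show ?thesis using g e by (simp add: unitary_group_iff)
qed

lemma unitary_pmat_commute:
  assumes p: "p permutes {..<n}" and U: "(pmat n p :: 'a mat) \<in> unitary_group q n"
  shows "pinv p (mirror n r) = mirror n (pinv p r)"
proof -
  have pi: "pinv p permutes {..<n}" using p by (rule permutes_inv)
  have "pmat n (pinv p) = (pmat n (mirror n \<circ> pinv p \<circ> mirror n) :: 'a mat)"
    using unitary_iv(2)[OF U] unfolding iv_pmat[OF p] dag_pmat[OF p] .
  then have e: "(pmat n (pinv p) :: 'a mat) $$ (pinv p s, s) = pmat n (mirror n \<circ> pinv p \<circ> mirror n) $$ (pinv p s, s)" for s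
    by simp
  have "pinv p s = mirror n (pinv p (mirror n s))" if "s < n" for s
    using e[of s] that permutes_lt[OF pi, of s] by (simp add: pmat_def split: if_splits)
  moreover have "pinv p s = s" "mirror n s = s" if "\<not> s < n" for s
    using that permutes_not_in[OF pi, of s] by (simp_all add: mirror_def)
  ultimately show ?thesis by (cases "r < n") (metis mirror_mirror, simp)
qed

text \<open>The unitary group is the set of fixed points of the automorphism \<open>g \<mapsto> (dag g)\<inverse>\<close>. It maps triangular
matrices to triangular ones and permutation matrices to permutation matrices, so applying it to the
normal form \<open>g = u w b\<close> gives a second such factorization of \<open>g\<close>. First the permutations agree, by
\<open>triangular_exchange\<close>. Once \<open>w\<close> is fixed, the automorphism preserves the set of inversions of \<open>w\<close>, so the second
factorization is again in normal form, and \<open>u\<close> and \<open>b\<close> are fixed too.\<close>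

lemma unitary_bruhat:
  fixes g :: "'a mat"
  assumes g: "g \<in> unitary_group q n"
  shows "\<exists>b1 p b2. b1 \<in> unitary_group q n \<inter> pat n (\<le>) \<and> b2 \<in> unitary_group q n \<inter> pat n (\<le>) \<and>
      p permutes {..<n} \<and> (pmat n p :: 'a mat) \<in> unitary_group q n \<and> g = b1 * pmat n p * b2"
proof -
  have gc: "g \<in> carrier (GL n)" and gdag: "iv n (dag g) = g" using unitary_iv[OF g] by blast+
  obtain u w b where u: "u \<in> carrier_mat n n" "u - 1\<^sub>m n \<in> pat n (inversion w)" and w: "w permutes {..<n}"
    and b: "b \<in> carrier (GL n)" "b \<in> pat n (\<le>)" and eq: "g = u * pmat n w * b"
    using bruhat_normal_form[OF gc] by blast
  let ?K = "{g \<in> carrier_mat n n. (g :: 'a mat) - 1\<^sub>m n \<in> pat n (inversion w)}"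
  have K: "subgroup ?K (GL n)" by (rule unipotent_subgroup) (auto simp: inversion_def)
  have uGL: "u \<in> carrier (GL n)" using subgroup.mem_carrier[OF K, of u] u by simp
  have u_tri: "u \<in> pat n (\<le>)"
  proof -
    have "u $$ (r, s) = 0" if "r < n" "s < n" "\<not> r \<le> s" for r s
      using pat_zero[OF u(2), of r s] that u(1) by (auto simp: inversion_def)
    then show ?thesis using u(1) by (simp add: pat_def)
  qed
  note dGL = dag_GL(1)[OF uGL] dag_GL(1)[OF b(1)] dag_GL(1)[OF pmat_GL[OF w]]
  define u' where "u' = iv n (dag u)"
  define b' where "b' = iv n (dag b)"
  define w' where "w' = mirror n \<circ> w \<circ> mirror n"
  have u': "u' \<in> carrier (GL n)" "u' \<in> pat n (\<le>)"
    using dGL upper_inverse[OF dGL(1), of id] dag_pat_triangular[OF u_tri] by (simp_all add: u'_def)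
  have b': "b' \<in> carrier (GL n)" "b' \<in> pat n (\<le>)"
    using dGL upper_inverse[OF dGL(2), of id] dag_pat_triangular[OF b(2)] by (simp_all add: b'_def)
  have w': "w' permutes {..<n}"
    unfolding w'_def using w mirror_permutes by (auto intro!: permutes_compose)
  have pw: "(pmat n w :: 'a mat) \<in> carrier (GL n)" "(pmat n w' :: 'a mat) \<in> carrier (GL n)" using w w' by simp_all
  have eq': "g = u' * pmat n w' * b'"
  proof -
    have "dag g = dag b * (dag (pmat n w) * dag u)"
      unfolding eq using dag_mult[OF _ GL_carrier[OF b(1)], of "u * pmat n w" n] dag_mult[OF u(1) pmat_carrier] u(1)
      by simp
    then have "iv n (dag g) = iv n (dag (pmat n w) * dag u) * iv n (dag b)"
      using dGL by (simp add: iv_mult)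
    also have "\<dots> = u' * pmat n w' * b'"
      using dGL by (simp add: iv_mult u'_def b'_def w'_def iv_dag_pmat[OF w])
    finally show ?thesis using gdag by simp
  qed
  have ww: "w = w'"
  proof (rule triangular_exchange[OF _ _ _ _ w w'])
    show "iv n u' * u \<in> carrier (GL n)" "b' * iv n b \<in> carrier (GL n)" using u' b' uGL b by simp_all
    show "iv n u' * u \<in> pat n (\<le>)" "b' * iv n b \<in> pat n (\<le>)"
      by (rule triangular_mult[OF triangular_inverse[OF u'] u_tri], rule triangular_mult[OF b'(2) triangular_inverse[OF b]])
    have "(iv n u' * u) * pmat n w = iv n u' * (u * pmat n w * b) * iv n b"
      using uGL u'(1) b(1) pw by (simp add: mat_assoc[of _ n])
    also have "\<dots> = iv n u' * (u' * pmat n w' * b') * iv n b"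
      using eq eq' by simp
    also have "\<dots> = pmat n w' * (b' * iv n b)"
      using u'(1) b'(1) b(1) pw by (simp add: mat_assoc[of _ n])
    finally show "(iv n u' * u) * pmat n w = pmat n w' * (b' * iv n b)" .
  qed
  have wU: "(pmat n w :: 'a mat) \<in> unitary_group q n"
    by (rule unitary_if_iv_dag[OF pw(1)]) (simp add: iv_dag_pmat[OF w] ww[unfolded w'_def, symmetric])
  have comm: "pinv w (mirror n r) = mirror n (pinv w r)" for r by (rule unitary_pmat_commute[OF w wU])
  have wi: "pinv w permutes {..<n}" using w by (rule permutes_inv)
  have "dag u - 1\<^sub>m n \<in> pat n (inversion w)"
  proof -
    have "dag u - 1\<^sub>m n = dag (u - 1\<^sub>m n)" using dag_diff[OF u(1) one_carrier_mat] by simp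
    moreover have "dag (u - 1\<^sub>m n) \<in> pat n (inversion w)"
    proof (rule pat_mono[OF dag_pat[OF u(2)]])
      fix r s assume rs: "r < n" "s < n" and inv: "inversion w (n - 1 - s) (n - 1 - r)"
      have "n - 1 - s = mirror n s" "n - 1 - r = mirror n r" using rs by (simp_all add: mirror_def)
      then have "mirror n s < mirror n r" "mirror n (pinv w r) < mirror n (pinv w s)"
        using inv by (simp_all add: inversion_def comm)
      then show "inversion w r s"
        using rs permutes_lt[OF wi, of r] permutes_lt[OF wi, of s]
        by (simp add: inversion_def mirror_less_iff)
    qed
    ultimately show ?thesis by simp
  qed
  then have "u' \<in> ?K"
    using subgroup.m_inv_closed[OF K, of "dag u"] dag_carrier[OF u(1)] by (simp add: u'_def)
  then have "u = u'"
    using bruhat_normal_form_unique[OF u _ _ w b b', of u'] eq eq' ww by simp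
  then have uU: "u \<in> unitary_group q n"
    using unitary_if_iv_dag[OF uGL] by (simp add: u'_def)
  have "b' = b"
  proof -
    have "u * pmat n w * b = u * pmat n w * b'" using eq eq' ww \<open>u = u'\<close> by simp
    moreover have "u * pmat n w \<in> carrier (GL n)" using uGL pw by simp
    ultimately show ?thesis using b(1) b'(1) by (metis GL_carrier iv_cancel(1))
  qed
  then have bU: "b \<in> unitary_group q n" using unitary_if_iv_dag[OF b(1)] by (simp add: b'_def)
  show ?thesis using uU u_tri bU b(2) w wU eq by blast
qed

end

section \<open>Three by three block matrices\<close>

text \<open>The unitary parabolic subgroup consists of three by three block matrices with bands of sizes \<open>i\<close>, \<open>m\<close>, \<open>i\<close>.
Indexing the blocks by a type with three elements lets products and adjoints be computed block by
block.\<close>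

datatype band = Top | Mid | Bot

fun flip :: "band \<Rightarrow> band" where
  "flip Top = Bot" | "flip Mid = Mid" | "flip Bot = Top"

fun band_size :: "nat \<Rightarrow> nat \<Rightarrow> band \<Rightarrow> nat" where
  "band_size i m Top = i" | "band_size i m Mid = m" | "band_size i m Bot = i"

fun band_start :: "nat \<Rightarrow> nat \<Rightarrow> band \<Rightarrow> nat" where
  "band_start i m Top = 0" | "band_start i m Mid = i" | "band_start i m Bot = i + m"

definition block :: "nat \<Rightarrow> nat \<Rightarrow> 'a mat \<Rightarrow> band \<Rightarrow> band \<Rightarrow> 'a mat" where
  "block i m X a c = mat (band_size i m a) (band_size i m c)
     (\<lambda>(r, s). X $$ (band_start i m a + r, band_start i m c + s))"

text \<open>The grading that defines the parabolic subgroup.\<close>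

definition band_index :: "nat \<Rightarrow> nat \<Rightarrow> nat \<Rightarrow> nat" where
  "band_index i m r = (if r < i then 0 else if r < i + m then 1 else 2)"

lemma block_carrier [simp]: "block i m X a c \<in> carrier_mat (band_size i m a) (band_size i m c)"
  by (simp add: block_def)

lemma block_index:
  "r < band_size i m a \<Longrightarrow> s < band_size i m c \<Longrightarrow>
    block i m X a c $$ (r, s) = X $$ (band_start i m a + r, band_start i m c + s)"
  by (simp add: block_def)

lemma band_lt: "r < band_size i m a \<Longrightarrow> band_start i m a + r < i + m + i"
  by (cases a) auto

lemma band_cover:
  assumes "r < i + m + i"
  obtains a t where "t < band_size i m a" "r = band_start i m a + t"
proof -
  consider "r < i" | "i \<le> r" "r < i + m" | "i + m \<le> r" by linarith
  then show thesis
  proof cases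
    case 1
    then show ?thesis using that[of r Top] by simp
  next
    case 2
    then show ?thesis using that[of "r - i" Mid] by simp
  next
    case 3
    then show ?thesis using that[of "r - (i + m)" Bot] assms by simp
  qed
qed

lemma block_eqI:
  assumes X: "X \<in> carrier_mat (i + m + i) (i + m + i)" and Y: "Y \<in> carrier_mat (i + m + i) (i + m + i)"
    and e: "\<And>a c. block i m X a c = block i m Y a c"
  shows "X = Y"
proof (rule eq_matI)
  fix r s assume "r < dim_row Y" "s < dim_col Y"
  then have "r < i + m + i" "s < i + m + i" using Y by auto
  then obtain a t c u where at: "t < band_size i m a" "r = band_start i m a + t"
    and cu: "u < band_size i m c" "s = band_start i m c + u"
    by (metis band_cover)
  show "X $$ (r, s) = Y $$ (r, s)"
    using e[of a c] block_index[OF at(1) cu(1), of X] block_index[OF at(1) cu(1), of Y] at cu by simp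
qed (use X Y in auto)

lemma sum_lessThan_split:
  fixes f :: "nat \<Rightarrow> 'b::comm_monoid_add"
  shows "(\<Sum>t<k + l. f t) = (\<Sum>t<k. f t) + (\<Sum>t<l. f (k + t))"
  by (induction l) (simp_all add: add.assoc)

lemma block_mult:
  fixes X Y :: "'a::field mat"
  assumes X: "X \<in> carrier_mat (i + m + i) (i + m + i)" and Y: "Y \<in> carrier_mat (i + m + i) (i + m + i)"
  shows "block i m (X * Y) a c = block i m X a Top * block i m Y Top c + block i m X a Mid * block i m Y Mid c
    + block i m X a Bot * block i m Y Bot c" (is "_ = ?R")
proof (rule eq_matI)
  have R: "block i m X a x * block i m Y x c \<in> carrier_mat (band_size i m a) (band_size i m c)" for x
    by (rule mult_carrier_mat[OF block_carrier block_carrier])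
  have Rc: "?R \<in> carrier_mat (band_size i m a) (band_size i m c)"
    using R[of Bot] by simp
  fix r s assume "r < dim_row ?R" "s < dim_col ?R"
  then have rs: "r < band_size i m a" "s < band_size i m c" using Rc by auto
  let ?f = "\<lambda>t. X $$ (band_start i m a + r, t) * Y $$ (t, band_start i m c + s)"
  have prod: "(block i m X a x * block i m Y x c) $$ (r, s) = (\<Sum>t<band_size i m x. ?f (band_start i m x + t))" for x
    unfolding mat_entry_mult_rect[OF block_carrier block_carrier rs]
    using rs by (intro sum.cong refl) (simp add: block_index)
  have "block i m (X * Y) a c $$ (r, s) = (\<Sum>t<i + m + i. ?f t)"
    unfolding block_index[OF rs] by (rule mat_entry_mult[OF X Y band_lt[OF rs(1)] band_lt[OF rs(2)]])
  also have "\<dots> = (\<Sum>t<i. ?f t) + (\<Sum>t<m. ?f (i + t)) + (\<Sum>t<i. ?f (i + m + t))"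
    by (simp only: sum_lessThan_split)
  also have "\<dots> = ?R $$ (r, s)"
    using rs carrier_matD[OF R[of Top]] carrier_matD[OF R[of Mid]] carrier_matD[OF R[of Bot]]
      prod[of Top] prod[of Mid] prod[of Bot]
    by (simp del: index_mult_mat)
  finally show "block i m (X * Y) a c $$ (r, s) = ?R $$ (r, s)" .
qed (simp_all add: block_def)

lemma block_zero: "block i m (0\<^sub>m (i + m + i) (i + m + i)) a c = 0\<^sub>m (band_size i m a) (band_size i m c)"
  using band_lt by (intro eq_matI) (auto simp: block_def)

lemma block_one: "block i m (1\<^sub>m (i + m + i)) a c =
    (if a = c then 1\<^sub>m (band_size i m a) else 0\<^sub>m (band_size i m a) (band_size i m c))"
  by (cases a; cases c; intro eq_matI) (auto simp: block_def)

lemma band_index_band: "r < band_size i m a \<Longrightarrow>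
    band_index i m (band_start i m a + r) = (case a of Top \<Rightarrow> 0 | Mid \<Rightarrow> 1 | Bot \<Rightarrow> 2)"
  by (cases a) (auto simp: band_index_def)

lemma block_blk: "block i m (blk (i + m + i) (band_index i m) X) a c =
    (if a = c then block i m X a c else 0\<^sub>m (band_size i m a) (band_size i m c))"
proof (rule eq_matI)
  fix r s
  assume "r < dim_row (if a = c then block i m X a c else 0\<^sub>m (band_size i m a) (band_size i m c))"
    "s < dim_col (if a = c then block i m X a c else 0\<^sub>m (band_size i m a) (band_size i m c))"
  then have rs: "r < band_size i m a" "s < band_size i m c" by (auto simp: block_def split: if_splits)
  show "block i m (blk (i + m + i) (band_index i m) X) a c $$ (r, s) =
      (if a = c then block i m X a c else 0\<^sub>m (band_size i m a) (band_size i m c)) $$ (r, s)"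
    using rs band_lt[OF rs(1)] band_lt[OF rs(2)] band_index_band[OF rs(1)] band_index_band[OF rs(2)]
    by (cases a; cases c) (simp_all add: block_def)
qed (auto simp: block_def)

lemma pat_band_iff:
  assumes X: "X \<in> carrier_mat (i + m + i) (i + m + i)"
  shows "X \<in> pat (i + m + i) (upper (band_index i m)) \<longleftrightarrow>
    block i m X Mid Top = 0\<^sub>m m i \<and> block i m X Bot Top = 0\<^sub>m i i \<and> block i m X Bot Mid = 0\<^sub>m i m"
proof
  assume P: "X \<in> pat (i + m + i) (upper (band_index i m))"
  have z: "block i m X a c $$ (r, s) = 0" if "r < band_size i m a" "s < band_size i m c"
     "(a, c) \<in> {(Mid, Top), (Bot, Top), (Bot, Mid)}" for a c r s
    using pat_zero[OF P band_lt[OF that(1)] band_lt[OF that(2)]] that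
    by (auto simp: block_index band_index_band)
  show "block i m X Mid Top = 0\<^sub>m m i \<and> block i m X Bot Top = 0\<^sub>m i i \<and> block i m X Bot Mid = 0\<^sub>m i m"
    using z[of _ Mid _ Top] z[of _ Bot _ Top] z[of _ Bot _ Mid]
    by (intro conjI eq_matI) (simp_all add: block_def)
next
  assume A: "block i m X Mid Top = 0\<^sub>m m i \<and> block i m X Bot Top = 0\<^sub>m i i \<and> block i m X Bot Mid = 0\<^sub>m i m"
  have "X $$ (r, s) = 0" if rs: "r < i + m + i" "s < i + m + i" "\<not> band_index i m r \<le> band_index i m s" for r s
  proof -
    obtain a t c u where at: "t < band_size i m a" "r = band_start i m a + t"
      and cu: "u < band_size i m c" "s = band_start i m c + u"
      using rs by (metis band_cover)
    have "(a, c) \<in> {(Mid, Top), (Bot, Top), (Bot, Mid)}"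
      using rs(3) band_index_band[OF at(1)] band_index_band[OF cu(1)] at(2) cu(2)
      by (cases a; cases c) auto
    then have "block i m X a c $$ (t, u) = 0" using A at(1) cu(1) by auto
    then show ?thesis using block_index[OF at(1) cu(1), of X] at(2) cu(2) by simp
  qed
  then show "X \<in> pat (i + m + i) (upper (band_index i m))" using X by (simp add: pat_def)
qed

lemma diag3:
  assumes "A \<in> carrier_mat i i" "B \<in> carrier_mat m m" "F \<in> carrier_mat i i"
  shows "diag_block_mat [A, B, F] = four_block_mat A (0\<^sub>m i (m + i)) (0\<^sub>m (m + i) i)
    (four_block_mat B (0\<^sub>m m i) (0\<^sub>m i m) F)"
  unfolding diag_block_mat.simps(2)[of A "[B, F]"] diag_block_mat.simps(2)[of B "[F]"]
    diag_block_mat_singleton Let_def using assms by simp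

lemma block_of_diag3:
  assumes "A \<in> carrier_mat i i" "B \<in> carrier_mat m m" "F \<in> carrier_mat i i"
  shows "diag_block_mat [A, B, F] \<in> carrier_mat (i + m + i) (i + m + i)"
    "block i m (diag_block_mat [A, B, F]) a c =
      (if a = c then (case a of Top \<Rightarrow> A | Mid \<Rightarrow> B | Bot \<Rightarrow> F) else 0\<^sub>m (band_size i m a) (band_size i m c))"
proof -
  show "diag_block_mat [A, B, F] \<in> carrier_mat (i + m + i) (i + m + i)"
    unfolding diag3[OF assms] carrier_mat_def using assms by auto
  show "block i m (diag_block_mat [A, B, F]) a c =
      (if a = c then (case a of Top \<Rightarrow> A | Mid \<Rightarrow> B | Bot \<Rightarrow> F) else 0\<^sub>m (band_size i m a) (band_size i m c))"
    unfolding diag3[OF assms] using assms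
    by (cases a; cases c; intro eq_matI) (auto simp: block_def)
qed

lemma block_of_upper3:
  assumes "A \<in> carrier_mat i i" "B \<in> carrier_mat m m" "F \<in> carrier_mat i i"
    "C \<in> carrier_mat i m" "D \<in> carrier_mat i i" "E \<in> carrier_mat m i"
  shows "block_upper3 A C D B E F \<in> carrier_mat (i + m + i) (i + m + i)"
    "block i m (block_upper3 A C D B E F) Top Top = A" "block i m (block_upper3 A C D B E F) Top Mid = C"
    "block i m (block_upper3 A C D B E F) Top Bot = D" "block i m (block_upper3 A C D B E F) Mid Top = 0\<^sub>m m i"
    "block i m (block_upper3 A C D B E F) Mid Mid = B" "block i m (block_upper3 A C D B E F) Mid Bot = E"
    "block i m (block_upper3 A C D B E F) Bot Top = 0\<^sub>m i i" "block i m (block_upper3 A C D B E F) Bot Mid = 0\<^sub>m i m"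
    "block i m (block_upper3 A C D B E F) Bot Bot = F"
proof -
  show "block_upper3 A C D B E F \<in> carrier_mat (i + m + i) (i + m + i)"
    using assms unfolding block_upper3_def append_rows_def carrier_mat_def by auto
  show "block i m (block_upper3 A C D B E F) Top Top = A" "block i m (block_upper3 A C D B E F) Top Mid = C"
    "block i m (block_upper3 A C D B E F) Top Bot = D" "block i m (block_upper3 A C D B E F) Mid Top = 0\<^sub>m m i"
    "block i m (block_upper3 A C D B E F) Mid Mid = B" "block i m (block_upper3 A C D B E F) Mid Bot = E"
    "block i m (block_upper3 A C D B E F) Bot Top = 0\<^sub>m i i" "block i m (block_upper3 A C D B E F) Bot Mid = 0\<^sub>m i m"
    "block i m (block_upper3 A C D B E F) Bot Bot = F"
    using assms by (auto intro!: eq_matI simp: block_def block_upper3_def append_rows_def)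
qed

lemma band_index_symmetric:
  assumes "r < i + m + i"
  shows "band_index i m r + band_index i m (i + m + i - 1 - r) = 2"
  using assms by (auto simp: band_index_def)

lemma blk_band_diag:
  fixes X :: "'a::field mat"
  assumes X: "X \<in> carrier_mat (i + m + i) (i + m + i)" and e: "blk (i + m + i) (band_index i m) X = X"
  shows "block i m X a c = (if a = c then block i m X a c else 0\<^sub>m (band_size i m a) (band_size i m c))"
    "X = diag_block_mat [block i m X Top Top, block i m X Mid Mid, block i m X Bot Bot]"
proof -
  show 1: "block i m X a c = (if a = c then block i m X a c else 0\<^sub>m (band_size i m a) (band_size i m c))" for a c
    using block_blk[of i m X a c] unfolding e .
  have c: "block i m X Top Top \<in> carrier_mat i i" "block i m X Mid Mid \<in> carrier_mat m m" "block i m X Bot Bot \<in> carrier_mat i i"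
    using block_carrier[of i m X Top Top] block_carrier[of i m X Mid Mid] block_carrier[of i m X Bot Bot] by simp_all
  show "X = diag_block_mat [block i m X Top Top, block i m X Mid Mid, block i m X Bot Bot]"
  proof (rule block_eqI[OF X block_of_diag3(1)[OF c]])
    fix a c'
    show "block i m X a c' = block i m (diag_block_mat [block i m X Top Top, block i m X Mid Mid, block i m X Bot Bot]) a c'"
      unfolding block_of_diag3(2)[OF c] using 1[of a c'] by (cases a; cases c') simp_all
  qed
qed

lemma diag3_blk:
  fixes A B F :: "'a::field mat"
  assumes "A \<in> carrier_mat i i" "B \<in> carrier_mat m m" "F \<in> carrier_mat i i"
  shows "blk (i + m + i) (band_index i m) (diag_block_mat [A, B, F]) = diag_block_mat [A, B, F]"
proof (rule block_eqI[OF blk_carrier block_of_diag3(1)[OF assms]])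
  fix a c
  show "block i m (blk (i + m + i) (band_index i m) (diag_block_mat [A, B, F])) a c =
      block i m (diag_block_mat [A, B, F]) a c"
    unfolding block_blk block_of_diag3(2)[OF assms] by simp
qed

lemma upper3_if_pat:
  fixes X :: "'a::field mat"
  assumes X: "X \<in> carrier_mat (i + m + i) (i + m + i)" and P: "X \<in> pat (i + m + i) (upper (band_index i m))"
  shows "X = block_upper3 (block i m X Top Top) (block i m X Top Mid) (block i m X Top Bot) (block i m X Mid Mid)
    (block i m X Mid Bot) (block i m X Bot Bot)"
proof -
  have c: "block i m X Top Top \<in> carrier_mat i i" "block i m X Mid Mid \<in> carrier_mat m m" "block i m X Bot Bot \<in> carrier_mat i i"
    "block i m X Top Mid \<in> carrier_mat i m" "block i m X Top Bot \<in> carrier_mat i i" "block i m X Mid Bot \<in> carrier_mat m i"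
    using block_carrier[of i m X Top Top] block_carrier[of i m X Mid Mid] block_carrier[of i m X Bot Bot]
      block_carrier[of i m X Top Mid] block_carrier[of i m X Top Bot] block_carrier[of i m X Mid Bot] by simp_all
  show ?thesis
  proof (rule block_eqI[OF X block_of_upper3(1)[OF c]])
    fix a c'
    show "block i m X a c' = block i m (block_upper3 (block i m X Top Top) (block i m X Top Mid) (block i m X Top Bot)
        (block i m X Mid Mid) (block i m X Mid Bot) (block i m X Bot Bot)) a c'"
      using P unfolding pat_band_iff[OF X] by (cases a; cases c') (simp_all add: block_of_upper3[OF c])
  qed
qed

lemma upper3_pat_blk:
  fixes A B C D E F :: "'a::field mat"
  assumes c: "A \<in> carrier_mat i i" "B \<in> carrier_mat m m" "F \<in> carrier_mat i i"
    "C \<in> carrier_mat i m" "D \<in> carrier_mat i i" "E \<in> carrier_mat m i"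
  shows "block_upper3 A C D B E F \<in> pat (i + m + i) (upper (band_index i m))"
    "blk (i + m + i) (band_index i m) (block_upper3 A C D B E F) = diag_block_mat [A, B, F]"
proof -
  show "block_upper3 A C D B E F \<in> pat (i + m + i) (upper (band_index i m))"
    unfolding pat_band_iff[OF block_of_upper3(1)[OF c]] by (simp add: block_of_upper3[OF c])
  show "blk (i + m + i) (band_index i m) (block_upper3 A C D B E F) = diag_block_mat [A, B, F]"
  proof (rule block_eqI[OF blk_carrier block_of_diag3(1)[OF c(1-3)]])
    fix a c'
    show "block i m (blk (i + m + i) (band_index i m) (block_upper3 A C D B E F)) a c' =
        block i m (diag_block_mat [A, B, F]) a c'"
      unfolding block_blk block_of_diag3(2)[OF c(1-3)] by (cases a; cases c') (simp_all add: block_of_upper3[OF c])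
  qed
qed

lemma mono_band_index: "mono_on S (band_index i m)"
  by (auto simp: mono_on_def band_index_def)

context conjugation
begin

lemma block_dag:
  assumes X: "X \<in> carrier_mat (i + m + i) (i + m + i)"
  shows "block i m (dag X) a c = dag (block i m X (flip c) (flip a))"
proof (rule eq_matI)
  have sz: "band_size i m (flip x) = band_size i m x" for x by (cases x) auto
  have B: "block i m X (flip c) (flip a) \<in> carrier_mat (band_size i m c) (band_size i m a)"
    using block_carrier[of i m X "flip c" "flip a"] by (simp only: sz)
  fix r s assume "r < dim_row (dag (block i m X (flip c) (flip a)))" "s < dim_col (dag (block i m X (flip c) (flip a)))"
  then have rs: "r < band_size i m a" "s < band_size i m c" using dag_carrier[OF B] by auto
  have idx: "i + m + i - 1 - (band_start i m x + t) = band_start i m (flip x) + (band_size i m x - 1 - t)"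
    if "t < band_size i m x" for x t
    using that by (cases x) auto
  have "block i m (dag X) a c $$ (r, s) =
      \<sigma> (X $$ (band_start i m (flip c) + (band_size i m c - 1 - s), band_start i m (flip a) + (band_size i m a - 1 - r)))"
    unfolding block_index[OF rs] dag_index[OF X band_lt[OF rs(1)] band_lt[OF rs(2)]] idx[OF rs(1)] idx[OF rs(2)] ..
  also have "\<dots> = dag (block i m X (flip c) (flip a)) $$ (r, s)"
    unfolding dag_index[OF B rs] using rs by (subst block_index) (simp_all add: sz)
  finally show "block i m (dag X) a c $$ (r, s) = dag (block i m X (flip c) (flip a)) $$ (r, s)" .
qed (cases a; cases c; simp add: block_def dag_def)+

lemma block_dag_mult_diag:
  assumes X: "X \<in> carrier_mat (i + m + i) (i + m + i)"
    and z: "\<And>a c. a \<noteq> c \<Longrightarrow> block i m X a c = 0\<^sub>m (band_size i m a) (band_size i m c)"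
  shows "block i m (dag X * X) a c =
    (if a = c then dag (block i m X (flip a) (flip a)) * block i m X a a else 0\<^sub>m (band_size i m a) (band_size i m c))"
proof -
  have c: "block i m X Top Top \<in> carrier_mat i i" "block i m X Mid Mid \<in> carrier_mat m m" "block i m X Bot Bot \<in> carrier_mat i i"
    using block_carrier[of i m X Top Top] block_carrier[of i m X Mid Mid] block_carrier[of i m X Bot Bot] by simp_all
  have p: "dag (block i m X Bot Bot) * block i m X Top Top \<in> carrier_mat i i"
    "dag (block i m X Mid Mid) * block i m X Mid Mid \<in> carrier_mat m m"
    "dag (block i m X Top Top) * block i m X Bot Bot \<in> carrier_mat i i" using c by simp_all
  note cd = c[THEN dag_carrier]
  show ?thesis
    unfolding block_mult[OF dag_carrier[OF X] X] block_dag[OF X]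
    using c cd p z
    by (cases a; cases c) (simp_all add: right_mult_zero_mat[OF cd(1)] right_mult_zero_mat[OF cd(2)]
        right_mult_zero_mat[OF cd(3)])
qed

section \<open>The unitary setting\<close>

lemma unitary_subgroup: "subgroup (unitary_group q n :: 'a mat set) (GL n)"
proof (rule subgroup_GL_if_closed)
  show "(unitary_group q n :: 'a mat set) \<subseteq> carrier (GL n)" using unitary_iv(1) by blast
  show "(1\<^sub>m n :: 'a mat) \<in> unitary_group q n" by (simp add: unitary_group_iff)
  fix g h :: "'a mat"
  assume "g \<in> unitary_group q n" "h \<in> unitary_group q n"
  then have g: "g \<in> carrier_mat n n" "dag g * g = 1\<^sub>m n" and h: "h \<in> carrier_mat n n" "dag h * h = 1\<^sub>m n"
    by (simp_all add: unitary_group_iff)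
  have "dag (g * h) * (g * h) = dag h * (dag g * g) * h"
    unfolding dag_mult[OF g(1) h(1)] using g(1) h(1) by (simp add: mat_assoc[of _ n])
  then show "g * h \<in> unitary_group q n"
    unfolding g(2) using g(1) h by (simp add: unitary_group_iff)
qed

lemma Ad_uminus:
  fixes X :: "'b::field mat"
  assumes "g \<in> carrier (GL n)" "X \<in> carrier_mat n n"
  shows "Ad n g (- X) = - Ad n g X"
  using GL_dim[OF assms(1)] GL_dim[OF GL_iv[OF assms(1)]] carrier_matD[OF assms(2)]
  by (simp add: Ad_def)

text \<open>With \<open>M = 1 - X\<close> and \<open>k = M\<inverse>\<close>, the Cayley transform \<open>(1 + X) M\<inverse>\<close> is \<open>2 k - 1\<close>. The condition
\<open>dag X = - X\<close> reads \<open>dag M + M = 2\<close>. Multiplying by \<open>dag k\<close> and \<open>k\<close>, this is equivalent to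
\<open>k + dag k = 2 dag k k\<close>, and so is \<open>dag (2 k - 1) (2 k - 1) = 1\<close>.\<close>

lemma Cayley_criterion:
  fixes X :: "'a mat"
  assumes X: "X \<in> carrier_mat n n" and m: "1\<^sub>m n - X \<in> carrier (GL n)"
  defines "k \<equiv> iv n (1\<^sub>m n - X)"
  shows "k + k - 1\<^sub>m n \<in> unitary_group q n \<longleftrightarrow> X \<in> unitary_alg q n"
proof -
  define M where "M = 1\<^sub>m n - X"
  have Mc: "M \<in> carrier_mat n n" "k \<in> carrier_mat n n" and M: "M \<in> carrier (GL n)"
    using m GL_carrier[OF GL_iv[OF m]] by (simp_all add: M_def k_def)
  have kM: "k * M = 1\<^sub>m n" "M * k = 1\<^sub>m n" using M by (simp_all add: k_def M_def)
  have dM: "dag M \<in> carrier_mat n n" "dag k \<in> carrier_mat n n" using Mc by simp_all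
  have dkM: "dag k * dag M = 1\<^sub>m n" "dag M * dag k = 1\<^sub>m n"
    unfolding dag_mult[OF Mc, symmetric] dag_mult[OF Mc(2,1), symmetric] kM by (rule dag_one)+
  define Q where "Q = dag k * k"
  have Qc: "Q \<in> carrier_mat n n" using Mc dM by (simp add: Q_def)
  have "X \<in> unitary_alg q n \<longleftrightarrow> dag M + M = 1\<^sub>m n + 1\<^sub>m n"
  proof -
    have dX: "dag X \<in> carrier_mat n n" using X by simp
    have dMe: "dag M = 1\<^sub>m n - dag X" unfolding M_def using dag_diff[OF one_carrier_mat X] by simp
    have "dag X = - X \<longleftrightarrow> dag M + M = 1\<^sub>m n + 1\<^sub>m n"
    proof
      assume e: "dag X = - X"
      show "dag M + M = 1\<^sub>m n + 1\<^sub>m n" unfolding dMe e unfolding M_def using X by (intro eq_matI) auto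
    next
      assume e: "dag M + M = 1\<^sub>m n + 1\<^sub>m n"
      show "dag X = - X"
      proof (rule eq_matI)
        fix r s assume "r < dim_row (- X)" "s < dim_col (- X)"
        then have rs: "r < n" "s < n" using X by auto
        have "(dag M + M) $$ (r, s) = (1\<^sub>m n + 1\<^sub>m n) $$ (r, s)" using e by simp
        then have "(1\<^sub>m n $$ (r, s) - dag X $$ (r, s)) + (1\<^sub>m n $$ (r, s) - X $$ (r, s)) =
            1\<^sub>m n $$ (r, s) + 1\<^sub>m n $$ (r, s)"
          unfolding dMe unfolding M_def using rs carrier_matD[OF X] carrier_matD[OF dX] by simp
        then show "dag X $$ (r, s) = (- X) $$ (r, s)"
          using rs X by (simp add: algebra_simps eq_neg_iff_add_eq_0)
      qed (use carrier_matD[OF X] carrier_matD[OF dX] in simp_all)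
    qed
    then show ?thesis using X by (simp add: unitary_alg_iff)
  qed
  also have "\<dots> \<longleftrightarrow> k + dag k = Q + Q"
  proof -
    have s: "dag k * (dag M + M) * k = k + dag k"
    proof -
      have "dag k * (dag M + M) = 1\<^sub>m n + dag k * M"
        unfolding mult_add_distrib_mat[OF dM(2) dM(1) Mc(1)] dkM ..
      then have "dag k * (dag M + M) * k = 1\<^sub>m n * k + dag k * M * k"
        using add_mult_distrib_mat[of "1\<^sub>m n" n n "dag k * M" k n] Mc dM by (simp add: mat_assoc[of _ n])
      then show ?thesis using Mc dM kM by (simp add: mat_assoc[of _ n])
    qed
    have t: "dag k * (1\<^sub>m n + 1\<^sub>m n) * k = Q + Q"
    proof -
      have "dag k * (1\<^sub>m n + 1\<^sub>m n) = dag k + dag k"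
        using mult_add_distrib_mat[OF dM(2) one_carrier_mat one_carrier_mat] dM by simp
      then show ?thesis using add_mult_distrib_mat[OF dM(2) dM(2) Mc(2)] by (simp add: Q_def)
    qed
    have back_and_forth: "dag M * (dag k * Z * k) * M = Z" if "Z \<in> carrier_mat n n" for Z
    proof -
      have "dag M * (dag k * Z * k) * M = (dag M * dag k) * Z * (k * M)"
        using that Mc dM by (simp add: mat_assoc[of _ n])
      then show ?thesis using that kM dkM by simp
    qed
    have "dag M + M \<in> carrier_mat n n" "1\<^sub>m n + 1\<^sub>m n \<in> carrier_mat n n" using Mc dM by simp_all
    then show ?thesis unfolding s[symmetric] t[symmetric] using back_and_forth by metis
  qed
  also have "\<dots> \<longleftrightarrow> k + k - 1\<^sub>m n \<in> unitary_group q n"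
  proof -
    define g where "g = k + k - 1\<^sub>m n"
    have gc: "g \<in> carrier_mat n n" unfolding g_def by (rule minus_carrier_mat) simp
    have dg: "dag g = dag k + dag k - 1\<^sub>m n"
      unfolding g_def using dag_diff[of "k + k" n n "1\<^sub>m n"] dag_add[OF Mc(2) Mc(2)] Mc by simp
    have kk: "k + k \<in> carrier_mat n n" "dag k + dag k \<in> carrier_mat n n" using Mc dM by simp_all
    have "dag g * g = dag g * (k + k) - dag g"
      using mult_minus_distrib_mat[OF dag_carrier[OF gc] kk(1) one_carrier_mat] dag_carrier[OF gc]
      by (simp add: g_def)
    also have "dag g * (k + k) = dag g * k + dag g * k"
      by (rule mult_add_distrib_mat[OF dag_carrier[OF gc] Mc(2) Mc(2)])
    also have "dag g * k = (Q + Q) - k"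
      unfolding dg minus_mult_distrib_mat[OF kk(2) one_carrier_mat Mc(2)]
        add_mult_distrib_mat[OF dM(2) dM(2) Mc(2)] Q_def[symmetric] using Mc by simp
    finally have prod: "dag g * g = (Q + Q - k) + (Q + Q - k) - (dag k + dag k - 1\<^sub>m n)"
      unfolding dg .
    have "dag g * g = 1\<^sub>m n \<longleftrightarrow> k + dag k = Q + Q"
    proof
      assume e: "dag g * g = 1\<^sub>m n"
      show "k + dag k = Q + Q"
      proof (rule eq_matI)
        fix r s assume "r < dim_row (Q + Q)" "s < dim_col (Q + Q)"
        then have rs: "r < n" "s < n" using Qc by auto
        let ?x = "Q $$ (r, s)" and ?y = "k $$ (r, s)" and ?z = "dag k $$ (r, s)" and ?o = "1\<^sub>m n $$ (r, s) :: 'a"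
        have "?o = ((Q + Q - k) + (Q + Q - k) - (dag k + dag k - 1\<^sub>m n)) $$ (r, s)"
          using e unfolding prod by simp
        also have "\<dots> = (?x + ?x - ?y) + (?x + ?x - ?y) - (?z + ?z - ?o)"
          using rs carrier_matD[OF Qc] carrier_matD[OF Mc(2)] carrier_matD[OF dM(2)] by simp
        also have "\<dots> = 2 * ((?x + ?x) - (?y + ?z)) + ?o"
          by (simp add: algebra_simps del: index_one_mat)
        finally have "2 * ((?x + ?x) - (?y + ?z)) = 0" by (simp del: index_one_mat mult_eq_0_iff)
        then have "(?x + ?x) - (?y + ?z) = 0" using two_nonzero by (simp only: mult_eq_0_iff) simp
        then show "(k + dag k) $$ (r, s) = (Q + Q) $$ (r, s)"
          using rs carrier_matD[OF Qc] carrier_matD[OF Mc(2)] carrier_matD[OF dM(2)] by simp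
      qed (use carrier_matD[OF Qc] carrier_matD[OF Mc(2)] carrier_matD[OF dM(2)] in simp_all)
    next
      assume e: "k + dag k = Q + Q"
      show "dag g * g = 1\<^sub>m n"
        unfolding prod e[symmetric] using carrier_matD[OF Mc(2)] carrier_matD[OF dM(2)]
        by (intro eq_matI) simp_all
    qed
    then show ?thesis using gc by (simp add: unitary_group_iff g_def)
  qed
  finally show ?thesis by simp
qed

lemma card_unitary_unipotent:
  assumes \<rho>: "\<And>r s. r < n \<Longrightarrow> s < n \<Longrightarrow> \<rho> r s \<Longrightarrow> r < s" "\<And>r s t. \<rho> r s \<Longrightarrow> \<rho> s t \<Longrightarrow> \<rho> r t"
  shows "card {g \<in> unitary_group q n. (g :: 'a mat) - 1\<^sub>m n \<in> pat n \<rho>} = card (unitary_alg q n \<inter> (pat n \<rho> :: 'a mat set))"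
proof -
  let ?K = "{g \<in> carrier_mat n n. (g :: 'a mat) - 1\<^sub>m n \<in> pat n \<rho>}"
  have K: "subgroup ?K (GL n)" using \<rho> by (rule unipotent_subgroup)
  have K_GL: "g \<in> carrier (GL n)" if "g \<in> ?K" for g using subgroup.mem_carrier[OF K that] .
  have K_iv: "iv n g \<in> ?K" if "g \<in> ?K" for g using subgroup.m_inv_closed[OF K that] .
  \<comment> \<open>\<open>h\<close> is one half; the inverse of the Cayley transform is \<open>g \<mapsto> 1 - (h (g + 1))\<inverse>\<close>.\<close>
  obtain h :: 'a where h: "h * 2 = 1" using two_nonzero that[of "1 / 2"] by simp
  have h2x: "2 * (h * x) = x" for x
    using h by (simp add: mult.assoc[symmetric] mult.commute[of 2 h])
  have half: "h * x + h * x = x" for x using h2x[of x] by (simp only: mult_2)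
  have A: "1\<^sub>m n - X \<in> ?K" if "X \<in> pat n \<rho>" for X :: "'a mat"
  proof -
    have c: "X \<in> carrier_mat n n" using that by (rule pat_carrier)
    have "(1\<^sub>m n - X) - 1\<^sub>m n \<in> pat n \<rho>"
      using that c by (auto simp: pat_def minus_carrier_mat)
    then show ?thesis using c by (simp add: minus_carrier_mat)
  qed
  have dbl: "k + k - 1\<^sub>m n \<in> ?K" "h \<cdot>\<^sub>m (k + 1\<^sub>m n) \<in> ?K" if "k \<in> ?K" for k :: "'a mat"
  proof -
    have c: "k \<in> carrier_mat n n" and p: "k - 1\<^sub>m n \<in> pat n \<rho>" using that by simp_all
    have z: "k $$ (r, s) = 1\<^sub>m n $$ (r, s)" if "r < n" "s < n" "\<not> \<rho> r s" for r s
      using pat_zero[OF p that] that(1,2) c by simp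
    have "k + k - 1\<^sub>m n - 1\<^sub>m n \<in> pat n \<rho>"
      using z c by (simp add: pat_def minus_carrier_mat)
    then show "k + k - 1\<^sub>m n \<in> ?K" by (simp add: minus_carrier_mat)
    have "h \<cdot>\<^sub>m (k + 1\<^sub>m n) - 1\<^sub>m n \<in> pat n \<rho>"
      using z c h by (simp add: pat_def minus_carrier_mat distrib_left)
    then show "h \<cdot>\<^sub>m (k + 1\<^sub>m n) \<in> ?K" using c by simp
  qed
  define f where "f X = iv n (1\<^sub>m n - X) + iv n (1\<^sub>m n - X) - 1\<^sub>m n" for X :: "'a mat"
  define f' where "f' g = 1\<^sub>m n - iv n (h \<cdot>\<^sub>m (g + 1\<^sub>m n))" for g :: "'a mat"
  have mm: "1\<^sub>m n - (1\<^sub>m n - Z) = Z" if "Z \<in> carrier_mat n n" for Z :: "'a mat"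
    using that by (intro eq_matI) auto
  have h1: "h \<cdot>\<^sub>m (k + k - 1\<^sub>m n + 1\<^sub>m n) = k" if "k \<in> carrier_mat n n" for k :: "'a mat"
    using that h by (intro eq_matI) (auto simp: distrib_left)
  have h2: "h \<cdot>\<^sub>m (g + 1\<^sub>m n) + h \<cdot>\<^sub>m (g + 1\<^sub>m n) - 1\<^sub>m n = g" if "g \<in> carrier_mat n n" for g :: "'a mat"
    using that by (intro eq_matI) (auto simp: h2x)
  have f'f: "f' (f X) = X" if X: "X \<in> pat n \<rho>" for X :: "'a mat"
  proof -
    have "iv n (1\<^sub>m n - X) \<in> carrier_mat n n" using K_iv[OF A[OF X]] by simp
    then show ?thesis
      unfolding f'_def f_def using h1 iv_iv[OF K_GL[OF A[OF X]]] mm[OF pat_carrier[OF X]] by simp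
  qed
  have f'_mem: "f' g \<in> pat n \<rho>" and ff': "f (f' g) = g" if g: "g \<in> ?K" for g
  proof -
    define k where "k = h \<cdot>\<^sub>m (g + 1\<^sub>m n)"
    have k: "k \<in> ?K" unfolding k_def using g by (rule dbl(2))
    have ik: "iv n k \<in> carrier_mat n n" "iv n k - 1\<^sub>m n \<in> pat n \<rho>" using K_iv[OF k] by simp_all
    have "(1\<^sub>m n - iv n k) $$ (r, s) = 0" if "r < n" "s < n" "\<not> \<rho> r s" for r s
      using pat_zero[OF ik(2) that] that(1,2) ik(1) by simp
    then show "f' g \<in> pat n \<rho>"
      using ik(1) by (simp add: f'_def k_def pat_def minus_carrier_mat)
    show "f (f' g) = g"
      unfolding f_def f'_def k_def[symmetric] mm[OF ik(1)] iv_iv[OF K_GL[OF k]]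
      unfolding k_def using g by (intro h2) simp
  qed
  have f_mem: "f X \<in> unitary_group q n \<longleftrightarrow> X \<in> unitary_alg q n" if X: "X \<in> pat n \<rho>" for X :: "'a mat"
    unfolding f_def by (rule Cayley_criterion[OF pat_carrier[OF X] K_GL[OF A[OF X]]])
  have "bij_betw f (unitary_alg q n \<inter> pat n \<rho>) {g \<in> unitary_group q n. (g :: 'a mat) - 1\<^sub>m n \<in> pat n \<rho>}"
  proof (rule bij_betw_byWitness[where f' = f'])
    show "\<forall>X\<in>unitary_alg q n \<inter> pat n \<rho>. f' (f X) = (X :: 'a mat)" using f'f by blast
    have UK: "g \<in> ?K" if "g \<in> {g \<in> unitary_group q n. g - 1\<^sub>m n \<in> pat n \<rho>}" for g :: "'a mat"
      using that unitary_group_iff[of g n] by simp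
    show "\<forall>g\<in>{g \<in> unitary_group q n. (g :: 'a mat) - 1\<^sub>m n \<in> pat n \<rho>}. f (f' g) = g"
      using ff'[OF UK] by blast
    show "f ` (unitary_alg q n \<inter> pat n \<rho>) \<subseteq> {g \<in> unitary_group q n. (g :: 'a mat) - 1\<^sub>m n \<in> pat n \<rho>}"
    proof (rule image_subsetI)
      fix X :: "'a mat" assume X: "X \<in> unitary_alg q n \<inter> pat n \<rho>"
      then have "f X \<in> ?K" unfolding f_def using dbl(1)[OF K_iv[OF A]] by blast
      then show "f X \<in> {g \<in> unitary_group q n. g - 1\<^sub>m n \<in> pat n \<rho>}" using X f_mem by simp
    qed
    show "f' ` {g \<in> unitary_group q n. (g :: 'a mat) - 1\<^sub>m n \<in> pat n \<rho>} \<subseteq> unitary_alg q n \<inter> pat n \<rho>"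
    proof (rule image_subsetI)
      fix g :: "'a mat" assume g: "g \<in> {g \<in> unitary_group q n. g - 1\<^sub>m n \<in> pat n \<rho>}"
      note m = f'_mem[OF UK[OF g]]
      show "f' g \<in> unitary_alg q n \<inter> pat n \<rho>"
        using f_mem[OF m] m ff'[OF UK[OF g]] g by simp
    qed
  qed
  then show ?thesis by (rule bij_betw_same_card[symmetric])
qed

lemma unitary_graded:
  "graded_matrix_group n (unitary_group q n :: 'a mat set) (unitary_alg q n)
    (\<lambda>b. \<exists>k. \<forall>r<n. b r + b (n - 1 - r) = k)"
proof (rule graded_matrix_group.intro, goal_cases)
  case 1
  show ?case by (rule unitary_subgroup)
next
  case 2
  show ?case by (auto simp: unitary_alg_def)
next
  case 3
  have "(0\<^sub>m n n :: 'a mat) = - 0\<^sub>m n n" by (intro eq_matI) auto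
  then show ?case by (simp add: unitary_alg_iff)
next
  case (4 X Y)
  then have X: "X \<in> carrier_mat n n" "dag X = - X" and Y: "Y \<in> carrier_mat n n" "dag Y = - Y"
    by (simp_all add: unitary_alg_iff)
  have "- X + - Y = - (X + Y)" using X(1) Y(1) by (intro eq_matI) auto
  then show ?case using X Y by (simp add: unitary_alg_iff dag_add[OF X(1) Y(1)])
next
  case (5 X Y)
  then have X: "X \<in> carrier_mat n n" "dag X = - X" and Y: "Y \<in> carrier_mat n n" "dag Y = - Y"
    by (simp_all add: unitary_alg_iff)
  have "- X - - Y = - (X - Y)" using X(1) Y(1) by (intro eq_matI) auto
  then show ?case using X Y by (simp add: unitary_alg_iff dag_diff[OF X(1) Y(1)] minus_carrier_mat)
next
  case (6 g X)
  then have X: "X \<in> carrier_mat n n" "dag X = - X" by (simp_all add: unitary_alg_iff)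
  note g = unitary_iv[OF 6(1)]
  have gc: "g \<in> carrier_mat n n" "dag g \<in> carrier_mat n n" using g(1) by simp_all
  have "dag (Ad n g X) = Ad n g (dag X)"
    unfolding Ad_def g(2) using gc X(1)
    by (simp add: dag_mult[of _ n n _ n] mat_assoc[of _ n])
  also have "\<dots> = - Ad n g X" unfolding X(2) by (rule Ad_uminus[OF g(1) X(1)])
  finally show ?case using g(1) X(1) by (simp add: unitary_alg_iff)
next
  case (7 b g)
  then obtain k where b: "\<And>r. r < n \<Longrightarrow> b r + b (n - 1 - r) = k" by blast
  have g: "g \<in> carrier_mat n n" "dag g * g = 1\<^sub>m n" using 7(2) by (simp_all add: unitary_group_iff)
  have d: "dag (blk n b g) = blk n b (dag g)"
    using b g(1) by (rule blk_dag[symmetric])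
  have p: "dag g \<in> pat n (upper b)"
    using b 7(3) by (rule dag_pat_upper)
  have "dag (blk n b g) * blk n b g = blk n b (dag g * g)"
    unfolding d by (rule blk_mult[OF p 7(3), symmetric])
  then show ?case unfolding g(2) by (simp add: unitary_group_iff)
next
  case (8 b X)
  then obtain k where b: "\<And>r. r < n \<Longrightarrow> b r + b (n - 1 - r) = k" by blast
  have X: "X \<in> carrier_mat n n" "dag X = - X" using 8(2) by (simp_all add: unitary_alg_iff)
  have "dag (blk n b X) = blk n b (dag X)"
    using b X(1) by (rule blk_dag[symmetric])
  also have "\<dots> = blk n b (- X)" unfolding X(2) ..
  also have "\<dots> = - blk n b X" using X(1) by (intro eq_matI) auto
  finally show ?case by (simp add: unitary_alg_iff)
next
  case (9 b p)
  then obtain k where b: "\<And>r. r < n \<Longrightarrow> b r + b (n - 1 - r) = k" by blast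
  have pi: "pinv p permutes {..<n}" using 9(2) by (rule permutes_inv)
  have "b (pinv p r) + b (pinv p (n - 1 - r)) = k" if r: "r < n" for r
    using unitary_pmat_commute[OF 9(2,3), of r] b[of "pinv p r"] r permutes_lt[OF pi, of r] by (simp add: mirror_def)
  then show ?case by auto
next
  case (10 \<rho>)
  show ?case by (rule card_unitary_unipotent[OF 10])
next
  case (11 g)
  show ?case by (rule unitary_bruhat[OF 11])
qed

text \<open>The last diagonal block prescribed in the Levi subgroup, in the form in which the equation
\<open>dag A * F = 1\<close> determines it.\<close>

lemma unitary_levi_corner:
  assumes A: "A \<in> carrier (GL i)"
  shows "antidiag i * iv i (conj_transpose q A) * antidiag i = iv i (dag A)"
proof -
  let ?J = "antidiag i :: 'a mat"
  have J: "?J \<in> carrier (GL i)" by (rule GL_I[of _ i ?J]) simp_all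
  have Ac: "A \<in> carrier_mat i i" using A by simp
  have dA: "dag A \<in> carrier (GL i)" using A by (rule dag_GL(1))
  have c: "conj_transpose q A \<in> carrier_mat i i" using Ac by (rule conj_transpose_carrier)
  have "conj_transpose q A = ?J * (?J * conj_transpose q A * ?J) * ?J"
    using c by (simp add: mat_assoc[of _ i])
  also have "\<dots> = ?J * dag A * ?J" unfolding dag_eq[OF Ac] ..
  finally have e: "conj_transpose q A = ?J * dag A * ?J" .
  have "iv i ?J = ?J" by (rule iv_unique) simp_all
  then have "iv i (conj_transpose q A) = ?J * iv i (dag A) * ?J"
    unfolding e using J dA by (simp add: iv_mult mat_assoc[of _ i])
  then show ?thesis
    using dA by (simp add: mat_assoc[of _ i] antidiag_cancel[OF GL_carrier[OF GL_iv[OF dA]]])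
qed

lemma unitary_radical_corner:
  assumes C: "C \<in> carrier_mat i m" and D: "D \<in> carrier_mat i i"
  shows "antidiag i * D + conj_transpose q D * antidiag i =
      - (antidiag i * C * antidiag m * conj_transpose q C * antidiag i) \<longleftrightarrow>
    D + dag D = - (C * dag C)"
proof -
  let ?J = "antidiag i :: 'a mat" and ?K = "antidiag m :: 'a mat"
  let ?l = "?J * D + conj_transpose q D * ?J" and ?r = "- (?J * C * ?K * conj_transpose q C * ?J)"
  have cD: "conj_transpose q D \<in> carrier_mat i i" using D by (rule conj_transpose_carrier)
  have cC: "conj_transpose q C \<in> carrier_mat m i" using C by (rule conj_transpose_carrier)
  have lc: "?l \<in> carrier_mat i i" using D cD by simp
  have CC: "C * dag C \<in> carrier_mat i i" by (rule mult_carrier_mat[OF C dag_carrier[OF C]])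
  have JC: "?J * C \<in> carrier_mat i m" by (rule mult_carrier_mat[OF antidiag_carrier C])
  have KC: "?K * conj_transpose q C \<in> carrier_mat m i" by (rule mult_carrier_mat[OF antidiag_carrier cC])
  have "?J * C * ?K * conj_transpose q C * ?J = ?J * C * (?K * conj_transpose q C) * ?J"
    unfolding assoc_mult_mat[OF JC antidiag_carrier cC] ..
  also have "\<dots> = ?J * C * dag C"
    unfolding assoc_mult_mat[OF JC KC antidiag_carrier] dag_eq[OF C] ..
  also have "\<dots> = ?J * (C * dag C)"
    by (rule assoc_mult_mat[OF antidiag_carrier C dag_carrier[OF C]])
  finally have r: "?r = - (?J * (C * dag C))" by simp
  have Jr: "?J * ?r = - (C * dag C)"
  proof -
    have "?J * - (?J * (C * dag C)) = - (?J * (?J * (C * dag C)))"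
      by (intro uminus_mult_right_mat) (simp add: antidiag_def)
    then show ?thesis unfolding r antidiag_cancel[OF CC] .
  qed
  have Jl: "?J * ?l = D + dag D"
  proof -
    have "?J * ?l = ?J * (?J * D) + ?J * (conj_transpose q D * ?J)"
      using D cD by (intro mult_add_distrib_mat[of _ i i _ i]) simp_all
    also have "\<dots> = D + dag D"
      unfolding antidiag_cancel[OF D] dag_eq[OF D, symmetric] using cD by (simp add: mat_assoc[of _ i])
    finally show ?thesis .
  qed
  have rc: "?r \<in> carrier_mat i i" unfolding r using CC by simp
  show ?thesis
    unfolding Jl[symmetric] Jr[symmetric] using antidiag_cancel[OF lc] antidiag_cancel[OF rc] by metis
qed

text \<open>The blocks of \<open>dag u * u\<close> above the diagonal are \<open>C + dag E\<close>, \<open>E + dag C\<close> and \<open>D + dag E * E + dag D\<close>.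
The first two vanish together, and they turn the third into the condition on \<open>D\<close>.\<close>

lemma unitary_unipotent_iff:
  assumes C: "C \<in> carrier_mat i m" and D: "D \<in> carrier_mat i i" and E: "E \<in> carrier_mat m i"
  shows "block_upper3 (1\<^sub>m i) C D (1\<^sub>m m) E (1\<^sub>m i) \<in> unitary_group q (i + m + i) \<longleftrightarrow>
    E = - dag C \<and> D + dag D = - (C * dag C)"
proof -
  let ?u = "block_upper3 (1\<^sub>m i) C D (1\<^sub>m m) E (1\<^sub>m i)"
  note b = block_of_upper3[OF one_carrier_mat one_carrier_mat one_carrier_mat C D E]
  note dc = dag_carrier[OF C] dag_carrier[OF D] dag_carrier[OF E]
  have p: "dag E * E \<in> carrier_mat i i" by (rule mult_carrier_mat[OF dc(3) E])
  have prod: "block i m (dag ?u * ?u) a c = block i m (dag ?u) a Top * block i m ?u Top c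
      + block i m (dag ?u) a Mid * block i m ?u Mid c + block i m (dag ?u) a Bot * block i m ?u Bot c" for a c
    by (rule block_mult[OF dag_carrier[OF b(1)] b(1)])
  note zs = left_mult_zero_mat[OF C] left_mult_zero_mat[OF D] left_mult_zero_mat[OF E]
    right_mult_zero_mat[OF dc(1)] right_mult_zero_mat[OF dc(2)] right_mult_zero_mat[OF dc(3)]
    right_mult_one_mat[OF dc(1)] right_mult_one_mat[OF dc(2)] right_mult_one_mat[OF dc(3)]
    left_mult_one_mat[OF C] left_mult_one_mat[OF D] left_mult_one_mat[OF E]
  note simps = prod block_dag[OF b(1)] b(2-) dag_zero dag_one zs
  have blocks: "block i m (dag ?u * ?u) Top Top = 1\<^sub>m i" "block i m (dag ?u * ?u) Mid Mid = 1\<^sub>m m"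
    "block i m (dag ?u * ?u) Bot Bot = 1\<^sub>m i" "block i m (dag ?u * ?u) Mid Top = 0\<^sub>m m i"
    "block i m (dag ?u * ?u) Bot Top = 0\<^sub>m i i" "block i m (dag ?u * ?u) Bot Mid = 0\<^sub>m i m"
    "block i m (dag ?u * ?u) Top Mid = C + dag E" "block i m (dag ?u * ?u) Mid Bot = E + dag C"
    "block i m (dag ?u * ?u) Top Bot = D + dag E * E + dag D"
    using C D E dc p by (simp_all add: simps)
  have uu: "dag ?u * ?u \<in> carrier_mat (i + m + i) (i + m + i)"
    using b(1) by simp
  have "dag ?u * ?u = 1\<^sub>m (i + m + i) \<longleftrightarrow>
      C + dag E = 0\<^sub>m i m \<and> E + dag C = 0\<^sub>m m i \<and> D + dag E * E + dag D = 0\<^sub>m i i"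
  proof
    assume e: "dag ?u * ?u = 1\<^sub>m (i + m + i)"
    have "block i m (dag ?u * ?u) a c = (if a = c then 1\<^sub>m (band_size i m a) else 0\<^sub>m (band_size i m a) (band_size i m c))" for a c
      unfolding e by (rule block_one)
    from this[of Top Mid] this[of Mid Bot] this[of Top Bot]
    show "C + dag E = 0\<^sub>m i m \<and> E + dag C = 0\<^sub>m m i \<and> D + dag E * E + dag D = 0\<^sub>m i i"
      unfolding blocks by simp
  next
    assume A: "C + dag E = 0\<^sub>m i m \<and> E + dag C = 0\<^sub>m m i \<and> D + dag E * E + dag D = 0\<^sub>m i i"
    show "dag ?u * ?u = 1\<^sub>m (i + m + i)"
    proof (rule block_eqI[OF uu one_carrier_mat])
      fix a c
      show "block i m (dag ?u * ?u) a c = block i m (1\<^sub>m (i + m + i)) a c"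
        unfolding block_one by (cases a; cases c) (simp_all add: blocks A)
    qed
  qed
  also have "\<dots> \<longleftrightarrow> E = - dag C \<and> D + dag D = - (C * dag C)"
  proof -
    have CC: "C * dag C \<in> carrier_mat i i" by (rule mult_carrier_mat[OF C dc(1)])
    have E2: "E + dag C = 0\<^sub>m m i \<longleftrightarrow> E = - dag C" by (rule mat_add_eq_zero_iff[OF E dc(1)])
    have "C + dag E = 0\<^sub>m i m \<and> D + dag E * E + dag D = 0\<^sub>m i i \<longleftrightarrow> D + dag D = - (C * dag C)"
      if E_eq: "E = - dag C"
    proof -
      have dE: "dag E = - C" unfolding E_eq dag_uminus by simp
      have "C + dag E = 0\<^sub>m i m" unfolding dE using C by (intro eq_matI) auto
      moreover have "dag E * E = C * dag C"
        unfolding dE unfolding E_eq using carrier_matD[OF C] carrier_matD[OF dc(1)] by simp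
      moreover have "X + Y + Z = (X + Z) + Y"
        if "X \<in> carrier_mat i i" "Y \<in> carrier_mat i i" "Z \<in> carrier_mat i i" for X Y Z :: "'a mat"
        using that by (intro eq_matI) auto
      then have "D + C * dag C + dag D = (D + dag D) + C * dag C"
        using D CC dc(2) by blast
      ultimately show ?thesis using mat_add_eq_zero_iff[of "D + dag D" i i "C * dag C"] D dc(2) CC by simp
    qed
    then show ?thesis using E2 by blast
  qed
  finally show ?thesis using b(1) by (simp add: unitary_group_iff)
qed

text \<open>For a block-diagonal unitary matrix with blocks \<open>A\<close>, \<open>B\<close>, \<open>F\<close> the conditions are \<open>dag A * F = 1\<close> and
\<open>B\<close> unitary. For the radical they are those of \<open>unitary_unipotent_iff\<close>.\<close>

lemma unitary_parabolic_eq: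
  "(unitary_parabolic q i j :: 'a parabolic) =
    graded_matrix_group.parab (2 * (i + j)) (unitary_group q (2 * (i + j))) (unitary_alg q (2 * (i + j)))
      (band_index i (2 * j))"
proof -
  define m where "m = 2 * j"
  have n: "2 * (i + j) = i + m + i" by (simp add: m_def)
  let ?n = "i + m + i" and ?b = "band_index i m"
  interpret gm: graded_matrix_group ?n "unitary_group q ?n :: 'a mat set" "unitary_alg q ?n"
    "\<lambda>b. \<exists>k. \<forall>r<?n. b r + b (?n - 1 - r) = k"
    by (rule unitary_graded)
  have one3: "diag_block_mat [1\<^sub>m i, 1\<^sub>m m, 1\<^sub>m i] = (1\<^sub>m ?n :: 'a mat)"
  proof (rule block_eqI[OF block_of_diag3(1)[OF one_carrier_mat one_carrier_mat one_carrier_mat] one_carrier_mat])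
    fix a c
    show "block i m (diag_block_mat [1\<^sub>m i, 1\<^sub>m m, 1\<^sub>m i]) a c = block i m (1\<^sub>m ?n :: 'a mat) a c"
      unfolding block_one block_of_diag3(2)[OF one_carrier_mat one_carrier_mat one_carrier_mat] by (cases a; cases c) simp_all
  qed
  have zero3: "diag_block_mat [0\<^sub>m i i, 0\<^sub>m m m, 0\<^sub>m i i] = (0\<^sub>m ?n ?n :: 'a mat)"
  proof (rule block_eqI[OF block_of_diag3(1)[OF zero_carrier_mat zero_carrier_mat zero_carrier_mat] zero_carrier_mat])
    fix a c
    show "block i m (diag_block_mat [0\<^sub>m i i, 0\<^sub>m m m, 0\<^sub>m i i]) a c = block i m (0\<^sub>m ?n ?n :: 'a mat) a c"
      unfolding block_zero block_of_diag3(2)[OF zero_carrier_mat zero_carrier_mat zero_carrier_mat] by (cases a; cases c) simp_all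
  qed
  have bc: "block i m X Top Top \<in> carrier_mat i i" "block i m X Mid Mid \<in> carrier_mat m m" "block i m X Bot Bot \<in> carrier_mat i i"
    "block i m X Top Mid \<in> carrier_mat i m" "block i m X Top Bot \<in> carrier_mat i i" "block i m X Mid Bot \<in> carrier_mat m i"
    for X :: "'a mat"
    using block_carrier[of i m X Top Top] block_carrier[of i m X Mid Mid] block_carrier[of i m X Bot Bot]
      block_carrier[of i m X Top Mid] block_carrier[of i m X Top Bot] block_carrier[of i m X Mid Bot] by simp_all
  have La: "gm.La ?b = unitary_alg q ?n \<inter> {diag_block_mat [A, B, F] | A B F.
      A \<in> carrier_mat i i \<and> B \<in> carrier_mat m m \<and> F \<in> carrier_mat i i}"
  proof (intro equalityI subsetI)
    fix X :: "'a mat" assume "X \<in> gm.La ?b"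
    then have X: "X \<in> unitary_alg q ?n" "X \<in> carrier_mat ?n ?n" "blk ?n ?b X = X"
      by (simp_all add: gm.La_def gm.Pa_def pat_def)
    then show "X \<in> unitary_alg q ?n \<inter> {diag_block_mat [A, B, F] | A B F.
        A \<in> carrier_mat i i \<and> B \<in> carrier_mat m m \<and> F \<in> carrier_mat i i}"
      using blk_band_diag(2)[OF X(2,3)] bc[of X] by blast
  next
    fix X :: "'a mat" assume "X \<in> unitary_alg q ?n \<inter> {diag_block_mat [A, B, F] | A B F.
        A \<in> carrier_mat i i \<and> B \<in> carrier_mat m m \<and> F \<in> carrier_mat i i}"
    then obtain A B F where X: "X \<in> unitary_alg q ?n" "X = diag_block_mat [A, B, F]"
      "A \<in> carrier_mat i i" "B \<in> carrier_mat m m" "F \<in> carrier_mat i i" by blast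
    have e: "blk ?n ?b X = X" unfolding X(2) by (rule diag3_blk[OF X(3-5)])
    then have "X \<in> pat ?n (upper ?b)" using blk_upper[of ?n ?b X] by simp
    then show "X \<in> gm.La ?b" using X(1) e by (simp add: gm.La_def gm.Pa_def)
  qed
  have Ua: "gm.Ua ?b = unitary_alg q ?n \<inter> {block_upper3 (0\<^sub>m i i) C D (0\<^sub>m m m) E (0\<^sub>m i i) | C D E.
      C \<in> carrier_mat i m \<and> D \<in> carrier_mat i i \<and> E \<in> carrier_mat m i}"
  proof (intro equalityI subsetI)
    fix X :: "'a mat" assume "X \<in> gm.Ua ?b"
    then have X: "X \<in> unitary_alg q ?n" "X \<in> carrier_mat ?n ?n" "X \<in> pat ?n (upper ?b)" "blk ?n ?b X = 0\<^sub>m ?n ?n"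
      by (simp_all add: gm.Ua_def gm.Pa_def pat_def)
    have "block i m X a a = 0\<^sub>m (band_size i m a) (band_size i m a)" for a
      using block_blk[of i m X a a] unfolding X(4) block_zero by simp
    from upper3_if_pat[OF X(2,3)] this[of Top] this[of Mid] this[of Bot]
    have "X = block_upper3 (0\<^sub>m i i) (block i m X Top Mid) (block i m X Top Bot) (0\<^sub>m m m) (block i m X Mid Bot) (0\<^sub>m i i)"
      by simp
    then show "X \<in> unitary_alg q ?n \<inter> {block_upper3 (0\<^sub>m i i) C D (0\<^sub>m m m) E (0\<^sub>m i i) | C D E.
        C \<in> carrier_mat i m \<and> D \<in> carrier_mat i i \<and> E \<in> carrier_mat m i}"
      using X(1) bc[of X] by blast
  next
    fix X :: "'a mat" assume "X \<in> unitary_alg q ?n \<inter> {block_upper3 (0\<^sub>m i i) C D (0\<^sub>m m m) E (0\<^sub>m i i) | C D E.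
        C \<in> carrier_mat i m \<and> D \<in> carrier_mat i i \<and> E \<in> carrier_mat m i}"
    then obtain C D E where X: "X \<in> unitary_alg q ?n" "X = block_upper3 (0\<^sub>m i i) C D (0\<^sub>m m m) E (0\<^sub>m i i)"
      "C \<in> carrier_mat i m" "D \<in> carrier_mat i i" "E \<in> carrier_mat m i" by blast
    have "X \<in> pat ?n (upper ?b)" "blk ?n ?b X = 0\<^sub>m ?n ?n"
      unfolding X(2) zero3[symmetric]
      by (rule upper3_pat_blk[OF zero_carrier_mat zero_carrier_mat zero_carrier_mat X(3-5)])+
    then show "X \<in> gm.Ua ?b" using X(1) by (simp add: gm.Ua_def gm.Pa_def)
  qed
  have Ug: "gm.Ug ?b = {block_upper3 (1\<^sub>m i) C D (1\<^sub>m m) C' (1\<^sub>m i) | C D C'.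
      C \<in> carrier_mat i m \<and> D \<in> carrier_mat i i \<and>
      C' = - (antidiag m * conj_transpose q C * antidiag i) \<and>
      antidiag i * D + conj_transpose q D * antidiag i =
        - (antidiag i * C * antidiag m * conj_transpose q C * antidiag i)}" (is "_ = ?R")
  proof (intro equalityI subsetI)
    fix X :: "'a mat" assume "X \<in> gm.Ug ?b"
    then have X: "X \<in> unitary_group q ?n" "X \<in> carrier_mat ?n ?n" "X \<in> pat ?n (upper ?b)" "blk ?n ?b X = 1\<^sub>m ?n"
      by (simp_all add: gm.Ug_def gm.Pg_def pat_def)
    have "block i m X a a = 1\<^sub>m (band_size i m a)" for a
      using block_blk[of i m X a a] unfolding X(4) block_one by simp
    from upper3_if_pat[OF X(2,3)] this[of Top] this[of Mid] this[of Bot]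
    have e: "X = block_upper3 (1\<^sub>m i) (block i m X Top Mid) (block i m X Top Bot) (1\<^sub>m m) (block i m X Mid Bot) (1\<^sub>m i)"
      by simp
    have u: "block i m X Mid Bot = - dag (block i m X Top Mid) \<and>
        block i m X Top Bot + dag (block i m X Top Bot) = - (block i m X Top Mid * dag (block i m X Top Mid))"
      using unitary_unipotent_iff[OF bc(4-6)] X(1) e by metis
    let ?C = "block i m X Top Mid" and ?D = "block i m X Top Bot"
    have "block i m X Mid Bot = - (antidiag m * conj_transpose q ?C * antidiag i)"
      unfolding dag_eq[OF bc(4)] using u by blast
    moreover have "antidiag i * ?D + conj_transpose q ?D * antidiag i =
        - (antidiag i * ?C * antidiag m * conj_transpose q ?C * antidiag i)"
      unfolding unitary_radical_corner[OF bc(4,5)] using u by blast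
    ultimately show "X \<in> ?R" using e bc(4,5)[of X] by blast
  next
    fix X :: "'a mat" assume "X \<in> ?R"
    then obtain C D C' where C: "C \<in> carrier_mat i m" and D: "D \<in> carrier_mat i i"
      and X: "X = block_upper3 (1\<^sub>m i) C D (1\<^sub>m m) C' (1\<^sub>m i)"
      and C': "C' = - (antidiag m * conj_transpose q C * antidiag i)"
      and e: "antidiag i * D + conj_transpose q D * antidiag i =
        - (antidiag i * C * antidiag m * conj_transpose q C * antidiag i)" by blast
    have C'2: "C' = - dag C" unfolding C' dag_eq[OF C] ..
    have C'c: "C' \<in> carrier_mat m i" unfolding C'2 using dag_carrier[OF C] by simp
    have "X \<in> unitary_group q ?n"
      unfolding X unitary_unipotent_iff[OF C D C'c] using C'2 e unfolding unitary_radical_corner[OF C D] by blast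
    moreover have "X \<in> pat ?n (upper ?b)" "blk ?n ?b X = 1\<^sub>m ?n"
      unfolding X one3[symmetric]
      by (rule upper3_pat_blk[OF one_carrier_mat one_carrier_mat one_carrier_mat C D C'c])+
    ultimately show "X \<in> gm.Ug ?b" by (simp add: gm.Ug_def gm.Pg_def)
  qed
  have Lg: "gm.Lg ?b = {diag_block_mat [A, B, antidiag i * iv i (conj_transpose q A) * antidiag i] | A B.
      A \<in> carrier (GL i) \<and> B \<in> unitary_group q m}" (is "_ = ?R")
  proof (intro equalityI subsetI)
    fix X :: "'a mat" assume "X \<in> gm.Lg ?b"
    then have X: "X \<in> unitary_group q ?n" "X \<in> carrier_mat ?n ?n" "blk ?n ?b X = X"
      by (simp_all add: gm.Lg_def gm.Pg_def pat_def)
    let ?A = "block i m X Top Top" and ?B = "block i m X Mid Mid" and ?F = "block i m X Bot Bot"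
    have z: "block i m X a c = 0\<^sub>m (band_size i m a) (band_size i m c)" if "a \<noteq> c" for a c
      using blk_band_diag(1)[OF X(2,3), of a c] that by simp
    have XX: "dag X * X = 1\<^sub>m ?n" using X(1) by (simp add: unitary_group_iff)
    have d: "dag (block i m X (flip a) (flip a)) * block i m X a a = 1\<^sub>m (band_size i m a)" for a
      using block_dag_mult_diag[OF X(2) z, of a a] unfolding XX block_one by simp
    have A: "?A \<in> carrier (GL i)"
      using d[of Top] by (intro GL_I[OF bc(1) dag_carrier[OF bc(3)[of X]]]) simp
    have B: "?B \<in> unitary_group q m"
      using d[of Mid] bc(2)[of X] by (simp add: unitary_group_iff)
    have "dag ?A * ?F = 1\<^sub>m i" using d[of Bot] by simp
    then have "?F * dag ?A = 1\<^sub>m i"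
      by (rule mat_mult_left_right_inverse[OF dag_carrier[OF bc(1)] bc(3)])
    then have "iv i (dag ?A) = ?F"
      by (rule iv_unique[OF dag_carrier[OF bc(1)] bc(3)])
    then have "X = diag_block_mat [?A, ?B, antidiag i * iv i (conj_transpose q ?A) * antidiag i]"
      unfolding unitary_levi_corner[OF A] using blk_band_diag(2)[OF X(2,3)] by simp
    then show "X \<in> ?R" using A B by blast
  next
    fix X :: "'a mat" assume "X \<in> ?R"
    then obtain A B where A: "A \<in> carrier (GL i)" and B: "B \<in> unitary_group q m"
      and "X = diag_block_mat [A, B, antidiag i * iv i (conj_transpose q A) * antidiag i]" by blast
    then have X: "X = diag_block_mat [A, B, iv i (dag A)]" by (simp add: unitary_levi_corner[OF A])
    have dA: "dag A \<in> carrier (GL i)" using A by (rule dag_GL(1))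
    have Bc: "B \<in> carrier_mat m m" "dag B * B = 1\<^sub>m m" using B by (simp_all add: unitary_group_iff)
    have c: "A \<in> carrier_mat i i" "B \<in> carrier_mat m m" "iv i (dag A) \<in> carrier_mat i i"
      using A dA Bc by simp_all
    have Xc: "X \<in> carrier_mat ?n ?n" unfolding X by (rule block_of_diag3(1)[OF c])
    have bX: "block i m X a c' = (if a = c' then (case a of Top \<Rightarrow> A | Mid \<Rightarrow> B | Bot \<Rightarrow> iv i (dag A))
        else 0\<^sub>m (band_size i m a) (band_size i m c'))" for a c'
      unfolding X by (rule block_of_diag3(2)[OF c])
    have z: "block i m X a c' = 0\<^sub>m (band_size i m a) (band_size i m c')" if "a \<noteq> c'" for a c'
      using bX[of a c'] that by simp
    have corner: "dag (iv i (dag A)) = iv i A"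
      using dag_GL(2)[OF dA] by simp
    have d: "dag (block i m X (flip a) (flip a)) * block i m X a a = 1\<^sub>m (band_size i m a)" for a
      using A dA Bc by (cases a) (simp_all add: bX corner)
    have "dag X * X = 1\<^sub>m ?n"
    proof (rule block_eqI)
      show "dag X * X \<in> carrier_mat ?n ?n" using Xc by simp
      fix a c'
      show "block i m (dag X * X) a c' = block i m (1\<^sub>m ?n) a c'"
        using block_dag_mult_diag[OF Xc z, of a c'] unfolding d block_one .
    qed simp
    then have "X \<in> unitary_group q ?n" using Xc by (simp add: unitary_group_iff)
    moreover have e: "blk ?n ?b X = X" unfolding X by (rule diag3_blk[OF c])
    moreover have "X \<in> pat ?n (upper ?b)" using blk_upper[of ?n ?b X] e by simp
    ultimately show "X \<in> gm.Lg ?b" by (simp add: gm.Lg_def gm.Pg_def)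
  qed
  show ?thesis
    unfolding unitary_parabolic_def n m_def[symmetric] gm.parab_def La Ua Ug Lg ..
qed

end

section \<open>The Mackey formula in the two settings\<close>

theorem theorem9:
  fixes q N :: nat
    and G GG W D R :: "'a::{field,finite} mat set"
    and S :: "'a mat \<Rightarrow> 'a mat set"
    and P P' :: "'a parabolic"
    and \<Phi> :: "'a mat \<Rightarrow> real"
  assumes q: "primepow q"
    and setting:
      "(\<exists>n i j i' j'. CARD('a) = q \<and> i + j = n \<and> i' + j' = n \<and> N = n \<and>
          G = carrier (GL n) \<and> GG = carrier_mat n n \<and> W = perm_mats n \<and>
          P = GL_parabolic i j \<and> P' = GL_parabolic i' j')
       \<or>
       (\<exists>n i j i' j'. CARD('a) = q\<^sup>2 \<and> odd q \<and> i + j = n \<and> i' + j' = n \<and> N = 2 * n \<and>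
          G = unitary_group q (2 * n) \<and> GG = unitary_alg q (2 * n) \<and>
          W = perm_mats (2 * n) \<inter> G \<and>
          P = unitary_parabolic q i j \<and> P' = unitary_parabolic q i' j')"
    and D: "double_coset_reps N D (W \<inter> levi P') W (W \<inter> levi P)"
    and R: "left_coset_reps N R G (par_group N P)"
    and S: "\<And>w. w \<in> D \<Longrightarrow> left_coset_reps N (S w) (levi P') (par_group N (par_cut N P' P w))"
    and \<Phi>: "\<Phi> \<in> invariant_funs N (levi P) (levi_alg P)"
  shows "(par_res P' \<circ> par_ind N R GG P) \<Phi> =
    (\<lambda>X\<in>levi_alg P'. \<Sum>w\<in>D.
       (par_ind N (S w) (levi_alg P') (par_cut N P' P w)
        \<circ> transport N (levi_alg (par_cut N P' P w)) w
        \<circ> par_res (par_cut N P P' (inv\<^bsub>GL N\<^esub> w))) \<Phi> X)"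
proof -
  obtain adm b b' where gm: "graded_matrix_group N G GG adm"
    and b: "adm b" "mono_on {..<N} b" "P = graded_matrix_group.parab N G GG b"
    and b': "adm b'" "mono_on {..<N} b'" "P' = graded_matrix_group.parab N G GG b'"
    and W: "W = perm_mats N \<inter> G"
    using setting
  proof (elim disjE exE conjE)
    fix n i j i' j'
    assume s: "i + j = n" "i' + j' = n" "N = n" "G = carrier (GL n)" "GG = carrier_mat n n"
      "W = perm_mats n" "P = GL_parabolic i j" "P' = GL_parabolic i' j'"
    show thesis
    proof (rule that[of "\<lambda>_. True" "\<lambda>r. if r < i then 0 else 1" "\<lambda>r. if r < i' then 0 else 1"])
      show "graded_matrix_group N G GG (\<lambda>_. True)" unfolding s(3-5) by (rule GL_graded)
      show "P = graded_matrix_group.parab N G GG (\<lambda>r. if r < i then 0 else 1)"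
        using GL_parabolic_eq[where ?'a = 'a, of i j] s by simp
      show "P' = graded_matrix_group.parab N G GG (\<lambda>r. if r < i' then 0 else 1)"
        using GL_parabolic_eq[where ?'a = 'a, of i' j'] s by simp
      show "W = perm_mats N \<inter> G" unfolding s(3,4,6) perm_mats_eq by auto
    qed (auto simp: mono_on_def)
  next
    fix n i j i' j'
    assume card: "CARD('a) = q\<^sup>2" "odd q"
      and s: "i + j = n" "i' + j' = n" "N = 2 * n" "G = unitary_group q (2 * n)" "GG = unitary_alg q (2 * n)"
      "W = perm_mats (2 * n) \<inter> G" "P = unitary_parabolic q i j" "P' = unitary_parabolic q i' j'"
    interpret conjugation q "\<lambda>x :: 'a. x ^ q" by (rule conjugation_if_card[OF q card(2,1)])
    have sym: "\<exists>k. \<forall>r<2 * (u + v). band_index u (2 * v) r + band_index u (2 * v) (2 * (u + v) - 1 - r) = k" for u v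
    proof -
      have "2 * (u + v) = u + 2 * v + u" by simp
      then show ?thesis using band_index_symmetric[of _ u "2 * v"] by metis
    qed
    show thesis
    proof (rule that[of "\<lambda>b. \<exists>k. \<forall>r<2 * n. b r + b (2 * n - 1 - r) = k" "band_index i (2 * j)" "band_index i' (2 * j')"])
      show "graded_matrix_group N G GG (\<lambda>b. \<exists>k. \<forall>r<2 * n. b r + b (2 * n - 1 - r) = k)"
        unfolding s(3-5) by (rule unitary_graded)
      show "\<exists>k. \<forall>r<2 * n. band_index i (2 * j) r + band_index i (2 * j) (2 * n - 1 - r) = k"
        unfolding s(1)[symmetric] by (rule sym)
      show "\<exists>k. \<forall>r<2 * n. band_index i' (2 * j') r + band_index i' (2 * j') (2 * n - 1 - r) = k"
        unfolding s(2)[symmetric] by (rule sym)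
      show "P = graded_matrix_group.parab N G GG (band_index i (2 * j))"
        unfolding s(3-5,7) s(1)[symmetric] by (rule unitary_parabolic_eq)
      show "P' = graded_matrix_group.parab N G GG (band_index i' (2 * j'))"
        unfolding s(3-5,8) s(2)[symmetric] by (rule unitary_parabolic_eq)
      show "W = perm_mats N \<inter> G" using s by simp
    qed (rule mono_band_index)+
  qed
  interpret graded_matrix_group N G GG adm by (rule gm)
  have levi: "levi P = Lg b" "levi_alg P = La b" "levi P' = Lg b'" "levi_alg P' = La b'"
    by (simp_all add: b(3) b'(3) parab_def)
  show ?thesis
    using mackey_formula[OF b(1,2) b'(1,2) W D[unfolded levi] R[unfolded b(3)] S[unfolded levi, unfolded b(3) b'(3)]
        \<Phi>[unfolded levi]]
    unfolding levi unfolding b(3) b'(3) .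
qed

end
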